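(* Let $V$ be a countable-dimensional complex vector space and $\mathbf{V}=\mathrm{Hom}_{\mathbb{C}}(V,\mathbb{C})$, with the topologies and the tensor products $\widehat{\otimes}^*,\widehat{\otimes}^!$ described in the context, and let $p,q\in\mathbb{Z}_{\ge0}$. One has canonical isomorphisms: (a) $\mathbf{V}^{p,q}=V^{\widehat{\otimes}^* p}\,\widehat{\otimes}^*\,\mathbf{V}^{\widehat{\otimes}^* q}$; (b) $\widehat{\mathbf{V}}^{p,q}=V^{\widehat{\otimes}^! p}\,\widehat{\otimes}^!\,\mathbf{V}^{\widehat{\otimes}^! q}$; (c) $V\,\widehat{\otimes}^!\,\mathbf{V}\cong\mathfrak{gl}(V)$.
   Context: Vector spaces are over $\mathbb{C}$ (with $\mathbb{C}$ discrete) and topologies on vector spaces are linear. Fix a basis $\{v_i\}_{i\in\mathbb{Z}_{>0}}$ of $V$ and let $V_i$ be the span of $v_1,\dots,v_i$. $V$ and $V^{\otimes p}$ carry the discrete topology; the duals $\mathbf{V}=\varprojlim V_i^*$ and $(V^{\otimes q})^*=\mathrm{Hom}_{\mathbb{C}}(V^{\otimes q},\mathbb{C})=\varprojlim(V_i^{\otimes q})^*$ carry the projective limit topology of discrete finite-dimensional spaces. $\mathbf{V}^{p,q}:=V^{\otimes p}\otimes(V^{\otimes q})^*=\bigcup_i V_i^{\otimes p}\otimes(V^{\otimes q})^*$ carries the inductive limit linear topology: a linear subspace is open iff its intersection with each $V_i^{\otimes p}\otimes(V^{\otimes q})^*$ is open there. $\widehat{\mathbf{V}}^{p,q}:=(\mathbf{V}^{q,p})^*$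 is the continuous dual, i.e. $\widehat{\mathbf{V}}^{p,q}=\varprojlim_i\mathrm{Hom}_{\mathbb{C}}(V_i^{\otimes q},V^{\otimes p})$ with the projective limit topology of the discrete spaces $\mathrm{Hom}_{\mathbb{C}}(V_i^{\otimes q},V^{\otimes p})$. $\mathfrak{gl}(V)$ is the Lie algebra of all linear endomorphisms of $V$, topologized as $\mathrm{End}\,V=\varprojlim_i\mathrm{Hom}_{\mathbb{C}}(V_i,V)$ with each $\mathrm{Hom}_{\mathbb{C}}(V_i,V)$ discrete. All isomorphisms are of topological vector spaces. Let $W_1,W_2$ be vector spaces with linear topologies. $W_1\otimes^* W_2$ is $W_1\otimes W_2$ with the linear topology in which a subspace $E$ is open iff: there are open subspaces $P_1\subset W_1$, $P_2\subset W_2$ with $P_1\otimes P_2\subset E$; for every $w_1\in W_1$ there is an open subspace $Q_{w_1}\subset W_2$ with $w_1\otimes Q_{w_1}\subset E$; and for every $w_2\in W_2$ there is an open subspace $Q_{w_2}\subset W_1$ with $Q_{w_2}\otimes w_2\subset E$. $W_1\otimes^! W_2$ is $W_1\otimes W_2$ with the linear topology in which a subspace $E$ is open iff there are open subspaces $P_1\subset W_1$, $P_2\subset W_2$ with $P_1\otimes W_2+W_1\otimes P_2\subset E$. $W_1\widehat{\otimes}^*W_2$ and $W_1\widehat{\otimes}^!W_2$ denote the respective completions; both operations are associative and commutative, and $W^{\widehat{\otimes}^* p}$, $W^{\widehat{\otimes}^! p}$ denote the $p$-fold products. *)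

theory Defs
  imports
    "HOL-Analysis.Analysis"
    "HOL-Library.Function_Algebras"
    "HOL-Library.Poly_Mapping"
begin

section \<open>Complex vector spaces\<close>

class scaleC =
  fixes scaleC :: "complex \<Rightarrow> 'a \<Rightarrow> 'a"  (infixr "*\<^sub>C" 75)

class complex_vector = scaleC + ab_group_add +
  assumes scaleC_add_right: "a *\<^sub>C (x + y) = a *\<^sub>C x + a *\<^sub>C y"
    and scaleC_add_left: "(a + b) *\<^sub>C x = a *\<^sub>C x + b *\<^sub>C x"
    and scaleC_scaleC: "a *\<^sub>C (b *\<^sub>C x) = (a * b) *\<^sub>C x"
    and scaleC_one: "1 *\<^sub>C x = x"

global_interpretation complex_vector: vector_space "scaleC :: complex \<Rightarrow> 'a \<Rightarrow> 'a::complex_vector"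
  by unfold_locales
    (simp_all add: scaleC_add_right scaleC_add_left scaleC_scaleC scaleC_one)

instantiation complex :: complex_vector
begin
definition scaleC_complex :: "complex \<Rightarrow> complex \<Rightarrow> complex" where
  "scaleC_complex c x = c * x"
instance by standard (simp_all add: scaleC_complex_def algebra_simps)
end

instantiation "fun" :: (type, complex_vector) complex_vector
begin
definition scaleC_fun :: "complex \<Rightarrow> ('a \<Rightarrow> 'b) \<Rightarrow> 'a \<Rightarrow> 'b" where
  "scaleC_fun c f = (\<lambda>x. c *\<^sub>C f x)"
instance
  by standard
    (simp_all add: scaleC_fun_def fun_eq_iff scaleC_add_right scaleC_add_left
      scaleC_scaleC scaleC_one)
end

instantiation poly_mapping :: (type, complex_vector) complex_vector
begin
lift_definition scaleC_poly_mapping :: "complex \<Rightarrow> ('a \<Rightarrow>\<^sub>0 'b) \<Rightarrow> ('a \<Rightarrow>\<^sub>0 'b)"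
  is "\<lambda>c f x. c *\<^sub>C f x"
  by (erule rev_finite_subset) (auto simp: complex_vector.scale_zero_right)
instance
  by standard
    (transfer, simp add: fun_eq_iff scaleC_add_right scaleC_add_left scaleC_scaleC scaleC_one)+
end

definition linear_on :: "'a::complex_vector set \<Rightarrow> ('a \<Rightarrow> 'b::complex_vector) \<Rightarrow> bool" where
  "linear_on S f \<longleftrightarrow>
     (\<forall>x\<in>S. \<forall>y\<in>S. f (x + y) = f x + f y) \<and> (\<forall>c. \<forall>x\<in>S. f (c *\<^sub>C x) = c *\<^sub>C f x)"

text \<open>Linear maps \<open>S \<rightarrow> X\<close> between subspaces of two types, extended by zero off \<open>S\<close> so that
  each map is represented exactly once.\<close>

definition Hom :: "'a::complex_vector set \<Rightarrow> 'b::complex_vector set \<Rightarrow> ('a \<Rightarrow> 'b) set" where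
  "Hom S X = {f. linear_on S f \<and> f ` S \<subseteq> X \<and> (\<forall>x. x \<notin> S \<longrightarrow> f x = 0)}"


section \<open>Algebraic tensor products\<close>

definition tensor_relations :: "('a::complex_vector \<times> 'b::complex_vector \<Rightarrow>\<^sub>0 complex) set" where
  "tensor_relations =
     {Poly_Mapping.single (a + a', b) 1 - Poly_Mapping.single (a, b) 1
        - Poly_Mapping.single (a', b) 1 | a a' b. True}
   \<union> {Poly_Mapping.single (a, b + b') 1 - Poly_Mapping.single (a, b) 1
        - Poly_Mapping.single (a, b') 1 | a b b'. True}
   \<union> {Poly_Mapping.single (c *\<^sub>C a, b) 1 - Poly_Mapping.single (a, b) c | c a b. True}
   \<union> {Poly_Mapping.single (a, c *\<^sub>C b) 1 - Poly_Mapping.single (a, b) c | c a b. True}"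

lemma equivp_span: "equivp (\<lambda>x y. x - y \<in> complex_vector.span R)"
proof (rule equivpI)
  show "reflp (\<lambda>x y. x - y \<in> complex_vector.span R)"
    by (simp add: reflp_def complex_vector.span_zero)
  show "symp (\<lambda>x y. x - y \<in> complex_vector.span R)"
    using complex_vector.span_neg by (fastforce simp: symp_def)
  show "transp (\<lambda>x y. x - y \<in> complex_vector.span R)"
    using complex_vector.span_add by (fastforce simp: transp_def)
qed

quotient_type (overloaded) ('a, 'b) tensor =
    "('a::complex_vector \<times> 'b::complex_vector) \<Rightarrow>\<^sub>0 complex"
  / "\<lambda>x y. x - y \<in> complex_vector.span tensor_relations"
  by (rule equivp_span)

lemma span_cong_add:
  "x - x' \<in> complex_vector.span R \<Longrightarrow> y - y' \<in> complex_vector.span R \<Longrightarrow>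
   (x + y) - (x' + y') \<in> complex_vector.span R"
  using complex_vector.span_add by (fastforce simp: algebra_simps)

lemma span_cong_diff:
  "x - x' \<in> complex_vector.span R \<Longrightarrow> y - y' \<in> complex_vector.span R \<Longrightarrow>
   (x - y) - (x' - y') \<in> complex_vector.span R"
  using complex_vector.span_diff[of "x - x'" R "y - y'"] by (simp add: algebra_simps)

lemma span_cong_uminus:
  "x - x' \<in> complex_vector.span R \<Longrightarrow> (- x) - (- x') \<in> complex_vector.span R"
  using complex_vector.span_neg[of "x - x'" R] by (simp add: algebra_simps)

lemma span_cong_scaleC:
  "x - x' \<in> complex_vector.span R \<Longrightarrow> c *\<^sub>C x - c *\<^sub>C x' \<in> complex_vector.span R"
  using complex_vector.span_scale[of "x - x'" R c]
  by (simp add: complex_vector.scale_right_diff_distrib)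

instantiation tensor :: (complex_vector, complex_vector) complex_vector
begin
lift_definition zero_tensor :: "('a, 'b) tensor" is 0 .
lift_definition plus_tensor :: "('a, 'b) tensor \<Rightarrow> ('a, 'b) tensor \<Rightarrow> ('a, 'b) tensor"
  is "(+)" by (rule span_cong_add)
lift_definition minus_tensor :: "('a, 'b) tensor \<Rightarrow> ('a, 'b) tensor \<Rightarrow> ('a, 'b) tensor"
  is "(-)" by (rule span_cong_diff)
lift_definition uminus_tensor :: "('a, 'b) tensor \<Rightarrow> ('a, 'b) tensor"
  is "uminus" by (rule span_cong_uminus)
lift_definition scaleC_tensor :: "complex \<Rightarrow> ('a, 'b) tensor \<Rightarrow> ('a, 'b) tensor"
  is "scaleC" by (rule span_cong_scaleC)
instance
  by standard
    (transfer; simp add: algebra_simps scaleC_add_right scaleC_add_left scaleC_scaleC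
      scaleC_one complex_vector.span_zero)+
end

lift_definition pure2 :: "'a::complex_vector \<Rightarrow> 'b::complex_vector \<Rightarrow> ('a, 'b) tensor"
  (infixl "\<otimes>" 70) is "\<lambda>a b. Poly_Mapping.single (a, b) 1" .

text \<open>The tensor product of two subspaces, realised inside that of the ambient spaces
  (into which it embeds, the scalars being a field).\<close>

definition tensor_space ::
    "'a::complex_vector set \<Rightarrow> 'b::complex_vector set \<Rightarrow> ('a, 'b) tensor set" where
  "tensor_space A B = complex_vector.span {a \<otimes> b | a b. a \<in> A \<and> b \<in> B}"

text \<open>All algebraic tensor powers of a space have to live in one type: this is the tensor
  algebra \<open>\<Oplus>\<^sub>n V\<^sup>\<otimes>\<^sup>n\<close>, the quotient of the free space on lists by multilinearity.\<close>

definition multilinear_relations :: "('a::complex_vector list \<Rightarrow>\<^sub>0 complex) set" where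
  "multilinear_relations =
     {Poly_Mapping.single (xs @ (a + b) # ys) 1 - Poly_Mapping.single (xs @ a # ys) 1
        - Poly_Mapping.single (xs @ b # ys) 1 | xs a b ys. True}
   \<union> {Poly_Mapping.single (xs @ (c *\<^sub>C a) # ys) 1 - Poly_Mapping.single (xs @ a # ys) c
        | xs c a ys. True}"

quotient_type (overloaded) 'a tensor_alg = "'a::complex_vector list \<Rightarrow>\<^sub>0 complex"
  / "\<lambda>x y. x - y \<in> complex_vector.span multilinear_relations"
  by (rule equivp_span)

instantiation tensor_alg :: (complex_vector) complex_vector
begin
lift_definition zero_tensor_alg :: "'a tensor_alg" is 0 .
lift_definition plus_tensor_alg :: "'a tensor_alg \<Rightarrow> 'a tensor_alg \<Rightarrow> 'a tensor_alg"
  is "(+)" by (rule span_cong_add)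
lift_definition minus_tensor_alg :: "'a tensor_alg \<Rightarrow> 'a tensor_alg \<Rightarrow> 'a tensor_alg"
  is "(-)" by (rule span_cong_diff)
lift_definition uminus_tensor_alg :: "'a tensor_alg \<Rightarrow> 'a tensor_alg"
  is "uminus" by (rule span_cong_uminus)
lift_definition scaleC_tensor_alg :: "complex \<Rightarrow> 'a tensor_alg \<Rightarrow> 'a tensor_alg"
  is "scaleC" by (rule span_cong_scaleC)
instance
  by standard
    (transfer; simp add: algebra_simps scaleC_add_right scaleC_add_left scaleC_scaleC
      scaleC_one complex_vector.span_zero)+
end

lift_definition pure :: "'a::complex_vector list \<Rightarrow> 'a tensor_alg"
  is "\<lambda>xs. Poly_Mapping.single xs 1" .

definition tensor_power :: "'a::complex_vector set \<Rightarrow> nat \<Rightarrow> 'a tensor_alg set" where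
  "tensor_power S n = complex_vector.span {pure xs | xs. length xs = n \<and> set xs \<subseteq> S}"

text \<open>The functional \<open>f\<^sub>1 \<otimes> \<dots> \<otimes> f\<^sub>q\<close> on \<open>V\<^sup>\<otimes>\<^sup>q\<close>.\<close>

definition tensor_form :: "('a::complex_vector \<Rightarrow> complex) list \<Rightarrow> 'a tensor_alg \<Rightarrow> complex" where
  "tensor_form fs = (THE g. g \<in> Hom (tensor_power UNIV (length fs)) UNIV \<and>
     (\<forall>xs. length xs = length fs \<longrightarrow> g (pure xs) = (\<Prod>i<length fs. (fs ! i) (xs ! i))))"


section \<open>Linear topologies\<close>

text \<open>A space with a linear topology is an abstract topology whose \<^const>\<open>topspace\<close> is a
  subspace of the ambient type. \<open>linear_topology W \<B>\<close> is the translation-invariant topology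
  on \<open>W\<close> in which the subspaces in \<open>\<B>\<close> form a base of neighbourhoods of zero.\<close>

definition linear_topology :: "'a::complex_vector set \<Rightarrow> 'a set set \<Rightarrow> 'a topology" where
  "linear_topology W \<B> = topology (\<lambda>U. U \<subseteq> W \<and> (\<forall>x\<in>U. \<exists>E\<in>\<B>. (+) x ` E \<subseteq> U))"

lemma openin_linear_topology:
  assumes "\<And>E E'. E \<in> \<B> \<Longrightarrow> E' \<in> \<B> \<Longrightarrow> \<exists>E''\<in>\<B>. E'' \<subseteq> E \<inter> E'"
  shows "openin (linear_topology W \<B>) U \<longleftrightarrow> U \<subseteq> W \<and> (\<forall>x\<in>U. \<exists>E\<in>\<B>. (+) x ` E \<subseteq> U)"
proof -
  let ?L = "\<lambda>U. U \<subseteq> W \<and> (\<forall>x\<in>U. \<exists>E\<in>\<B>. (+) x ` E \<subseteq> U)"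
  have "istopology ?L"
    unfolding istopology_def
  proof (intro conjI allI impI)
    fix S T assume S: "?L S" and T: "?L T"
    show "S \<inter> T \<subseteq> W" using S by blast
    show "\<forall>x\<in>S \<inter> T. \<exists>E\<in>\<B>. (+) x ` E \<subseteq> S \<inter> T"
    proof
      fix x assume "x \<in> S \<inter> T"
      then obtain E E' where E: "E \<in> \<B>" "(+) x ` E \<subseteq> S" "E' \<in> \<B>" "(+) x ` E' \<subseteq> T"
        using S T by blast
      then obtain E'' where "E'' \<in> \<B>" "E'' \<subseteq> E \<inter> E'" using assms by blast
      then show "\<exists>E\<in>\<B>. (+) x ` E \<subseteq> S \<inter> T" using E by blast
    qed
  next
    fix \<K> assume K: "\<forall>S\<in>\<K>. ?L S"
    show "\<Union>\<K> \<subseteq> W" using K by blast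
    show "\<forall>x\<in>\<Union>\<K>. \<exists>E\<in>\<B>. (+) x ` E \<subseteq> \<Union>\<K>"
    proof
      fix x assume "x \<in> \<Union>\<K>"
      then obtain S where "S \<in> \<K>" "x \<in> S" by blast
      then show "\<exists>E\<in>\<B>. (+) x ` E \<subseteq> \<Union>\<K>" using K by (meson Union_upper subset_trans)
    qed
  qed
  then show ?thesis
    by (simp add: linear_topology_def topology_inverse')
qed

definition open_subspaces :: "'a::complex_vector topology \<Rightarrow> 'a set set" where
  "open_subspaces T = {E. complex_vector.subspace E \<and> openin T E}"

definition is_linear_topology :: "'a::complex_vector topology \<Rightarrow> bool" where
  "is_linear_topology T \<longleftrightarrow> complex_vector.subspace (topspace T) \<and>
     (\<forall>U. openin T U \<longleftrightarrow>
        U \<subseteq> topspace T \<and> (\<forall>x\<in>U. \<exists>E\<in>open_subspaces T. (+) x ` E \<subseteq> U))"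

definition tvs_iso ::
    "'a::complex_vector topology \<Rightarrow> 'b::complex_vector topology \<Rightarrow> ('a \<Rightarrow> 'b) \<Rightarrow> bool" where
  "tvs_iso T T' \<phi> \<longleftrightarrow> linear_on (topspace T) \<phi> \<and> homeomorphic_map T T' \<phi>"

text \<open>For \<open>S = \<Union>\<^sub>i F i\<close>, this is \<open>Hom(S, X) = lim\<^sub>i Hom(F i, X)\<close> with the projective limit
  topology of the discrete spaces \<open>Hom(F i, X)\<close>: the kernels of the restriction maps are a base
  at zero.\<close>

definition Hom_topology ::
    "'a::complex_vector set \<Rightarrow> (nat \<Rightarrow> 'a set) \<Rightarrow> 'b::complex_vector set \<Rightarrow> ('a \<Rightarrow> 'b) topology" where
  "Hom_topology S F X =
     linear_topology (Hom S X) (range (\<lambda>i. {f \<in> Hom S X. \<forall>x\<in>F i. f x = 0}))"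


section \<open>The two tensor product topologies and their completions\<close>

definition star_tensor ::
    "'a::complex_vector topology \<Rightarrow> 'b::complex_vector topology \<Rightarrow> ('a, 'b) tensor topology" where
  "star_tensor T1 T2 = linear_topology (tensor_space (topspace T1) (topspace T2))
     {E. complex_vector.subspace E \<and> E \<subseteq> tensor_space (topspace T1) (topspace T2) \<and>
       (\<exists>P1\<in>open_subspaces T1. \<exists>P2\<in>open_subspaces T2. tensor_space P1 P2 \<subseteq> E) \<and>
       (\<forall>w1\<in>topspace T1. \<exists>Q\<in>open_subspaces T2. \<forall>y\<in>Q. w1 \<otimes> y \<in> E) \<and>
       (\<forall>w2\<in>topspace T2. \<exists>Q\<in>open_subspaces T1. \<forall>x\<in>Q. x \<otimes> w2 \<in> E)}"

definition shriek_tensor ::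
    "'a::complex_vector topology \<Rightarrow> 'b::complex_vector topology \<Rightarrow> ('a, 'b) tensor topology" where
  "shriek_tensor T1 T2 = linear_topology (tensor_space (topspace T1) (topspace T2))
     {E. complex_vector.subspace E \<and> E \<subseteq> tensor_space (topspace T1) (topspace T2) \<and>
       (\<exists>P1\<in>open_subspaces T1. \<exists>P2\<in>open_subspaces T2.
          tensor_space P1 (topspace T2) \<subseteq> E \<and> tensor_space (topspace T1) P2 \<subseteq> E)}"

definition complete_linear_topology :: "'a::complex_vector topology \<Rightarrow> bool" where
  "complete_linear_topology T \<longleftrightarrow>
     (\<forall>\<F>. \<F> \<noteq> bot \<and> \<F> \<le> principal (topspace T) \<and>
        (\<forall>E\<in>open_subspaces T. \<exists>x\<in>topspace T. eventually (\<lambda>y. y - x \<in> E) \<F>)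
      \<longrightarrow> (\<exists>l. limitin T (\<lambda>y. y) l \<F>))"

definition is_completion ::
    "'a::complex_vector topology \<Rightarrow> 'b::complex_vector topology \<Rightarrow> ('a \<Rightarrow> 'b) \<Rightarrow> bool" where
  "is_completion T T' \<iota> \<longleftrightarrow>
     is_linear_topology T' \<and> Hausdorff_space T' \<and> complete_linear_topology T' \<and>
     linear_on (topspace T) \<iota> \<and> \<iota> ` topspace T \<subseteq> topspace T' \<and>
     T' closure_of (\<iota> ` topspace T) = topspace T' \<and>
     (\<forall>U. openin T U \<longleftrightarrow> (\<exists>U'. openin T' U' \<and> U = {x \<in> topspace T. \<iota> x \<in> U'}))"

text \<open>A completion is unique up to a unique isomorphism compatible with \<open>\<iota>\<close>. To iterate completed
  tensor products inside one type, completions are chosen inside the fixed space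
  \<open>nat list \<Rightarrow> complex\<close>; its dimension is the continuum, as large as that of every space
  considered here. (For a space whose completion does not embed linearly into it, the choice below
  is unspecified.)\<close>

type_synonym coeffs = "nat list \<Rightarrow> complex"

definition completion_pair :: "'a::complex_vector topology \<Rightarrow> coeffs topology \<times> ('a \<Rightarrow> coeffs)" where
  "completion_pair T = (SOME p. is_completion T (fst p) (snd p))"

definition completion :: "'a::complex_vector topology \<Rightarrow> coeffs topology" where
  "completion T = fst (completion_pair T)"

definition completion_map :: "'a::complex_vector topology \<Rightarrow> 'a \<Rightarrow> coeffs" where
  "completion_map T = snd (completion_pair T)"

lemma is_completion_completion:
  assumes "is_completion T (T' :: coeffs topology) \<iota>"
  shows "is_completion T (completion T) (completion_map T)"
proof -
  have "is_completion T (fst (T', \<iota>)) (snd (T', \<iota>))" using assms by simp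
  then show ?thesis
    unfolding completion_def completion_map_def completion_pair_def by (rule someI)
qed

definition completed_star :: "'a::complex_vector topology \<Rightarrow> 'b::complex_vector topology \<Rightarrow> coeffs topology" where
  "completed_star T1 T2 = completion (star_tensor T1 T2)"

definition completed_shriek :: "'a::complex_vector topology \<Rightarrow> 'b::complex_vector topology \<Rightarrow> coeffs topology" where
  "completed_shriek T1 T2 = completion (shriek_tensor T1 T2)"

text \<open>The images of \<open>x \<otimes> y\<close> in the completed products.\<close>

definition star_pure ::
    "'a::complex_vector topology \<Rightarrow> 'b::complex_vector topology \<Rightarrow> 'a \<Rightarrow> 'b \<Rightarrow> coeffs" where
  "star_pure T1 T2 x y = completion_map (star_tensor T1 T2) (x \<otimes> y)"

definition shriek_pure ::
    "'a::complex_vector topology \<Rightarrow> 'b::complex_vector topology \<Rightarrow> 'a \<Rightarrow> 'b \<Rightarrow> coeffs" where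
  "shriek_pure T1 T2 x y = completion_map (shriek_tensor T1 T2) (x \<otimes> y)"

text \<open>Iterated completed products. The empty product is the unit, the discrete space \<open>\<complex>\<close>,
  which is complete, so that \<^const>\<open>completion\<close> only moves it into \<^typ>\<open>coeffs\<close>.\<close>

primrec star_power :: "'a::complex_vector topology \<Rightarrow> nat \<Rightarrow> coeffs topology" where
  "star_power W 0 = completion (discrete_topology (UNIV :: complex set))"
| "star_power W (Suc n) = completed_star W (star_power W n)"

primrec shriek_power :: "'a::complex_vector topology \<Rightarrow> nat \<Rightarrow> coeffs topology" where
  "shriek_power W 0 = completion (discrete_topology (UNIV :: complex set))"
| "shriek_power W (Suc n) = completed_shriek W (shriek_power W n)"

text \<open>The images of \<open>w\<^sub>1 \<otimes> \<dots> \<otimes> w\<^sub>n\<close> in the \<open>n\<close>-fold completed products.\<close>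

primrec star_power_pure :: "'a::complex_vector topology \<Rightarrow> 'a list \<Rightarrow> coeffs" where
  "star_power_pure W [] = completion_map (discrete_topology (UNIV :: complex set)) 1"
| "star_power_pure W (w # ws) =
     star_pure W (star_power W (length ws)) w (star_power_pure W ws)"

primrec shriek_power_pure :: "'a::complex_vector topology \<Rightarrow> 'a list \<Rightarrow> coeffs" where
  "shriek_power_pure W [] = completion_map (discrete_topology (UNIV :: complex set)) 1"
| "shriek_power_pure W (w # ws) =
     shriek_pure W (shriek_power W (length ws)) w (shriek_power_pure W ws)"

section \<open>The spaces attached to a space with a countable basis\<close>

text \<open>The space \<open>V\<close> is the whole type \<open>'v\<close>, with basis \<open>v 0, v 1, \<dots>\<close>; the sequence is indexed
  from zero, so that \<open>flag v i\<close> is still the span of the first \<open>i\<close> basis vectors.\<close>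

definition flag :: "(nat \<Rightarrow> 'v::complex_vector) \<Rightarrow> nat \<Rightarrow> 'v set" where
  "flag v i = complex_vector.span (v ` {..<i})"

definition dual_topology :: "(nat \<Rightarrow> 'v::complex_vector) \<Rightarrow> ('v \<Rightarrow> complex) topology" where
  "dual_topology v = Hom_topology UNIV (flag v) UNIV"

definition gl_topology :: "(nat \<Rightarrow> 'v::complex_vector) \<Rightarrow> ('v \<Rightarrow> 'v) topology" where
  "gl_topology v = Hom_topology UNIV (flag v) UNIV"

definition dual_power_topology ::
    "(nat \<Rightarrow> 'v::complex_vector) \<Rightarrow> nat \<Rightarrow> ('v tensor_alg \<Rightarrow> complex) topology" where
  "dual_power_topology v q =
     Hom_topology (tensor_power UNIV q) (\<lambda>i. tensor_power (flag v i) q) UNIV"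

text \<open>\<open>V\<^sub>i\<^sup>\<otimes>\<^sup>p \<otimes> (V\<^sup>\<otimes>\<^sup>q)\<^sup>*\<close>, a finite direct sum of copies of \<open>(V\<^sup>\<otimes>\<^sup>q)\<^sup>*\<close> since the left factor is
  finite-dimensional and discrete.\<close>

definition mixed_step ::
    "(nat \<Rightarrow> 'v::complex_vector) \<Rightarrow> nat \<Rightarrow> nat \<Rightarrow> nat \<Rightarrow>
     ('v tensor_alg, 'v tensor_alg \<Rightarrow> complex) tensor topology" where
  "mixed_step v p q i =
     linear_topology (tensor_space (tensor_power (flag v i) p) (topspace (dual_power_topology v q)))
       {tensor_space (tensor_power (flag v i) p) P | P. P \<in> open_subspaces (dual_power_topology v q)}"

definition mixed_topology ::
    "(nat \<Rightarrow> 'v::complex_vector) \<Rightarrow> nat \<Rightarrow> nat \<Rightarrow>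
     ('v tensor_alg, 'v tensor_alg \<Rightarrow> complex) tensor topology" where
  "mixed_topology v p q =
     linear_topology (tensor_space (tensor_power UNIV p) (topspace (dual_power_topology v q)))
       {E. complex_vector.subspace E \<and>
           E \<subseteq> tensor_space (tensor_power UNIV p) (topspace (dual_power_topology v q)) \<and>
           (\<forall>i. openin (mixed_step v p q i) (E \<inter> topspace (mixed_step v p q i)))}"

definition continuous_dual :: "'a::complex_vector topology \<Rightarrow> ('a \<Rightarrow> complex) set" where
  "continuous_dual T =
     {l \<in> Hom (topspace T) UNIV. continuous_map T (discrete_topology UNIV) l}"

text \<open>The continuous dual of \<open>V\<^sup>\<otimes>\<^sup>q \<otimes> (V\<^sup>\<otimes>\<^sup>p)\<^sup>*\<close>. A continuous functional \<open>l\<close> corresponds to the map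
  \<open>x \<mapsto> l (x \<otimes> -)\<close> from \<open>V\<^sup>\<otimes>\<^sup>q\<close> to the continuous dual \<open>V\<^sup>\<otimes>\<^sup>p\<close> of \<open>(V\<^sup>\<otimes>\<^sup>p)\<^sup>*\<close>, so the subspaces below are
  the kernels of the projections to \<open>Hom(V\<^sub>i\<^sup>\<otimes>\<^sup>q, V\<^sup>\<otimes>\<^sup>p)\<close> and the topology is that of
  \<open>lim\<^sub>i Hom(V\<^sub>i\<^sup>\<otimes>\<^sup>q, V\<^sup>\<otimes>\<^sup>p)\<close>.\<close>

definition completed_mixed_topology ::
    "(nat \<Rightarrow> 'v::complex_vector) \<Rightarrow> nat \<Rightarrow> nat \<Rightarrow>
     (('v tensor_alg, 'v tensor_alg \<Rightarrow> complex) tensor \<Rightarrow> complex) topology" where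
  "completed_mixed_topology v p q =
     linear_topology (continuous_dual (mixed_topology v q p))
       (range (\<lambda>i. {l \<in> continuous_dual (mixed_topology v q p).
          \<forall>x\<in>tensor_power (flag v i) q. \<forall>g\<in>topspace (dual_power_topology v p). l (x \<otimes> g) = 0}))"

end

theory Submission
  imports Defs
begin

text \<open>Everything is computed in coordinates with respect to the basis \<open>v\<close>. A basis of \<open>V\<^sup>\<otimes>\<^sup>p\<close> is indexed by
  the lists of length \<open>p\<close>, so that a linear map from \<open>V\<^sup>\<otimes>\<^sup>q\<close> to \<open>V\<^sup>\<otimes>\<^sup>p\<close> is a matrix of format \<open>(p, q)\<close> with
  rows and columns indexed by lists, each column having finitely many non-zero entries. The
  topology of \<open>lim\<^sub>i Hom(V\<^sub>i\<^sup>\<otimes>\<^sup>q, V\<^sup>\<otimes>\<^sup>p)\<close> becomes that of agreement on finitely many columns. In this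
  way \<open>V\<^sup>\<otimes>\<^sup>p\<close>, \<open>(V\<^sup>\<otimes>\<^sup>q)\<^sup>*\<close>, \<open>gl(V)\<close> and the dual of \<open>V\<^sup>\<otimes>\<^sup>q \<otimes> (V\<^sup>\<otimes>\<^sup>p)\<^sup>*\<close> all are spaces of column-finite
  matrices, of formats \<open>(p, 0)\<close>, \<open>(0, q)\<close>, \<open>(1, 1)\<close> and \<open>(p, q)\<close> (\<open>column_iso\<close>, \<open>Hom_iso\<close>,
  \<open>completed_mixed_iso\<close>).\<close>

text \<open>Parts (b) and (c) then are one statement about matrices, \<open>kron_completion\<close>: the Kronecker product
  makes the space of format \<open>(p + p', q + q')\<close> the completion of the \<open>\<otimes>\<^sup>!\<close> product of those of formats
  \<open>(p, q)\<close> and \<open>(p', q')\<close>. Its image is dense because it contains the matrix units. The tensor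
  product has the induced topology because, modulo an open subspace, a tensor is a finite combination
  of products of matrix units whose coefficients are entries of its Kronecker product. A completion
  is unique (\<open>completion_unique\<close>), so this determines all the iterated completed products by
  induction.\<close>

text \<open>For part (a), the two tensor products of \<open>W\<^sub>1\<close> and \<open>W\<^sub>2\<close> have the same topology if both spaces are
  discrete, and also if in both of them all open subspaces have finite codimension. Hence the powers
  of \<open>V\<close> and those of its dual are the same for \<open>\<otimes>\<^sup>*\<close> and \<open>\<otimes>\<^sup>!\<close>. One product \<open>V\<^sup>\<otimes>\<^sup>p \<otimes>\<^sup>* (V\<^sup>\<otimes>\<^sup>q)\<^sup>*\<close> remains.
  Its topology is that of the inductive limit over \<open>V\<^sub>i\<^sup>\<otimes>\<^sup>p\<close> (\<open>mixed_eq_star\<close>), and the Kronecker product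
  identifies it with the matrices that have finitely many non-zero rows (\<open>star_rowfin_iso\<close>). These
  form a complete space (\<open>complete_rowfin\<close>), so that completing changes nothing.\<close>

section \<open>Linear maps on subspaces\<close>

abbreviation "csubspace \<equiv> complex_vector.subspace"
abbreviation "cspan \<equiv> complex_vector.span"

lemmas cspan_base = complex_vector.span_base
lemmas cspan_induct_alt = complex_vector.span_induct_alt
lemmas cspan_minimal = complex_vector.span_minimal
lemmas cspan_mono = complex_vector.span_mono
lemmas cspan_scale = complex_vector.span_scale
lemmas cspan_sum = complex_vector.span_sum
lemmas csubspace_0 = complex_vector.subspace_0
lemmas csubspace_UNIV = complex_vector.subspace_UNIV
lemmas csubspace_add = complex_vector.subspace_add
lemmas csubspace_def = complex_vector.subspace_def
lemmas csubspace_diff = complex_vector.subspace_diff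
lemmas csubspace_inter = complex_vector.subspace_inter
lemmas csubspace_scale = complex_vector.subspace_scale
lemmas csubspace_sum = complex_vector.subspace_sum

abbreviation clinear :: "('a::complex_vector \<Rightarrow> 'b::complex_vector) \<Rightarrow> bool" where
  "clinear \<equiv> Vector_Spaces.linear scaleC scaleC"

global_interpretation complex_vector_pair: vector_space_pair
  "scaleC :: complex \<Rightarrow> 'a \<Rightarrow> 'a::complex_vector"
  "scaleC :: complex \<Rightarrow> 'b \<Rightarrow> 'b::complex_vector"
  by unfold_locales

lemma clinearI:
  assumes "\<And>x y. f (x + y) = f x + f y" and "\<And>c x. f (c *\<^sub>C x) = c *\<^sub>C f x"
  shows "clinear f"
  using assms by unfold_locales auto

lemmas clinear_add = complex_vector_pair.linear_add
lemmas clinear_diff = complex_vector_pair.linear_diff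
lemmas clinear_scale = complex_vector_pair.linear_scale
lemmas clinear_0 = complex_vector_pair.linear_0
lemmas clinear_sum = complex_vector_pair.linear_sum

lemma clinear_compose: "clinear f \<Longrightarrow> clinear g \<Longrightarrow> clinear (\<lambda>x. g (f x))"
  by (intro clinearI) (simp_all add: clinear_add clinear_scale)

lemma clinear_imp_linear_on: "clinear f \<Longrightarrow> linear_on S f"
  by (simp add: linear_on_def clinear_add clinear_scale)

lemma linear_on_0:
  assumes "linear_on S f" "csubspace S" shows "f 0 = 0"
proof -
  have "f (0 *\<^sub>C 0) = 0 *\<^sub>C f 0"
    using assms csubspace_0 unfolding linear_on_def by blast
  then show ?thesis by simp
qed

lemma linear_on_diff:
  assumes "linear_on S f" "csubspace S" "x \<in> S" "y \<in> S"
  shows "f (x - y) = f x - f y"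
proof -
  have "f (x + (- 1) *\<^sub>C y) = f x + (- 1) *\<^sub>C f y"
    using assms csubspace_scale unfolding linear_on_def by metis
  then show ?thesis by simp
qed

lemma linear_on_extend:
  fixes f :: "'a::complex_vector \<Rightarrow> 'b::complex_vector"
  assumes f: "linear_on S f" and S: "csubspace S"
  obtains g where "clinear g" "\<And>x. x \<in> S \<Longrightarrow> g x = f x"
proof -
  obtain B where B: "B \<subseteq> S" "complex_vector.independent B" "S \<subseteq> cspan B"
    using complex_vector.basis_exists by metis
  obtain g where g: "clinear g" "\<forall>x\<in>B. g x = f x"
    using complex_vector_pair.linear_independent_extend[OF B(2)] by blast
  have "x \<in> S \<and> g x = f x" if "x \<in> cspan B" for x
    using that
  proof (induction rule: cspan_induct_alt)
    case base
    then show ?case using g S f by (simp add: csubspace_0 clinear_0 linear_on_0)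
  next
    case (step c x y)
    have "c *\<^sub>C x \<in> S" using S B(1) step csubspace_scale by blast
    moreover have "f (c *\<^sub>C x) = c *\<^sub>C f x" using f B(1) step by (auto simp: linear_on_def)
    ultimately show ?case
      using f S g step by (auto simp: csubspace_add linear_on_def clinear_add clinear_scale)
  qed
  then show ?thesis using that g B(3) by blast
qed

lemma linear_on_subset: "linear_on S f \<Longrightarrow> E \<subseteq> S \<Longrightarrow> linear_on E f"
  unfolding linear_on_def by blast

lemma linear_on_add: "linear_on S f \<Longrightarrow> x \<in> S \<Longrightarrow> y \<in> S \<Longrightarrow> f (x + y) = f x + f y"
  unfolding linear_on_def by blast

lemma linear_on_scale: "linear_on S f \<Longrightarrow> x \<in> S \<Longrightarrow> f (c *\<^sub>C x) = c *\<^sub>C f x"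
  unfolding linear_on_def by blast

lemma subspace_vimage_Int:
  assumes "linear_on S f" "csubspace S" "csubspace E"
  shows "csubspace {x \<in> S. f x \<in> E}"
  unfolding csubspace_def
  using assms linear_on_0[OF assms(1,2)]
  by (auto simp: csubspace_0 csubspace_add csubspace_scale
      linear_on_def)

lemma subspace_vimage:
  assumes "clinear f" "csubspace E"
  shows "csubspace {x. f x \<in> E}"
  using subspace_vimage_Int[OF clinear_imp_linear_on[OF assms(1), of UNIV] _ assms(2)] by simp

lemma subspace_image:
  assumes "linear_on S f" "csubspace E" "E \<subseteq> S"
  shows "csubspace (f ` E)"
  unfolding csubspace_def
proof (intro conjI ballI allI)
  have "f 0 = 0"
    using assms(2) linear_on_0 linear_on_subset[OF assms(1,3)] by blast
  then show "0 \<in> f ` E"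
    using csubspace_0[OF assms(2)] by force
next
  fix x y assume "x \<in> f ` E" "y \<in> f ` E"
  then obtain a b where "x = f a" "y = f b" "a \<in> E" "b \<in> E" by blast
  then have "x + y = f (a + b)" "a + b \<in> E"
    using assms by (auto simp: linear_on_add[OF linear_on_subset[OF assms(1,3)]] csubspace_add)
  then show "x + y \<in> f ` E" by blast
next
  fix x c assume "x \<in> f ` E"
  then obtain a where "x = f a" "a \<in> E" by blast
  then have "c *\<^sub>C x = f (c *\<^sub>C a)" "c *\<^sub>C a \<in> E"
    using assms by (auto simp: linear_on_scale[OF linear_on_subset[OF assms(1,3)]] csubspace_scale)
  then show "c *\<^sub>C x \<in> f ` E" by blast
qed


section \<open>Universal properties of the algebraic tensor products\<close>

definition free_lift :: "('k \<Rightarrow> 'b::complex_vector) \<Rightarrow> ('k \<Rightarrow>\<^sub>0 complex) \<Rightarrow> 'b" where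
  "free_lift F x = (\<Sum>k\<in>Poly_Mapping.keys x. Poly_Mapping.lookup x k *\<^sub>C F k)"

lemma free_lift_superset:
  assumes "finite S" "Poly_Mapping.keys x \<subseteq> S"
  shows "free_lift F x = (\<Sum>k\<in>S. Poly_Mapping.lookup x k *\<^sub>C F k)"
  unfolding free_lift_def
  by (rule sum.mono_neutral_left) (use assms in \<open>auto simp: in_keys_iff\<close>)

lemma clinear_free_lift: "clinear (free_lift F)"
proof (rule clinearI)
  fix x y :: "'a \<Rightarrow>\<^sub>0 complex"
  let ?S = "Poly_Mapping.keys x \<union> Poly_Mapping.keys y"
  have "Poly_Mapping.keys (x + y) \<subseteq> ?S" by (rule Poly_Mapping.keys_add)
  then show "free_lift F (x + y) = free_lift F x + free_lift F y"
    by (simp add: free_lift_superset[of ?S] lookup_add scaleC_add_left sum.distrib)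
next
  fix c and x :: "'a \<Rightarrow>\<^sub>0 complex"
  have lk: "Poly_Mapping.lookup (c *\<^sub>C x) k = c * Poly_Mapping.lookup x k" for k
    by transfer (simp add: scaleC_complex_def)
  have "Poly_Mapping.keys (c *\<^sub>C x) \<subseteq> Poly_Mapping.keys x"
    by (auto simp: in_keys_iff lk)
  then show "free_lift F (c *\<^sub>C x) = c *\<^sub>C free_lift F x"
    by (simp add: free_lift_superset[of "Poly_Mapping.keys x"] lk scaleC_scaleC
        complex_vector.scale_sum_right)
qed

lemma free_lift_single: "free_lift F (Poly_Mapping.single k c) = c *\<^sub>C F k"
  by (simp add: free_lift_def)

lemma clinear_eq_0_on_span:
  assumes "clinear f" "\<And>x. x \<in> R \<Longrightarrow> f x = 0" "x \<in> cspan R"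
  shows "f x = 0"
  using complex_vector_pair.linear_eq_0_on_span[OF assms(1)] assms by blast

lemma pure2_add_left: "(a + a') \<otimes> b = a \<otimes> b + a' \<otimes> b"
proof transfer
  fix a a' :: 'a and b :: 'b
  have "Poly_Mapping.single (a + a', b) 1 - Poly_Mapping.single (a, b) 1
        - Poly_Mapping.single (a', b) (1::complex) \<in> tensor_relations"
    unfolding tensor_relations_def by blast
  then show "Poly_Mapping.single (a + a', b) 1 - (Poly_Mapping.single (a, b) 1 +
      Poly_Mapping.single (a', b) 1) \<in> cspan tensor_relations"
    using cspan_base by (fastforce simp: diff_diff_eq)
qed

lemma pure2_add_right: "a \<otimes> (b + b') = a \<otimes> b + a \<otimes> b'"
proof transfer
  fix a :: 'a and b b' :: 'b
  have "Poly_Mapping.single (a, b + b') 1 - Poly_Mapping.single (a, b) 1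
        - Poly_Mapping.single (a, b') (1::complex) \<in> tensor_relations"
    unfolding tensor_relations_def by blast
  then show "Poly_Mapping.single (a, b + b') 1 - (Poly_Mapping.single (a, b) 1 +
      Poly_Mapping.single (a, b') 1) \<in> cspan tensor_relations"
    using cspan_base by (fastforce simp: diff_diff_eq)
qed

lemma scaleC_single: "c *\<^sub>C Poly_Mapping.single k (d::complex) = Poly_Mapping.single k (c * d)"
  by transfer (auto simp: fun_eq_iff when_def scaleC_complex_def)

lemma pure2_scale_left: "(c *\<^sub>C a) \<otimes> b = c *\<^sub>C (a \<otimes> b)"
proof transfer
  fix c and a :: 'a and b :: 'b
  have "Poly_Mapping.single (c *\<^sub>C a, b) 1 - Poly_Mapping.single (a, b) c \<in> tensor_relations"
    unfolding tensor_relations_def by blast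
  then show "Poly_Mapping.single (c *\<^sub>C a, b) 1 - c *\<^sub>C Poly_Mapping.single (a, b) 1
      \<in> cspan tensor_relations"
    by (simp add: scaleC_single cspan_base)
qed

lemma pure2_scale_right: "a \<otimes> (c *\<^sub>C b) = c *\<^sub>C (a \<otimes> b)"
proof transfer
  fix c and a :: 'a and b :: 'b
  have "Poly_Mapping.single (a, c *\<^sub>C b) 1 - Poly_Mapping.single (a, b) c \<in> tensor_relations"
    unfolding tensor_relations_def by blast
  then show "Poly_Mapping.single (a, c *\<^sub>C b) 1 - c *\<^sub>C Poly_Mapping.single (a, b) 1
      \<in> cspan tensor_relations"
    by (simp add: scaleC_single cspan_base)
qed

lemma clinear_pure2_left: "clinear (\<lambda>x. x \<otimes> y)"
  by (rule clinearI) (simp_all add: pure2_add_left pure2_scale_left)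

lemma clinear_pure2_right: "clinear (\<lambda>y. x \<otimes> y)"
  by (rule clinearI) (simp_all add: pure2_add_right pure2_scale_right)

text \<open>The linear extension of \<open>B\<close> to the free space on pairs kills the relations, hence is constant on
  classes.\<close>

lemma tensor_universal:
  fixes B :: "'a::complex_vector \<Rightarrow> 'b::complex_vector \<Rightarrow> 'c::complex_vector"
  assumes "\<And>y. clinear (\<lambda>x. B x y)" and "\<And>x. clinear (\<lambda>y. B x y)"
  obtains L where "clinear L" "\<And>x y. L (x \<otimes> y) = B x y"
proof -
  let ?f = "free_lift (\<lambda>(x, y). B x y)"
  have lin: "clinear ?f" by (rule clinear_free_lift)
  have "?f r = 0" if "r \<in> tensor_relations" for r
    using that assms unfolding tensor_relations_def
    by (auto simp: clinear_diff[OF lin] free_lift_single scaleC_one clinear_add clinear_scale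
        clinear_add[OF assms(1)] clinear_scale[OF assms(1)]
        clinear_add[OF assms(2)] clinear_scale[OF assms(2)])
  then have zero: "?f r = 0" if "r \<in> cspan tensor_relations" for r
    using clinear_eq_0_on_span[OF lin] that by blast
  define L where "L t = ?f (rep_tensor t)" for t
  have L: "L (abs_tensor x) = ?f x" for x
  proof -
    have "rep_tensor (abs_tensor x) - x \<in> cspan tensor_relations"
      by (simp only: tensor.abs_eq_iff[symmetric] Quotient3_abs_rep[OF Quotient3_tensor])
    from zero[OF this] show ?thesis by (simp add: L_def clinear_diff[OF lin])
  qed
  have ex: "\<exists>x. t = abs_tensor x" for t :: "('a, 'b) tensor"
    using Quotient3_abs_rep[OF Quotient3_tensor, symmetric] by (rule exI)
  have "clinear L"
  proof (rule clinearI)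
    fix s t :: "('a, 'b) tensor"
    obtain x y where "s = abs_tensor x" "t = abs_tensor y" using ex by metis
    then show "L (s + t) = L s + L t"
      by (simp add: plus_tensor.abs_eq L clinear_add[OF lin])
  next
    fix c and t :: "('a, 'b) tensor"
    obtain x where "t = abs_tensor x" using ex by metis
    then show "L (c *\<^sub>C t) = c *\<^sub>C L t"
      by (simp add: scaleC_tensor.abs_eq L clinear_scale[OF lin])
  qed
  moreover have "L (x \<otimes> y) = B x y" for x y
    by (simp add: pure2.abs_eq L free_lift_single scaleC_one)
  ultimately show ?thesis using that by blast
qed

lemma pure_add: "pure (xs @ (a + b) # ys) = pure (xs @ a # ys) + pure (xs @ b # ys)"
proof transfer
  fix xs ys and a b :: 'a
  have "Poly_Mapping.single (xs @ (a + b) # ys) 1 - Poly_Mapping.single (xs @ a # ys) 1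
        - Poly_Mapping.single (xs @ b # ys) (1::complex) \<in> multilinear_relations"
    unfolding multilinear_relations_def by blast
  then show "Poly_Mapping.single (xs @ (a + b) # ys) 1 - (Poly_Mapping.single (xs @ a # ys) 1
        + Poly_Mapping.single (xs @ b # ys) 1) \<in> cspan multilinear_relations"
    using cspan_base by (fastforce simp: diff_diff_eq)
qed

lemma pure_scale: "pure (xs @ (c *\<^sub>C a) # ys) = c *\<^sub>C pure (xs @ a # ys)"
proof transfer
  fix xs ys c and a :: 'a
  have "Poly_Mapping.single (xs @ (c *\<^sub>C a) # ys) 1 - Poly_Mapping.single (xs @ a # ys) c
      \<in> multilinear_relations"
    unfolding multilinear_relations_def by blast
  then show "Poly_Mapping.single (xs @ (c *\<^sub>C a) # ys) 1 - c *\<^sub>C Poly_Mapping.single (xs @ a # ys) 1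
      \<in> cspan multilinear_relations"
    by (simp add: scaleC_single cspan_base)
qed

lemma clinear_pure: "clinear (\<lambda>a. pure (xs @ a # ys))"
  by (rule clinearI) (simp_all add: pure_add pure_scale)

lemma tensor_alg_universal:
  fixes F :: "'a::complex_vector list \<Rightarrow> 'b::complex_vector"
  assumes F: "\<And>xs ys. clinear (\<lambda>a. F (xs @ a # ys))"
  obtains L where "clinear L" "\<And>xs. L (pure xs) = F xs"
proof -
  let ?f = "free_lift F"
  have lin: "clinear ?f" by (rule clinear_free_lift)
  have "?f r = 0" if "r \<in> multilinear_relations" for r
    using that unfolding multilinear_relations_def
    by (auto simp: clinear_diff[OF lin] free_lift_single scaleC_one
        clinear_add[OF F] clinear_scale[OF F])
  then have zero: "?f r = 0" if "r \<in> cspan multilinear_relations" for r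
    using clinear_eq_0_on_span[OF lin] that by blast
  define L where "L t = ?f (rep_tensor_alg t)" for t
  have L: "L (abs_tensor_alg x) = ?f x" for x
  proof -
    have "rep_tensor_alg (abs_tensor_alg x) - x \<in> cspan multilinear_relations"
      by (simp only: tensor_alg.abs_eq_iff[symmetric] Quotient3_abs_rep[OF Quotient3_tensor_alg])
    from zero[OF this] show ?thesis by (simp add: L_def clinear_diff[OF lin])
  qed
  have ex: "\<exists>x. t = abs_tensor_alg x" for t :: "'a tensor_alg"
    using Quotient3_abs_rep[OF Quotient3_tensor_alg, symmetric] by (rule exI)
  have "clinear L"
  proof (rule clinearI)
    fix s t :: "'a tensor_alg"
    obtain x y where "s = abs_tensor_alg x" "t = abs_tensor_alg y" using ex by metis
    then show "L (s + t) = L s + L t"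
      by (simp add: plus_tensor_alg.abs_eq L clinear_add[OF lin])
  next
    fix c and t :: "'a tensor_alg"
    obtain x where "t = abs_tensor_alg x" using ex by metis
    then show "L (c *\<^sub>C t) = c *\<^sub>C L t"
      by (simp add: scaleC_tensor_alg.abs_eq L clinear_scale[OF lin])
  qed
  moreover have "L (pure xs) = F xs" for xs
    by (simp add: pure.abs_eq L free_lift_single scaleC_one)
  ultimately show ?thesis using that by blast
qed

section \<open>Linear topologies through their open subspaces\<close>

lemma open_subspaces_subset: "E \<in> open_subspaces T \<Longrightarrow> E \<subseteq> topspace T"
  by (simp add: open_subspaces_def openin_subset)

lemma open_subspaces_subspace: "E \<in> open_subspaces T \<Longrightarrow> csubspace E"
  by (simp add: open_subspaces_def)

lemma open_subspaces_Int:
  "E \<in> open_subspaces T \<Longrightarrow> E' \<in> open_subspaces T \<Longrightarrow> E \<inter> E' \<in> open_subspaces T"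
  by (simp add: open_subspaces_def csubspace_inter openin_Int)

lemma subspace_topspace: "is_linear_topology T \<Longrightarrow> csubspace (topspace T)"
  unfolding is_linear_topology_def by blast

lemma topspace_open_subspace: "is_linear_topology T \<Longrightarrow> topspace T \<in> open_subspaces T"
  by (simp add: open_subspaces_def subspace_topspace)

lemma openin_iff_cosets:
  "is_linear_topology T \<Longrightarrow>
     openin T U \<longleftrightarrow> U \<subseteq> topspace T \<and> (\<forall>x\<in>U. \<exists>E\<in>open_subspaces T. (+) x ` E \<subseteq> U)"
  unfolding is_linear_topology_def by blast

lemma openin_coset:
  assumes T: "is_linear_topology T" and E: "E \<in> open_subspaces T" and x: "x \<in> topspace T"
  shows "openin T ((+) x ` E)"
  unfolding openin_iff_cosets[OF T]
proof (intro conjI ballI)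
  show "(+) x ` E \<subseteq> topspace T"
    using open_subspaces_subset[OF E] x subspace_topspace[OF T] csubspace_add by blast
  fix y assume "y \<in> (+) x ` E"
  then obtain e where "e \<in> E" "y = x + e" by blast
  then have "(+) y ` E \<subseteq> (+) x ` E"
    using csubspace_add[OF open_subspaces_subspace[OF E]] by (auto simp: add.assoc)
  then show "\<exists>E'\<in>open_subspaces T. (+) y ` E' \<subseteq> (+) x ` E" using E by blast
qed

lemma in_coset_iff: "y \<in> (+) x ` E \<longleftrightarrow> y - x \<in> (E :: 'a::ab_group_add set)"
  by (metis add.commute add_diff_cancel_left' diff_add_cancel imageE imageI)

text \<open>A subspace is a union of cosets of every subspace that it contains.\<close>

lemma open_subspaceI:
  assumes T: "is_linear_topology T" and E: "csubspace E" "E \<subseteq> topspace T"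
    and D: "D \<in> open_subspaces T" "D \<subseteq> E"
  shows "E \<in> open_subspaces T"
proof -
  have "\<forall>x\<in>E. (+) x ` D \<subseteq> E" using E D csubspace_add by blast
  then have "\<forall>x\<in>E. \<exists>D\<in>open_subspaces T. (+) x ` D \<subseteq> E" using D(1) by blast
  then have "openin T E" using E(2) openin_iff_cosets[OF T, of E] by simp
  then show ?thesis using E by (simp add: open_subspaces_def)
qed

lemma open_contains_subspace:
  assumes "is_linear_topology T" "openin T U" "0 \<in> U"
  obtains E where "E \<in> open_subspaces T" "E \<subseteq> U"
proof -
  obtain E where "E \<in> open_subspaces T" "(+) 0 ` E \<subseteq> U"
    using assms openin_iff_cosets by blast
  then show ?thesis using that by simp
qed

text \<open>All topologies in this theory are given by a directed family of subspaces, for which the open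
  subspaces are those containing a member of the family.\<close>

definition zero_base :: "'a::complex_vector set \<Rightarrow> 'a set set \<Rightarrow> bool" where
  "zero_base W \<B> \<longleftrightarrow> csubspace W \<and> \<B> \<noteq> {} \<and>
     (\<forall>E\<in>\<B>. csubspace E \<and> E \<subseteq> W) \<and>
     (\<forall>E\<in>\<B>. \<forall>E'\<in>\<B>. \<exists>E''\<in>\<B>. E'' \<subseteq> E \<inter> E')"

context
  fixes W :: "'a::complex_vector set" and \<B> :: "'a set set"
  assumes base: "zero_base W \<B>"
begin

lemma openin_zero_base:
  "openin (linear_topology W \<B>) U \<longleftrightarrow> U \<subseteq> W \<and> (\<forall>x\<in>U. \<exists>E\<in>\<B>. (+) x ` E \<subseteq> U)"
  by (rule openin_linear_topology) (use base in \<open>auto simp: zero_base_def\<close>)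

lemma topspace_zero_base: "topspace (linear_topology W \<B>) = W"
proof -
  have "(+) x ` E \<subseteq> W" if "x \<in> W" "E \<in> \<B>" for x E
    using that base csubspace_add unfolding zero_base_def by blast
  moreover have "\<B> \<noteq> {}" using base by (simp add: zero_base_def)
  ultimately have "openin (linear_topology W \<B>) W"
    unfolding openin_zero_base by blast
  moreover have "topspace (linear_topology W \<B>) \<subseteq> W"
    using openin_zero_base openin_topspace by blast
  ultimately show ?thesis using openin_subset by blast
qed

lemma open_subspaces_zero_base:
  "E \<in> open_subspaces (linear_topology W \<B>) \<longleftrightarrow>
     csubspace E \<and> E \<subseteq> W \<and> (\<exists>D\<in>\<B>. D \<subseteq> E)"
proof
  assume "E \<in> open_subspaces (linear_topology W \<B>)"
  then have E: "csubspace E" "openin (linear_topology W \<B>) E"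
    by (auto simp: open_subspaces_def)
  then have "\<exists>D\<in>\<B>. (+) 0 ` D \<subseteq> E"
    using openin_zero_base[of E] csubspace_0[of E] by blast
  then obtain D where "D \<in> \<B>" "(+) 0 ` D \<subseteq> E" by blast
  then show "csubspace E \<and> E \<subseteq> W \<and> (\<exists>D\<in>\<B>. D \<subseteq> E)"
    using E openin_zero_base[of E] by auto
next
  assume E: "csubspace E \<and> E \<subseteq> W \<and> (\<exists>D\<in>\<B>. D \<subseteq> E)"
  then obtain D where "D \<in> \<B>" "D \<subseteq> E" by blast
  then have "\<forall>x\<in>E. (+) x ` D \<subseteq> E" using E csubspace_add by blast
  then show "E \<in> open_subspaces (linear_topology W \<B>)"
    using E \<open>D \<in> \<B>\<close> openin_zero_base[of E] by (auto simp: open_subspaces_def)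
qed

lemma zero_base_open: "E \<in> \<B> \<Longrightarrow> E \<in> open_subspaces (linear_topology W \<B>)"
  using base by (auto simp: open_subspaces_zero_base zero_base_def)

lemma is_linear_topology_zero_base: "is_linear_topology (linear_topology W \<B>)"
  unfolding is_linear_topology_def topspace_zero_base
proof (intro conjI allI)
  show "csubspace W" using base by (simp add: zero_base_def)
  fix U
  have "\<B> \<subseteq> open_subspaces (linear_topology W \<B>)"
    using base by (auto simp: open_subspaces_zero_base zero_base_def)
  moreover have "\<exists>E\<in>\<B>. (+) x ` E \<subseteq> U"
    if "E \<in> open_subspaces (linear_topology W \<B>)" "(+) x ` E \<subseteq> U" for E x
    using that open_subspaces_zero_base by (meson image_mono subset_trans)
  ultimately show "openin (linear_topology W \<B>) U \<longleftrightarrow> U \<subseteq> W \<and>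
      (\<forall>x\<in>U. \<exists>E\<in>open_subspaces (linear_topology W \<B>). (+) x ` E \<subseteq> U)"
    unfolding openin_zero_base by blast
qed

end

lemma is_linear_discrete: "is_linear_topology (discrete_topology W)"
  if "csubspace W" for W :: "'a::complex_vector set"
proof -
  have "{0} \<in> open_subspaces (discrete_topology W)"
    using that csubspace_0 by (auto simp: open_subspaces_def)
  then show ?thesis using that by (auto simp: is_linear_topology_def intro!: bexI[of _ "{0}"])
qed

lemma Hausdorff_linear_topology:
  assumes T: "is_linear_topology T"
    and sep: "\<And>x. x \<in> topspace T \<Longrightarrow> x \<noteq> 0 \<Longrightarrow> \<exists>E\<in>open_subspaces T. x \<notin> E"
  shows "Hausdorff_space T"
  unfolding Hausdorff_space_def
proof (intro allI impI)
  fix x y assume xy: "x \<in> topspace T \<and> y \<in> topspace T \<and> x \<noteq> y"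
  then have "x - y \<in> topspace T"
    using subspace_topspace[OF T] csubspace_diff by blast
  then obtain E where E: "E \<in> open_subspaces T" "x - y \<notin> E" using sep xy by fastforce
  note sE = open_subspaces_subspace[OF E(1)]
  have "disjnt ((+) x ` E) ((+) y ` E)"
    unfolding disjnt_iff in_coset_iff
  proof (intro allI notI, elim conjE)
    fix z assume "z - x \<in> E" "z - y \<in> E"
    then have "(z - y) - (z - x) \<in> E" using csubspace_diff[OF sE] by blast
    then show False using E(2) by simp
  qed
  then show "\<exists>U V. openin T U \<and> openin T V \<and> x \<in> U \<and> y \<in> V \<and> disjnt U V"
    using openin_coset[OF T E(1)] xy csubspace_0[OF sE]
    by (intro exI[of _ "(+) x ` E"] exI[of _ "(+) y ` E"]) (auto simp: in_coset_iff)
qed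

lemma Hausdorff_linear_separation:
  assumes T: "is_linear_topology T" "Hausdorff_space T"
    and x: "x \<in> topspace T" "\<And>E. E \<in> open_subspaces T \<Longrightarrow> x \<in> E"
  shows "x = 0"
proof (rule ccontr)
  assume "x \<noteq> 0"
  moreover have "0 \<in> topspace T"
    using subspace_topspace[OF T(1)] csubspace_0 by blast
  ultimately obtain U V where "openin T U" "openin T V" "0 \<in> U" "x \<in> V" "disjnt U V"
    using T(2) x(1) unfolding Hausdorff_space_def by metis
  moreover from this obtain E where "E \<in> open_subspaces T" "E \<subseteq> U"
    using open_contains_subspace[OF T(1)] by blast
  ultimately show False using x(2) by (meson disjnt_iff subsetD)
qed

lemma tvs_isoI:
  assumes T: "is_linear_topology T" and T': "is_linear_topology T'"
    and lin: "linear_on (topspace T) \<phi>" and bij: "bij_betw \<phi> (topspace T) (topspace T')"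
    and cont: "\<And>E'. E' \<in> open_subspaces T' \<Longrightarrow> \<exists>E\<in>open_subspaces T. \<phi> ` E \<subseteq> E'"
    and "open": "\<And>E. E \<in> open_subspaces T \<Longrightarrow>
                  \<exists>E'\<in>open_subspaces T'. {x \<in> topspace T. \<phi> x \<in> E'} \<subseteq> E"
  shows "tvs_iso T T' \<phi>"
  unfolding tvs_iso_def
proof (intro conjI lin bijective_open_imp_homeomorphic_map)
  show "\<phi> ` topspace T = topspace T'" and "inj_on \<phi> (topspace T)"
    using bij by (auto simp: bij_betw_def)
  have im: "\<phi> x \<in> topspace T'" if "x \<in> topspace T" for x
    using bij that by (auto simp: bij_betw_def)
  note subT = subspace_topspace[OF T]
  show "continuous_map T T' \<phi>"
    unfolding continuous_map_def
  proof (intro conjI allI impI)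
    show "\<phi> \<in> topspace T \<rightarrow> topspace T'" using im by blast
    fix U assume U: "openin T' U"
    show "openin T {x \<in> topspace T. \<phi> x \<in> U}"
      unfolding openin_iff_cosets[OF T]
    proof (intro conjI ballI)
      fix x assume x: "x \<in> {x \<in> topspace T. \<phi> x \<in> U}"
      then obtain E' where E': "E' \<in> open_subspaces T'" "(+) (\<phi> x) ` E' \<subseteq> U"
        using U openin_iff_cosets[OF T'] by blast
      then obtain E where E: "E \<in> open_subspaces T" "\<phi> ` E \<subseteq> E'" using cont by blast
      have "x + e \<in> {x \<in> topspace T. \<phi> x \<in> U}" if "e \<in> E" for e
      proof -
        have e: "e \<in> topspace T" using that E open_subspaces_subset by blast
        then have "\<phi> (x + e) = \<phi> x + \<phi> e" using lin x linear_on_add by blast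
        moreover have "\<phi> x + \<phi> e \<in> U" using E' E that by blast
        ultimately show ?thesis using e x csubspace_add[OF subT] by simp
      qed
      then show "\<exists>E\<in>open_subspaces T. (+) x ` E \<subseteq> {x \<in> topspace T. \<phi> x \<in> U}"
        using E by blast
    qed auto
  qed
  show "open_map T T' \<phi>"
    unfolding open_map_def
  proof (intro allI impI)
    fix U assume U: "openin T U"
    show "openin T' (\<phi> ` U)"
      unfolding openin_iff_cosets[OF T']
    proof (intro conjI ballI)
      show "\<phi> ` U \<subseteq> topspace T'" using U im openin_subset by blast
      fix y assume "y \<in> \<phi> ` U"
      then obtain x where x: "x \<in> U" "y = \<phi> x" by blast
      obtain E where E: "E \<in> open_subspaces T" "(+) x ` E \<subseteq> U"
        using U x openin_iff_cosets[OF T] by blast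
      then obtain E' where E': "E' \<in> open_subspaces T'" "{x \<in> topspace T. \<phi> x \<in> E'} \<subseteq> E"
        using "open" by blast
      have xT: "x \<in> topspace T" using U x openin_subset by blast
      have "y + e \<in> \<phi> ` U" if "e \<in> E'" for e
      proof -
        have "e \<in> \<phi> ` topspace T"
          using that open_subspaces_subset[OF E'(1)] bij by (auto simp: bij_betw_def)
        then obtain z where z: "z \<in> topspace T" "\<phi> z = e" by blast
        then have "z \<in> E" using E'(2) that by blast
        then have "x + z \<in> U" using E(2) by blast
        moreover have "\<phi> (x + z) = y + e" using lin x xT z linear_on_add by blast
        ultimately show ?thesis by (metis imageI)
      qed
      then show "\<exists>E\<in>open_subspaces T'. (+) y ` E \<subseteq> \<phi> ` U" using E' by blast
    qed
  qed
qed

text \<open>The form in which isomorphisms are verified below: for a linear bijection, continuity in both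
  directions is a comparison of members of the two bases.\<close>

lemma tvs_iso_zero_baseI:
  assumes B: "zero_base W \<B>" and B': "zero_base W' \<B>'"
    and lin: "linear_on W \<phi>" and bij: "bij_betw \<phi> W W'"
    and cont: "\<And>E'. E' \<in> \<B>' \<Longrightarrow> \<exists>E\<in>\<B>. \<phi> ` E \<subseteq> E'"
    and "open": "\<And>E. E \<in> \<B> \<Longrightarrow> \<exists>E'\<in>\<B>'. {x \<in> W. \<phi> x \<in> E'} \<subseteq> E"
  shows "tvs_iso (linear_topology W \<B>) (linear_topology W' \<B>') \<phi>"
proof (rule tvs_isoI)
  have sub: "\<B> \<subseteq> open_subspaces (linear_topology W \<B>)"
       "\<B>' \<subseteq> open_subspaces (linear_topology W' \<B>')"
    using zero_base_open[OF B] zero_base_open[OF B'] by blast+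
  show "\<exists>E\<in>open_subspaces (linear_topology W \<B>). \<phi> ` E \<subseteq> E'"
    if "E' \<in> open_subspaces (linear_topology W' \<B>')" for E'
    using that cont sub unfolding open_subspaces_zero_base[OF B'] by (meson subset_iff)
  show "\<exists>E'\<in>open_subspaces (linear_topology W' \<B>').
      {x \<in> topspace (linear_topology W \<B>). \<phi> x \<in> E'} \<subseteq> E"
    if "E \<in> open_subspaces (linear_topology W \<B>)" for E
    using that "open" sub unfolding open_subspaces_zero_base[OF B] topspace_zero_base[OF B]
    by (meson subset_iff)
qed (use lin bij in \<open>auto simp: topspace_zero_base[OF B] topspace_zero_base[OF B']
      is_linear_topology_zero_base[OF B] is_linear_topology_zero_base[OF B']\<close>)

lemma tvs_iso_linear: "tvs_iso T T' \<phi> \<Longrightarrow> linear_on (topspace T) \<phi>"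
  by (simp add: tvs_iso_def)

lemma tvs_iso_bij: "tvs_iso T T' \<phi> \<Longrightarrow> bij_betw \<phi> (topspace T) (topspace T')"
  unfolding tvs_iso_def bij_betw_def
  using homeomorphic_imp_surjective_map homeomorphic_imp_injective_map by blast

lemma tvs_iso_in: "tvs_iso T T' \<phi> \<Longrightarrow> x \<in> topspace T \<Longrightarrow> \<phi> x \<in> topspace T'"
  using tvs_iso_bij bij_betw_apply by metis

lemma tvs_iso_vimage:
  assumes \<phi>: "tvs_iso T T' \<phi>" and T: "is_linear_topology T" and E: "E \<in> open_subspaces T'"
  shows "{x \<in> topspace T. \<phi> x \<in> E} \<in> open_subspaces T"
proof -
  have "continuous_map T T' \<phi>"
    using \<phi> homeomorphic_imp_continuous_map by (auto simp: tvs_iso_def)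
  then show ?thesis
    using E \<phi> subspace_vimage_Int[OF tvs_iso_linear[OF \<phi>] subspace_topspace[OF T]]
    by (auto simp: open_subspaces_def continuous_map_def)
qed

lemma tvs_iso_inverse:
  assumes \<phi>: "tvs_iso T T' \<phi>" and T: "is_linear_topology T"
  obtains \<psi> where "tvs_iso T' T \<psi>" "\<And>x. x \<in> topspace T \<Longrightarrow> \<psi> (\<phi> x) = x"
    "\<And>y. y \<in> topspace T' \<Longrightarrow> \<phi> (\<psi> y) = y"
proof -
  obtain \<psi> where h: "homeomorphic_maps T T' \<phi> \<psi>"
    using \<phi> by (auto simp: tvs_iso_def homeomorphic_map_maps)
  then have inv: "\<And>x. x \<in> topspace T \<Longrightarrow> \<psi> (\<phi> x) = x" "\<And>y. y \<in> topspace T' \<Longrightarrow> \<phi> (\<psi> y) = y"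
    by (auto simp: homeomorphic_maps_def)
  have h': "homeomorphic_map T' T \<psi>"
    using h homeomorphic_map_maps homeomorphic_maps_sym by blast
  have in\<psi>: "\<psi> y \<in> topspace T" if "y \<in> topspace T'" for y
    using h' that homeomorphic_imp_surjective_map by blast
  have "linear_on (topspace T') \<psi>"
    unfolding linear_on_def
  proof (intro conjI ballI allI)
    fix x y assume xy: "x \<in> topspace T'" "y \<in> topspace T'"
    have "\<phi> (\<psi> x + \<psi> y) = x + y"
      using linear_on_add[OF tvs_iso_linear[OF \<phi>]] in\<psi> inv xy by simp
    then show "\<psi> (x + y) = \<psi> x + \<psi> y"
      using inv(1)[of "\<psi> x + \<psi> y"] in\<psi> xy subspace_topspace[OF T] csubspace_add
      by metis
  next
    fix c x assume x: "x \<in> topspace T'"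
    have "\<phi> (c *\<^sub>C \<psi> x) = c *\<^sub>C x"
      using linear_on_scale[OF tvs_iso_linear[OF \<phi>]] in\<psi> inv x by simp
    then show "\<psi> (c *\<^sub>C x) = c *\<^sub>C \<psi> x"
      using inv(1)[of "c *\<^sub>C \<psi> x"] in\<psi> x subspace_topspace[OF T] csubspace_scale
      by metis
  qed
  then show ?thesis using that h' inv by (simp add: tvs_iso_def)
qed

lemma tvs_iso_compose:
  assumes \<phi>: "tvs_iso T T' \<phi>" and \<psi>: "tvs_iso T' T'' \<psi>"
  shows "tvs_iso T T'' (\<lambda>x. \<psi> (\<phi> x))"
  unfolding tvs_iso_def
proof (intro conjI)
  show "linear_on (topspace T) (\<lambda>x. \<psi> (\<phi> x))"
    using tvs_iso_linear[OF \<phi>] tvs_iso_linear[OF \<psi>] tvs_iso_in[OF \<phi>]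
    unfolding linear_on_def by simp
  show "homeomorphic_map T T'' (\<lambda>x. \<psi> (\<phi> x))"
    using homeomorphic_map_compose[of T T' \<phi> T'' \<psi>] \<phi> \<psi> by (simp add: tvs_iso_def o_def)
qed

text \<open>A Cauchy filter on the target is moved back along the inverse, and its limit forward again.\<close>

lemma complete_linear_topology_iso:
  assumes \<phi>: "tvs_iso T T' \<phi>" and T: "is_linear_topology T" and T': "is_linear_topology T'"
    and compl: "complete_linear_topology T"
  shows "complete_linear_topology T'"
  unfolding complete_linear_topology_def
proof (intro allI impI, elim conjE)
  obtain \<psi> where \<psi>: "tvs_iso T' T \<psi>" "\<And>x. x \<in> topspace T \<Longrightarrow> \<psi> (\<phi> x) = x"
    "\<And>y. y \<in> topspace T' \<Longrightarrow> \<phi> (\<psi> y) = y"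
    using tvs_iso_inverse[OF \<phi> T] by blast
  fix \<F> assume F: "\<F> \<noteq> bot" "\<F> \<le> principal (topspace T')"
    and cauchy: "\<forall>E\<in>open_subspaces T'. \<exists>x\<in>topspace T'. eventually (\<lambda>y. y - x \<in> E) \<F>"
  have ev: "eventually (\<lambda>y. y \<in> topspace T') \<F>" using F(2) by (simp add: le_principal)
  let ?\<G> = "filtermap \<psi> \<F>"
  have "?\<G> \<noteq> bot" using F(1) by (simp add: filtermap_bot_iff)
  moreover have "?\<G> \<le> principal (topspace T)"
    unfolding le_principal eventually_filtermap
    using ev tvs_iso_in[OF \<psi>(1)] by (auto elim: eventually_mono)
  moreover have "\<exists>x\<in>topspace T. eventually (\<lambda>y. y - x \<in> E) ?\<G>" if E: "E \<in> open_subspaces T" for E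
  proof -
    obtain x where x: "x \<in> topspace T'" "eventually (\<lambda>y. y - x \<in> {y \<in> topspace T'. \<psi> y \<in> E}) \<F>"
      using cauchy tvs_iso_vimage[OF \<psi>(1) T' E] by blast
    have "eventually (\<lambda>y. \<psi> y - \<psi> x \<in> E) \<F>"
      using eventually_conj[OF x(2) ev] x(1)
        linear_on_diff[OF tvs_iso_linear[OF \<psi>(1)] subspace_topspace[OF T']]
      by (auto elim!: eventually_mono)
    then show ?thesis using x(1) tvs_iso_in[OF \<psi>(1)] by (auto simp: eventually_filtermap)
  qed
  ultimately obtain l where l: "limitin T (\<lambda>y. y) l ?\<G>"
    using compl unfolding complete_linear_topology_def by blast
  have "continuous_map T T' \<phi>"
    using \<phi> homeomorphic_imp_continuous_map by (auto simp: tvs_iso_def)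
  then have opn: "openin T {x \<in> topspace T. \<phi> x \<in> U}" if "openin T' U" for U
    using that by (simp add: continuous_map_def)
  have lT: "l \<in> topspace T" using l by (rule limitin_topspace)
  have "limitin T' (\<lambda>y. y) (\<phi> l) \<F>"
    unfolding limitin_def
  proof (intro conjI allI impI)
    show "\<phi> l \<in> topspace T'" using lT tvs_iso_in[OF \<phi>] by blast
    fix U assume U: "openin T' U \<and> \<phi> l \<in> U"
    then have "l \<in> {x \<in> topspace T. \<phi> x \<in> U}" using lT by simp
    then have "eventually (\<lambda>y. y \<in> {x \<in> topspace T. \<phi> x \<in> U}) ?\<G>"
      using l opn U unfolding limitin_def by blast
    then have "eventually (\<lambda>y. \<phi> (\<psi> y) \<in> U) \<F>" by (simp add: eventually_filtermap eventually_conj_iff)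
    then have "eventually (\<lambda>y. \<phi> (\<psi> y) \<in> U \<and> y \<in> topspace T') \<F>" using ev by (rule eventually_conj)
    then show "eventually (\<lambda>y. y \<in> U) \<F>" by (rule eventually_mono) (use \<psi>(3) in auto)
  qed
  then show "\<exists>l. limitin T' (\<lambda>y. y) l \<F>" by blast
qed

section \<open>Completions\<close>

text \<open>The closure in the definition of a completion and the equivalence on open sets reduce to statements
  about open subspaces, since open sets are unions of their cosets. Completions are built from these
  and taken apart into them.\<close>

lemma is_completionI:
  assumes T: "is_linear_topology T" and T': "is_linear_topology T'"
    and haus: "Hausdorff_space T'" and compl: "complete_linear_topology T'"
    and lin: "linear_on (topspace T) \<iota>" and im: "\<iota> ` topspace T \<subseteq> topspace T'"
    and dense: "\<And>y E. y \<in> topspace T' \<Longrightarrow> E \<in> open_subspaces T' \<Longrightarrow> \<exists>x\<in>topspace T. \<iota> x - y \<in> E"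
    and cont: "\<And>E'. E' \<in> open_subspaces T' \<Longrightarrow> \<exists>E\<in>open_subspaces T. \<iota> ` E \<subseteq> E'"
    and "open": "\<And>E. E \<in> open_subspaces T \<Longrightarrow>
                  \<exists>E'\<in>open_subspaces T'. {x \<in> topspace T. \<iota> x \<in> E'} \<subseteq> E"
  shows "is_completion T T' \<iota>"
  unfolding is_completion_def
proof (intro conjI T' haus compl lin im allI)
  note subT = subspace_topspace[OF T]
  show "T' closure_of (\<iota> ` topspace T) = topspace T'"
  proof
    show "topspace T' \<subseteq> T' closure_of (\<iota> ` topspace T)"
    proof
      fix y assume y: "y \<in> topspace T'"
      show "y \<in> T' closure_of (\<iota> ` topspace T)"
        unfolding in_closure_of
      proof (intro conjI y allI impI)
        fix U assume "y \<in> U \<and> openin T' U"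
        then obtain E where "E \<in> open_subspaces T'" "(+) y ` E \<subseteq> U"
          using openin_iff_cosets[OF T'] by blast
        moreover from this obtain x where "x \<in> topspace T" "\<iota> x - y \<in> E" using dense y by blast
        ultimately show "\<exists>z. z \<in> \<iota> ` topspace T \<and> z \<in> U"
          by (metis imageI in_coset_iff subsetD)
      qed
    qed
  qed (rule closure_of_subset_topspace)
  fix U
  show "openin T U \<longleftrightarrow> (\<exists>U'. openin T' U' \<and> U = {x \<in> topspace T. \<iota> x \<in> U'})"
  proof
    assume U: "openin T U"
    have "\<exists>E'\<in>open_subspaces T'. {z \<in> topspace T. \<iota> z - \<iota> x \<in> E'} \<subseteq> U" if x: "x \<in> U" for x
    proof -
      obtain E where E: "E \<in> open_subspaces T" "(+) x ` E \<subseteq> U"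
        using U x openin_iff_cosets[OF T] by blast
      then obtain E' where E': "E' \<in> open_subspaces T'" "{x \<in> topspace T. \<iota> x \<in> E'} \<subseteq> E"
        using "open" by blast
      have xT: "x \<in> topspace T" using U x openin_subset by blast
      have "z \<in> U" if "z \<in> topspace T" "\<iota> z - \<iota> x \<in> E'" for z
      proof -
        have "z - x \<in> E"
          using that E' xT csubspace_diff[OF subT] linear_on_diff[OF lin subT] by auto
        then show ?thesis using E(2) in_coset_iff by blast
      qed
      then show ?thesis using E' by blast
    qed
    then obtain D where D: "\<And>x. x \<in> U \<Longrightarrow> D x \<in> open_subspaces T'"
      "\<And>x. x \<in> U \<Longrightarrow> {z \<in> topspace T. \<iota> z - \<iota> x \<in> D x} \<subseteq> U" by metis
    have UT: "U \<subseteq> topspace T" using U openin_subset by blast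
    have "openin T' (\<Union>x\<in>U. (+) (\<iota> x) ` D x)"
      using D(1) UT im openin_coset[OF T'] by blast
    moreover have "U = {x \<in> topspace T. \<iota> x \<in> (\<Union>x\<in>U. (+) (\<iota> x) ` D x)}"
    proof (intro equalityI subsetI)
      fix x assume x: "x \<in> U"
      then have "0 \<in> D x"
        using D(1) open_subspaces_subspace csubspace_0 by blast
      then show "x \<in> {x \<in> topspace T. \<iota> x \<in> (\<Union>x\<in>U. (+) (\<iota> x) ` D x)}"
        using x UT by (auto simp: in_coset_iff intro!: bexI[of _ x])
    next
      fix x assume "x \<in> {x \<in> topspace T. \<iota> x \<in> (\<Union>x\<in>U. (+) (\<iota> x) ` D x)}"
      then show "x \<in> U" using D(2) by (auto simp: in_coset_iff)
    qed
    ultimately show "\<exists>U'. openin T' U' \<and> U = {x \<in> topspace T. \<iota> x \<in> U'}" by blast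
  next
    assume "\<exists>U'. openin T' U' \<and> U = {x \<in> topspace T. \<iota> x \<in> U'}"
    then obtain U' where U': "openin T' U'" "U = {x \<in> topspace T. \<iota> x \<in> U'}" by blast
    show "openin T U"
      unfolding openin_iff_cosets[OF T]
    proof (intro conjI ballI)
      fix x assume x: "x \<in> U"
      then obtain E' where E': "E' \<in> open_subspaces T'" "(+) (\<iota> x) ` E' \<subseteq> U'"
        using U' openin_iff_cosets[OF T'] by blast
      then obtain E where E: "E \<in> open_subspaces T" "\<iota> ` E \<subseteq> E'" using cont by blast
      have "x + e \<in> U" if "e \<in> E" for e
      proof -
        have e: "e \<in> topspace T" using that E open_subspaces_subset by blast
        then have "\<iota> (x + e) = \<iota> x + \<iota> e" using lin x U' linear_on_add by blast
        moreover have "\<iota> x + \<iota> e \<in> U'" using E' E that by blast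
        ultimately show ?thesis using e x U' csubspace_add[OF subT] by simp
      qed
      then show "\<exists>E\<in>open_subspaces T. (+) x ` E \<subseteq> U" using E by blast
    qed (use U' in auto)
  qed
qed

lemma is_completionD:
  assumes c: "is_completion T T' \<iota>" and T: "is_linear_topology T"
  shows "is_linear_topology T'" "Hausdorff_space T'" "complete_linear_topology T'"
    "linear_on (topspace T) \<iota>" "\<And>x. x \<in> topspace T \<Longrightarrow> \<iota> x \<in> topspace T'"
    "\<And>y E. y \<in> topspace T' \<Longrightarrow> E \<in> open_subspaces T' \<Longrightarrow> \<exists>x\<in>topspace T. \<iota> x - y \<in> E"
    "\<And>E'. E' \<in> open_subspaces T' \<Longrightarrow> {x \<in> topspace T. \<iota> x \<in> E'} \<in> open_subspaces T"
    "\<And>E. E \<in> open_subspaces T \<Longrightarrow> \<exists>E'\<in>open_subspaces T'. {x \<in> topspace T. \<iota> x \<in> E'} \<subseteq> E"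
proof -
  show T': "is_linear_topology T'" and "Hausdorff_space T'" "complete_linear_topology T'"
    and lin: "linear_on (topspace T) \<iota>" and "\<And>x. x \<in> topspace T \<Longrightarrow> \<iota> x \<in> topspace T'"
    using c by (auto simp: is_completion_def)
  show "\<exists>x\<in>topspace T. \<iota> x - y \<in> E" if y: "y \<in> topspace T'" and E: "E \<in> open_subspaces T'" for y E
  proof -
    have "y \<in> T' closure_of (\<iota> ` topspace T)" using c y by (simp add: is_completion_def)
    moreover have "y \<in> (+) y ` E"
      using csubspace_0[OF open_subspaces_subspace[OF E]] by (simp add: in_coset_iff)
    ultimately obtain z where "z \<in> \<iota> ` topspace T" "z \<in> (+) y ` E"
      using openin_coset[OF T' E y] by (meson in_closure_of)
    then show ?thesis by (auto simp: in_coset_iff)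
  qed
  have op: "openin T U \<longleftrightarrow> (\<exists>U'. openin T' U' \<and> U = {x \<in> topspace T. \<iota> x \<in> U'})" for U
    using c by (simp add: is_completion_def)
  show "{x \<in> topspace T. \<iota> x \<in> E'} \<in> open_subspaces T" if "E' \<in> open_subspaces T'" for E'
    using that op subspace_vimage_Int[OF lin subspace_topspace[OF T]]
    by (auto simp: open_subspaces_def)
  show "\<exists>E'\<in>open_subspaces T'. {x \<in> topspace T. \<iota> x \<in> E'} \<subseteq> E" if E: "E \<in> open_subspaces T" for E
  proof -
    obtain U' where U': "openin T' U'" "E = {x \<in> topspace T. \<iota> x \<in> U'}"
      using E op by (auto simp: open_subspaces_def)
    have "\<iota> 0 \<in> U'" using U'(2) csubspace_0[OF open_subspaces_subspace[OF E]] by blast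
    then have "0 \<in> U'" using linear_on_0[OF lin subspace_topspace[OF T]] by simp
    then obtain E' where "E' \<in> open_subspaces T'" "E' \<subseteq> U'"
      by (rule open_contains_subspace[OF T' U'(1)])
    then show ?thesis using U'(2) by blast
  qed
qed

text \<open>The isomorphism between two completions is, as a set of pairs, the closure of
  \<open>{(\<iota> x, \<kappa> x)}\<close> in their product. The description is symmetric in the two completions, so that
  each property of this relation has to be proved in one direction only.\<close>

definition limit_pair ::
    "'a::complex_vector topology \<Rightarrow> 'b::complex_vector topology \<Rightarrow> ('a \<Rightarrow> 'b) \<Rightarrow>
     'c::complex_vector topology \<Rightarrow> ('a \<Rightarrow> 'c) \<Rightarrow> 'b \<Rightarrow> 'c \<Rightarrow> bool" where
  "limit_pair T A \<iota> B \<kappa> a b \<longleftrightarrow> a \<in> topspace A \<and> b \<in> topspace B \<and>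
     (\<forall>D\<in>open_subspaces A. \<forall>E\<in>open_subspaces B. \<exists>x\<in>topspace T. \<iota> x - a \<in> D \<and> \<kappa> x - b \<in> E)"

lemma limit_pair_sym: "limit_pair T A \<iota> B \<kappa> a b \<longleftrightarrow> limit_pair T B \<kappa> A \<iota> b a"
  unfolding limit_pair_def by blast

context
  fixes T :: "'a::complex_vector topology" and A :: "'b::complex_vector topology" and \<iota>
    and B :: "'c::complex_vector topology" and \<kappa>
  assumes T: "is_linear_topology T" and A: "is_completion T A \<iota>" and B: "is_completion T B \<kappa>"
begin

lemma limit_pair_map: "x \<in> topspace T \<Longrightarrow> limit_pair T A \<iota> B \<kappa> (\<iota> x) (\<kappa> x)"
  unfolding limit_pair_def
proof (intro conjI ballI)
  assume x: "x \<in> topspace T"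
  show "\<iota> x \<in> topspace A" "\<kappa> x \<in> topspace B"
    using x is_completionD(5)[OF A T] is_completionD(5)[OF B T] by auto
  fix D E assume "D \<in> open_subspaces A" "E \<in> open_subspaces B"
  then have "\<iota> x - \<iota> x \<in> D" "\<kappa> x - \<kappa> x \<in> E"
    using open_subspaces_subspace csubspace_0 by auto
  then show "\<exists>z\<in>topspace T. \<iota> z - \<iota> x \<in> D \<and> \<kappa> z - \<kappa> x \<in> E" using x by blast
qed

lemma open_subspace_transfer:
  assumes "E \<in> open_subspaces B"
  obtains D where "D \<in> open_subspaces A" "\<And>x. x \<in> topspace T \<Longrightarrow> \<iota> x \<in> D \<Longrightarrow> \<kappa> x \<in> E"
proof -
  obtain D where "D \<in> open_subspaces A"
      "{x \<in> topspace T. \<iota> x \<in> D} \<subseteq> {x \<in> topspace T. \<kappa> x \<in> E}"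
    using is_completionD(8)[OF A T is_completionD(7)[OF B T assms]] by blast
  then show ?thesis using that by blast
qed

text \<open>If \<open>\<iota> x \<in> D\<close> forces \<open>\<kappa> x \<in> E\<close>, then this persists for limits: a point \<open>x\<close> with \<open>\<iota> x\<close> close to \<open>a \<in> D\<close>
  satisfies \<open>\<iota> x \<in> D\<close>, whence \<open>\<kappa> x \<in> E\<close>, and \<open>b\<close> differs from \<open>\<kappa> x\<close> by an element of \<open>E\<close>.\<close>

lemma limit_pair_open:
  assumes "E \<in> open_subspaces B"
  obtains D where "D \<in> open_subspaces A"
    "\<And>a b. limit_pair T A \<iota> B \<kappa> a b \<Longrightarrow> a \<in> D \<Longrightarrow> b \<in> E"
proof -
  obtain D where D: "D \<in> open_subspaces A" "\<And>x. x \<in> topspace T \<Longrightarrow> \<iota> x \<in> D \<Longrightarrow> \<kappa> x \<in> E"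
    using open_subspace_transfer[OF assms] by blast
  have "b \<in> E" if p: "limit_pair T A \<iota> B \<kappa> a b" and a: "a \<in> D" for a b
  proof -
    obtain x where x: "x \<in> topspace T" "\<iota> x - a \<in> D" "\<kappa> x - b \<in> E"
      using p D(1) assms unfolding limit_pair_def by blast
    have "\<iota> x - a + a \<in> D"
      using csubspace_add[OF open_subspaces_subspace[OF D(1)] x(2) a] .
    then have "\<kappa> x \<in> E" using D(2) x(1) by simp
    then have "\<kappa> x - (\<kappa> x - b) \<in> E"
      using csubspace_diff[OF open_subspaces_subspace[OF assms] _ x(3)] by blast
    then show ?thesis by simp
  qed
  then show ?thesis using that D(1) by blast
qed

lemma limit_pair_add:
  assumes "limit_pair T A \<iota> B \<kappa> a b" "limit_pair T A \<iota> B \<kappa> a' b'"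
  shows "limit_pair T A \<iota> B \<kappa> (a + a') (b + b')"
  unfolding limit_pair_def
proof (intro conjI ballI)
  show "a + a' \<in> topspace A" "b + b' \<in> topspace B"
    using assms csubspace_add[OF subspace_topspace[OF is_completionD(1)[OF A T]]]
      csubspace_add[OF subspace_topspace[OF is_completionD(1)[OF B T]]]
    by (auto simp: limit_pair_def)
  fix D E assume D: "D \<in> open_subspaces A" and E: "E \<in> open_subspaces B"
  obtain x where x: "x \<in> topspace T" "\<iota> x - a \<in> D" "\<kappa> x - b \<in> E"
    using assms(1) D E unfolding limit_pair_def by blast
  obtain x' where x': "x' \<in> topspace T" "\<iota> x' - a' \<in> D" "\<kappa> x' - b' \<in> E"
    using assms(2) D E unfolding limit_pair_def by blast
  have "(\<iota> x - a) + (\<iota> x' - a') \<in> D" "(\<kappa> x - b) + (\<kappa> x' - b') \<in> E"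
    using csubspace_add[OF open_subspaces_subspace[OF D] x(2) x'(2)]
      csubspace_add[OF open_subspaces_subspace[OF E] x(3) x'(3)] .
  moreover have "\<iota> (x + x') = \<iota> x + \<iota> x'" "\<kappa> (x + x') = \<kappa> x + \<kappa> x'"
    using linear_on_add[OF is_completionD(4)[OF A T]] linear_on_add[OF is_completionD(4)[OF B T]]
      x x' by auto
  ultimately have "\<iota> (x + x') - (a + a') \<in> D" "\<kappa> (x + x') - (b + b') \<in> E"
    by (simp_all add: algebra_simps)
  moreover have "x + x' \<in> topspace T"
    by (rule csubspace_add[OF subspace_topspace[OF T] x(1) x'(1)])
  ultimately show "\<exists>x\<in>topspace T. \<iota> x - (a + a') \<in> D \<and> \<kappa> x - (b + b') \<in> E" by blast
qed

lemma limit_pair_scale: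
  assumes "limit_pair T A \<iota> B \<kappa> a b"
  shows "limit_pair T A \<iota> B \<kappa> (c *\<^sub>C a) (c *\<^sub>C b)"
  unfolding limit_pair_def
proof (intro conjI ballI)
  show "c *\<^sub>C a \<in> topspace A" "c *\<^sub>C b \<in> topspace B"
    using assms csubspace_scale[OF subspace_topspace[OF is_completionD(1)[OF A T]]]
      csubspace_scale[OF subspace_topspace[OF is_completionD(1)[OF B T]]]
    by (auto simp: limit_pair_def)
  fix D E assume D: "D \<in> open_subspaces A" and E: "E \<in> open_subspaces B"
  obtain x where x: "x \<in> topspace T" "\<iota> x - a \<in> D" "\<kappa> x - b \<in> E"
    using assms(1) D E unfolding limit_pair_def by blast
  have "c *\<^sub>C (\<iota> x - a) \<in> D" "c *\<^sub>C (\<kappa> x - b) \<in> E"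
    using csubspace_scale[OF open_subspaces_subspace[OF D] x(2)]
      csubspace_scale[OF open_subspaces_subspace[OF E] x(3)] .
  moreover have "\<iota> (c *\<^sub>C x) = c *\<^sub>C \<iota> x" "\<kappa> (c *\<^sub>C x) = c *\<^sub>C \<kappa> x"
    using linear_on_scale[OF is_completionD(4)[OF A T]] linear_on_scale[OF is_completionD(4)[OF B T]]
      x by auto
  ultimately have "\<iota> (c *\<^sub>C x) - c *\<^sub>C a \<in> D" "\<kappa> (c *\<^sub>C x) - c *\<^sub>C b \<in> E"
    by (simp_all add: complex_vector.scale_right_diff_distrib)
  moreover have "c *\<^sub>C x \<in> topspace T"
    by (rule csubspace_scale[OF subspace_topspace[OF T] x(1)])
  ultimately show "\<exists>x\<in>topspace T. \<iota> x - c *\<^sub>C a \<in> D \<and> \<kappa> x - c *\<^sub>C b \<in> E" by blast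
qed

text \<open>By linearity it suffices that \<open>0\<close> is related to \<open>b - b'\<close> only if this difference lies in every open
  subspace.\<close>

lemma limit_pair_unique:
  assumes "limit_pair T A \<iota> B \<kappa> a b" "limit_pair T A \<iota> B \<kappa> a b'"
  shows "b = b'"
proof -
  have "limit_pair T A \<iota> B \<kappa> (a + (- 1) *\<^sub>C a) (b + (- 1) *\<^sub>C b')"
    by (intro limit_pair_add limit_pair_scale assms)
  then have p: "limit_pair T A \<iota> B \<kappa> 0 (b - b')" by simp
  have "b - b' = 0"
  proof (rule Hausdorff_linear_separation)
    show "is_linear_topology B" "Hausdorff_space B" using is_completionD[OF B T] by auto
    show "b - b' \<in> topspace B" using p by (simp add: limit_pair_def)
    fix E assume "E \<in> open_subspaces B"
    then obtain D where "D \<in> open_subspaces A"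
      "\<And>a b. limit_pair T A \<iota> B \<kappa> a b \<Longrightarrow> a \<in> D \<Longrightarrow> b \<in> E"
      using limit_pair_open by blast
    then show "b - b' \<in> E"
      using p csubspace_0[OF open_subspaces_subspace] by blast
  qed
  then show ?thesis by simp
qed

text \<open>The images under \<open>\<kappa>\<close> of the points of \<open>T\<close> near \<open>a\<close> form a Cauchy filter.\<close>

lemma limit_pair_exists:
  assumes a: "a \<in> topspace A"
  shows "\<exists>b. limit_pair T A \<iota> B \<kappa> a b"
proof -
  note lA = is_completionD(1)[OF A T] and lB = is_completionD(1)[OF B T]
  define G where "G D = \<kappa> ` {x \<in> topspace T. \<iota> x - a \<in> D}" for D
  define \<F> where "\<F> = (INF D\<in>open_subspaces A. principal (G D))"
  have ev: "eventually P \<F> \<longleftrightarrow> (\<exists>D\<in>open_subspaces A. \<forall>y\<in>G D. P y)" for P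
    unfolding \<F>_def eventually_principal[symmetric]
  proof (rule eventually_INF_base)
    show "open_subspaces A \<noteq> {}" using topspace_open_subspace[OF lA] by blast
    fix D D' assume "D \<in> open_subspaces A" "D' \<in> open_subspaces A"
    then show "\<exists>x\<in>open_subspaces A. principal (G x) \<le> inf (principal (G D)) (principal (G D'))"
      by (intro bexI[of _ "D \<inter> D'"]) (auto simp: G_def open_subspaces_Int)
  qed
  have ne: "\<F> \<noteq> bot"
  proof
    assume "\<F> = bot"
    then have "eventually (\<lambda>_. False) \<F>" by simp
    then obtain D where "D \<in> open_subspaces A" "G D = {}" unfolding ev by blast
    then show False using is_completionD(6)[OF A T a] unfolding G_def by blast
  qed
  moreover have "\<F> \<le> principal (topspace B)"
    unfolding le_principal ev
    using topspace_open_subspace[OF lA] is_completionD(5)[OF B T] by (auto simp: G_def)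
  moreover have "\<exists>x\<in>topspace B. eventually (\<lambda>y. y - x \<in> E) \<F>" if E: "E \<in> open_subspaces B" for E
  proof -
    obtain D where D: "D \<in> open_subspaces A" "\<And>x. x \<in> topspace T \<Longrightarrow> \<iota> x \<in> D \<Longrightarrow> \<kappa> x \<in> E"
      using open_subspace_transfer[OF E] by blast
    obtain x where x: "x \<in> topspace T" "\<iota> x - a \<in> D" using is_completionD(6)[OF A T a D(1)] by blast
    have "\<kappa> z - \<kappa> x \<in> E" if z: "z \<in> topspace T" "\<iota> z - a \<in> D" for z
    proof -
      have "(\<iota> z - a) - (\<iota> x - a) \<in> D"
        using csubspace_diff[OF open_subspaces_subspace[OF D(1)]] z x by blast
      then have "\<iota> (z - x) \<in> D"
        using linear_on_diff[OF is_completionD(4)[OF A T] subspace_topspace[OF T]] z x by simp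
      then have "\<kappa> (z - x) \<in> E"
        using D(2) csubspace_diff[OF subspace_topspace[OF T]] z x by blast
      then show ?thesis
        using linear_on_diff[OF is_completionD(4)[OF B T] subspace_topspace[OF T]] z x by simp
    qed
    then have "eventually (\<lambda>y. y - \<kappa> x \<in> E) \<F>"
      unfolding ev using D(1) by (auto simp: G_def)
    then show ?thesis using is_completionD(5)[OF B T x(1)] by blast
  qed
  ultimately obtain b where b: "limitin B (\<lambda>y. y) b \<F>"
    using is_completionD(3)[OF B T] unfolding complete_linear_topology_def by blast
  then have bB: "b \<in> topspace B" by (rule limitin_topspace)
  have "\<exists>x\<in>topspace T. \<iota> x - a \<in> D \<and> \<kappa> x - b \<in> E"
    if D: "D \<in> open_subspaces A" and E: "E \<in> open_subspaces B" for D E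
  proof -
    have "b \<in> (+) b ` E"
      using csubspace_0[OF open_subspaces_subspace[OF E]] by (simp add: in_coset_iff)
    then have "eventually (\<lambda>y. y \<in> (+) b ` E) \<F>"
      using b openin_coset[OF lB E bB] by (auto simp: limitin_def)
    moreover have "eventually (\<lambda>y. y \<in> G D) \<F>" unfolding ev using D by blast
    ultimately have "eventually (\<lambda>y. y \<in> (+) b ` E \<and> y \<in> G D) \<F>" by (rule eventually_conj)
    then obtain y where "y \<in> (+) b ` E" "y \<in> G D"
      using eventually_happens'[OF ne] by blast
    then show ?thesis by (auto simp: in_coset_iff G_def)
  qed
  then show ?thesis using a bB unfolding limit_pair_def by blast
qed

end

text \<open>The relation \<open>limit_pair\<close> is the graph of the isomorphism: it is linear, and existence, uniqueness
  and openness hold in both directions by symmetry.\<close>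

lemma completion_unique:
  assumes T: "is_linear_topology T" and A: "is_completion T A \<iota>" and B: "is_completion T B \<kappa>"
  shows "\<exists>\<phi>. tvs_iso A B \<phi> \<and> (\<forall>x\<in>topspace T. \<phi> (\<iota> x) = \<kappa> x)"
proof -
  let ?R = "limit_pair T A \<iota> B \<kappa>"
  define \<phi> where "\<phi> a = (THE b. ?R a b)" for a
  note lA = is_completionD(1)[OF A T] and lB = is_completionD(1)[OF B T]
  have \<phi>: "?R a b \<longleftrightarrow> a \<in> topspace A \<and> \<phi> a = b" for a b
  proof -
    have "\<exists>!b. ?R a b" if "a \<in> topspace A"
      using limit_pair_exists[OF T A B that] limit_pair_unique[OF T A B] by blast
    then have "?R a (\<phi> a)" if "a \<in> topspace A" using that theI' unfolding \<phi>_def by metis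
    then show ?thesis using limit_pair_unique[OF T A B] by (auto simp: limit_pair_def)
  qed
  have in\<phi>: "\<phi> a \<in> topspace B" if "a \<in> topspace A" for a
    using \<phi>[of a "\<phi> a"] that by (simp add: limit_pair_def)
  have "tvs_iso A B \<phi>"
  proof (rule tvs_isoI[OF lA lB])
    show "linear_on (topspace A) \<phi>"
      unfolding linear_on_def
      using \<phi> limit_pair_add[OF T A B] limit_pair_scale[OF T A B] by blast
    show "bij_betw \<phi> (topspace A) (topspace B)"
      unfolding bij_betw_def
    proof
      show "inj_on \<phi> (topspace A)"
        using \<phi> limit_pair_unique[OF T B A] limit_pair_sym[of T A \<iota> B \<kappa>] unfolding inj_on_def by blast
      have "b \<in> \<phi> ` topspace A" if "b \<in> topspace B" for b
      proof -
        obtain a where "?R a b"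
          using limit_pair_exists[OF T B A \<open>b \<in> topspace B\<close>] limit_pair_sym[of T A \<iota> B \<kappa>] by blast
        then have "a \<in> topspace A" "b = \<phi> a" using \<phi>[of a b] by auto
        then show ?thesis by (rule rev_image_eqI)
      qed
      then show "\<phi> ` topspace A = topspace B" using in\<phi> by blast
    qed
    show "\<exists>D\<in>open_subspaces A. \<phi> ` D \<subseteq> E" if "E \<in> open_subspaces B" for E
      using limit_pair_open[OF T A B that] \<phi> open_subspaces_subset by (metis image_subsetI subsetD)
    show "\<exists>E\<in>open_subspaces B. {x \<in> topspace A. \<phi> x \<in> E} \<subseteq> D" if D: "D \<in> open_subspaces A" for D
    proof -
      obtain E where E: "E \<in> open_subspaces B"
        "\<And>b a. limit_pair T B \<kappa> A \<iota> b a \<Longrightarrow> b \<in> E \<Longrightarrow> a \<in> D"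
        using limit_pair_open[OF T B A D] by blast
      then have "{x \<in> topspace A. \<phi> x \<in> E} \<subseteq> D"
        using \<phi> limit_pair_sym[of T A \<iota> B \<kappa>] by blast
      then show ?thesis using E(1) by blast
    qed
  qed
  moreover have "\<phi> (\<iota> x) = \<kappa> x" if "x \<in> topspace T" for x
    using limit_pair_map[OF T A B that] \<phi> by blast
  ultimately show ?thesis by blast
qed

lemma is_completion_self:
  assumes "is_linear_topology T" "Hausdorff_space T" "complete_linear_topology T"
  shows "is_completion T T (\<lambda>x. x)"
proof (rule is_completionI)
  show "\<exists>x\<in>topspace T. x - y \<in> E" if "y \<in> topspace T" "E \<in> open_subspaces T" for y E
    using that csubspace_0 open_subspaces_subspace by (metis diff_self)
qed (use assms in \<open>auto simp: linear_on_def\<close>)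

lemma is_completion_compose_iso:
  assumes \<phi>: "tvs_iso T T' \<phi>" and T: "is_linear_topology T" and T': "is_linear_topology T'"
    and c: "is_completion T' A \<iota>"
  shows "is_completion T A (\<lambda>x. \<iota> (\<phi> x))"
proof (rule is_completionI[OF T])
  note A = is_completionD[OF c T']
  obtain \<psi> where \<psi>: "tvs_iso T' T \<psi>" "\<And>x. x \<in> topspace T \<Longrightarrow> \<psi> (\<phi> x) = x"
    "\<And>y. y \<in> topspace T' \<Longrightarrow> \<phi> (\<psi> y) = y"
    using tvs_iso_inverse[OF \<phi> T] by blast
  show "is_linear_topology A" "Hausdorff_space A" "complete_linear_topology A" using A by auto
  show "linear_on (topspace T) (\<lambda>x. \<iota> (\<phi> x))"
    using A(4) tvs_iso_linear[OF \<phi>] tvs_iso_in[OF \<phi>] unfolding linear_on_def by simp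
  show "(\<lambda>x. \<iota> (\<phi> x)) ` topspace T \<subseteq> topspace A" using A(5) tvs_iso_in[OF \<phi>] by blast
  show "\<exists>x\<in>topspace T. \<iota> (\<phi> x) - y \<in> E" if "y \<in> topspace A" "E \<in> open_subspaces A" for y E
    using A(6)[OF that] \<psi>(3) tvs_iso_in[OF \<psi>(1)] by metis
  show "\<exists>E\<in>open_subspaces T. (\<lambda>x. \<iota> (\<phi> x)) ` E \<subseteq> E'" if "E' \<in> open_subspaces A" for E'
    using tvs_iso_vimage[OF \<phi> T A(7)[OF that]] by (rule bexI[rotated]) auto
  show "\<exists>E'\<in>open_subspaces A. {x \<in> topspace T. \<iota> (\<phi> x) \<in> E'} \<subseteq> E" if E: "E \<in> open_subspaces T" for E
  proof -
    obtain E' where E': "E' \<in> open_subspaces A"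
        "{x \<in> topspace T'. \<iota> x \<in> E'} \<subseteq> {y \<in> topspace T'. \<psi> y \<in> E}"
      using A(8)[OF tvs_iso_vimage[OF \<psi>(1) T' E]] by blast
    have "x \<in> E" if x: "x \<in> topspace T" "\<iota> (\<phi> x) \<in> E'" for x
    proof -
      have "\<phi> x \<in> {y \<in> topspace T'. \<psi> y \<in> E}" using E'(2) x tvs_iso_in[OF \<phi> x(1)] by blast
      then show ?thesis using \<psi>(2)[OF x(1)] by simp
    qed
    then show ?thesis using E'(1) by blast
  qed
qed

lemma iso_compose_is_completion:
  assumes c: "is_completion T A \<iota>" and T: "is_linear_topology T"
    and \<phi>: "tvs_iso A B \<phi>" and B: "is_linear_topology B"
  shows "is_completion T B (\<lambda>x. \<phi> (\<iota> x))"
proof (rule is_completionI[OF T B])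
  note A = is_completionD[OF c T]
  obtain \<psi> where \<psi>: "tvs_iso B A \<psi>" "\<And>x. x \<in> topspace A \<Longrightarrow> \<psi> (\<phi> x) = x"
    "\<And>y. y \<in> topspace B \<Longrightarrow> \<phi> (\<psi> y) = y"
    using tvs_iso_inverse[OF \<phi> A(1)] by blast
  show "Hausdorff_space B"
  proof -
    have "A homeomorphic_space B"
      using \<phi> homeomorphic_map_imp_homeomorphic_space unfolding tvs_iso_def by blast
    then show ?thesis using A(2) homeomorphic_Hausdorff_space by blast
  qed
  show "complete_linear_topology B" using complete_linear_topology_iso[OF \<phi> A(1) B A(3)] .
  show "linear_on (topspace T) (\<lambda>x. \<phi> (\<iota> x))"
    using A(4,5) tvs_iso_linear[OF \<phi>] unfolding linear_on_def by simp
  show "(\<lambda>x. \<phi> (\<iota> x)) ` topspace T \<subseteq> topspace B" using A(5) tvs_iso_in[OF \<phi>] by blast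
  show "\<exists>x\<in>topspace T. \<phi> (\<iota> x) - y \<in> E" if y: "y \<in> topspace B" and E: "E \<in> open_subspaces B" for y E
  proof -
    obtain x where x: "x \<in> topspace T" "\<iota> x - \<psi> y \<in> {x \<in> topspace A. \<phi> x \<in> E}"
      using A(6) tvs_iso_in[OF \<psi>(1) y] tvs_iso_vimage[OF \<phi> A(1) E] by meson
    then have "\<phi> (\<iota> x) - \<phi> (\<psi> y) \<in> E"
      using linear_on_diff[OF tvs_iso_linear[OF \<phi>] subspace_topspace[OF A(1)]]
        A(5) tvs_iso_in[OF \<psi>(1) y] by auto
    then show ?thesis using x(1) \<psi>(3) y by auto
  qed
  show "\<exists>E\<in>open_subspaces T. (\<lambda>x. \<phi> (\<iota> x)) ` E \<subseteq> E'" if "E' \<in> open_subspaces B" for E'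
    using A(7)[OF tvs_iso_vimage[OF \<phi> A(1) that]] by (rule bexI[rotated]) auto
  show "\<exists>E'\<in>open_subspaces B. {x \<in> topspace T. \<phi> (\<iota> x) \<in> E'} \<subseteq> E" if E: "E \<in> open_subspaces T" for E
  proof -
    obtain E' where E': "E' \<in> open_subspaces A" "{x \<in> topspace T. \<iota> x \<in> E'} \<subseteq> E"
      using A(8)[OF E] by blast
    have "{x \<in> topspace T. \<phi> (\<iota> x) \<in> {y \<in> topspace B. \<psi> y \<in> E'}} \<subseteq> E"
    proof
      fix x assume "x \<in> {x \<in> topspace T. \<phi> (\<iota> x) \<in> {y \<in> topspace B. \<psi> y \<in> E'}}"
      then have x: "x \<in> topspace T" "\<psi> (\<phi> (\<iota> x)) \<in> E'" by auto
      then show "x \<in> E" using E'(2) \<psi>(2)[OF A(5)[OF x(1)]] by auto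
    qed
    then show ?thesis using tvs_iso_vimage[OF \<psi>(1) B E'(1)] by blast
  qed
qed

text \<open>Since a completion is selected inside the fixed type \<open>coeffs\<close>, one that was constructed on another
  type has to be carried there along an injective linear map.\<close>

lemma transported_topology:
  fixes e :: "'a::complex_vector \<Rightarrow> 'b::complex_vector"
  assumes T: "is_linear_topology T" and lin: "linear_on (topspace T) e"
    and inj: "inj_on e (topspace T)"
  obtains T' where "is_linear_topology T'" "tvs_iso T T' e"
proof -
  let ?B = "(`) e ` open_subspaces T"
  have base: "zero_base (e ` topspace T) ?B"
    unfolding zero_base_def
  proof (intro conjI ballI)
    show "csubspace (e ` topspace T)"
      using subspace_image[OF lin subspace_topspace[OF T]] by blast
    show "?B \<noteq> {}" using topspace_open_subspace[OF T] by blast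
    fix E assume "E \<in> ?B"
    then show "csubspace E" "E \<subseteq> e ` topspace T"
      using subspace_image[OF lin] open_subspaces_subset open_subspaces_subspace by blast+
  next
    fix E E' assume "E \<in> ?B" "E' \<in> ?B"
    then obtain D D' where "D \<in> open_subspaces T" "D' \<in> open_subspaces T" "E = e ` D" "E' = e ` D'"
      by blast
    then show "\<exists>E''\<in>?B. E'' \<subseteq> E \<inter> E'"
      by (intro bexI[of _ "e ` (D \<inter> D')"]) (auto simp: open_subspaces_Int)
  qed
  note top = topspace_zero_base[OF base] and lT' = is_linear_topology_zero_base[OF base]
  have sub: "?B \<subseteq> open_subspaces (linear_topology (e ` topspace T) ?B)"
    using base by (auto simp: open_subspaces_zero_base[OF base] zero_base_def)
  have "tvs_iso T (linear_topology (e ` topspace T) ?B) e"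
  proof (rule tvs_isoI[OF T lT' lin])
    show "bij_betw e (topspace T) (topspace (linear_topology (e ` topspace T) ?B))"
      using inj by (simp add: top bij_betw_def)
    show "\<exists>E\<in>open_subspaces T. e ` E \<subseteq> E'"
      if "E' \<in> open_subspaces (linear_topology (e ` topspace T) ?B)" for E'
      using that by (auto simp: open_subspaces_zero_base[OF base])
    show "\<exists>E'\<in>open_subspaces (linear_topology (e ` topspace T) ?B). {x \<in> topspace T. e x \<in> E'} \<subseteq> E"
      if E: "E \<in> open_subspaces T" for E
    proof -
      have "{x \<in> topspace T. e x \<in> e ` E} \<subseteq> E"
        using inj open_subspaces_subset[OF E] by (auto dest: inj_onD)
      then show ?thesis using sub E by blast
    qed
  qed
  then show ?thesis using that lT' by blast
qed

text \<open>Whichever completion has been selected, it is isomorphic to every concrete one that embeds into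
  \<open>coeffs\<close>. All later statements about iterated completed products rest on this.\<close>

lemma completion_iso:
  assumes T: "is_linear_topology T" and c: "is_completion T M \<kappa>"
    and e: "linear_on (topspace M) e" "inj_on (e :: _ \<Rightarrow> coeffs) (topspace M)"
  obtains \<phi> where "tvs_iso (completion T) M \<phi>"
    "\<And>x. x \<in> topspace T \<Longrightarrow> \<phi> (completion_map T x) = \<kappa> x"
    "is_completion T (completion T) (completion_map T)"
proof -
  obtain M' where "is_linear_topology M'" "tvs_iso M M' e"
    using transported_topology[OF is_completionD(1)[OF c T] e] by blast
  then have "is_completion T M' (\<lambda>x. e (\<kappa> x))"
    using iso_compose_is_completion[OF c T] by blast
  then have "is_completion T (completion T) (completion_map T)"
    by (rule is_completion_completion)
  then show ?thesis using completion_unique[OF T _ c] that by blast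
qed

section \<open>The two tensor product topologies\<close>

lemma subspace_tensor_space: "csubspace (tensor_space A B)"
  by (simp add: tensor_space_def)

lemma pure2_in_tensor_space: "a \<in> A \<Longrightarrow> b \<in> B \<Longrightarrow> a \<otimes> b \<in> tensor_space A B"
  unfolding tensor_space_def by (rule cspan_base) blast

lemma tensor_space_subset_iff:
  assumes "csubspace E"
  shows "tensor_space A B \<subseteq> E \<longleftrightarrow> (\<forall>a\<in>A. \<forall>b\<in>B. a \<otimes> b \<in> E)"
proof
  assume "\<forall>a\<in>A. \<forall>b\<in>B. a \<otimes> b \<in> E"
  then have "{a \<otimes> b |a b. a \<in> A \<and> b \<in> B} \<subseteq> E" by blast
  then show "tensor_space A B \<subseteq> E"
    unfolding tensor_space_def using assms by (rule cspan_minimal)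
qed (use pure2_in_tensor_space[of _ A _ B] in blast)

lemma tensor_space_mono: "A \<subseteq> A' \<Longrightarrow> B \<subseteq> B' \<Longrightarrow> tensor_space A B \<subseteq> tensor_space A' B'"
  using tensor_space_subset_iff[OF subspace_tensor_space, of A B A' B'] pure2_in_tensor_space[of _ A' _ B']
  by blast

lemma clinear_tensor_space:
  assumes L: "clinear L" and E: "csubspace E"
    and "\<And>a b. a \<in> A \<Longrightarrow> b \<in> B \<Longrightarrow> L (a \<otimes> b) \<in> E" and t: "t \<in> tensor_space A B"
  shows "L t \<in> E"
proof -
  have "tensor_space A B \<subseteq> {t. L t \<in> E}"
    using tensor_space_subset_iff[OF subspace_vimage[OF L E]] assms(3) by simp
  then show ?thesis using t by blast
qed

lemma clinear_eq_on_tensor_space: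
  assumes L: "clinear L" and M: "clinear M"
    and eq: "\<And>a b. a \<in> A \<Longrightarrow> b \<in> B \<Longrightarrow> L (a \<otimes> b) = M (a \<otimes> b)" and t: "t \<in> tensor_space A B"
  shows "L t = M t"
  using complex_vector_pair.linear_eq_on_span[OF L M, of "{a \<otimes> b | a b. a \<in> A \<and> b \<in> B}" t] eq t
  unfolding tensor_space_def by blast

definition star_base where
  "star_base T1 T2 = {E. csubspace E \<and> E \<subseteq> tensor_space (topspace T1) (topspace T2) \<and>
       (\<exists>P1\<in>open_subspaces T1. \<exists>P2\<in>open_subspaces T2. tensor_space P1 P2 \<subseteq> E) \<and>
       (\<forall>w1\<in>topspace T1. \<exists>Q\<in>open_subspaces T2. \<forall>y\<in>Q. w1 \<otimes> y \<in> E) \<and>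
       (\<forall>w2\<in>topspace T2. \<exists>Q\<in>open_subspaces T1. \<forall>x\<in>Q. x \<otimes> w2 \<in> E)}"

definition shriek_base where
  "shriek_base T1 T2 = {E. csubspace E \<and> E \<subseteq> tensor_space (topspace T1) (topspace T2) \<and>
       (\<exists>P1\<in>open_subspaces T1. \<exists>P2\<in>open_subspaces T2.
          tensor_space P1 (topspace T2) \<subseteq> E \<and> tensor_space (topspace T1) P2 \<subseteq> E)}"

lemma star_tensor_base:
  "star_tensor T1 T2 = linear_topology (tensor_space (topspace T1) (topspace T2)) (star_base T1 T2)"
  by (simp add: star_tensor_def star_base_def)

lemma shriek_tensor_base:
  "shriek_tensor T1 T2 = linear_topology (tensor_space (topspace T1) (topspace T2)) (shriek_base T1 T2)"
  by (simp add: shriek_tensor_def shriek_base_def)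

context
  fixes T1 :: "'a::complex_vector topology" and T2 :: "'b::complex_vector topology"
  assumes T1: "is_linear_topology T1" and T2: "is_linear_topology T2"
begin

lemma star_base_Int:
  assumes E: "E \<in> star_base T1 T2" and E': "E' \<in> star_base T1 T2"
  shows "E \<inter> E' \<in> star_base T1 T2"
proof -
  have s: "csubspace E" "csubspace E'"
      "E \<subseteq> tensor_space (topspace T1) (topspace T2)"
    and w: "\<And>w. w \<in> topspace T1 \<Longrightarrow> \<exists>Q\<in>open_subspaces T2. \<forall>y\<in>Q. w \<otimes> y \<in> E"
       "\<And>w. w \<in> topspace T1 \<Longrightarrow> \<exists>Q\<in>open_subspaces T2. \<forall>y\<in>Q. w \<otimes> y \<in> E'"
       "\<And>w. w \<in> topspace T2 \<Longrightarrow> \<exists>Q\<in>open_subspaces T1. \<forall>x\<in>Q. x \<otimes> w \<in> E"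
       "\<And>w. w \<in> topspace T2 \<Longrightarrow> \<exists>Q\<in>open_subspaces T1. \<forall>x\<in>Q. x \<otimes> w \<in> E'"
    using E E' by (auto simp: star_base_def)
  obtain P1 P2 where P: "P1 \<in> open_subspaces T1" "P2 \<in> open_subspaces T2" "tensor_space P1 P2 \<subseteq> E"
    using E unfolding star_base_def by blast
  obtain P1' P2' where P': "P1' \<in> open_subspaces T1" "P2' \<in> open_subspaces T2"
      "tensor_space P1' P2' \<subseteq> E'"
    using E' unfolding star_base_def by blast
  have "tensor_space (P1 \<inter> P1') (P2 \<inter> P2') \<subseteq> E \<inter> E'"
    using P(3) P'(3) tensor_space_mono[of "P1 \<inter> P1'" P1 "P2 \<inter> P2'" P2]
      tensor_space_mono[of "P1 \<inter> P1'" P1' "P2 \<inter> P2'" P2'] by blast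
  moreover have "P1 \<inter> P1' \<in> open_subspaces T1" "P2 \<inter> P2' \<in> open_subspaces T2"
    using P P' open_subspaces_Int by blast+
  moreover have "\<exists>Q\<in>open_subspaces T2. \<forall>y\<in>Q. w \<otimes> y \<in> E \<inter> E'" if "w \<in> topspace T1" for w
    using w(1,2)[OF that] open_subspaces_Int[of _ T2] by (meson IntD1 IntD2 IntI)
  moreover have "\<exists>Q\<in>open_subspaces T1. \<forall>x\<in>Q. x \<otimes> w \<in> E \<inter> E'" if "w \<in> topspace T2" for w
    using w(3,4)[OF that] open_subspaces_Int[of _ T1] by (meson IntD1 IntD2 IntI)
  ultimately show ?thesis
    using s csubspace_inter[OF s(1,2)] unfolding star_base_def by blast
qed

lemma tensor_space_in_shriek_base:
  "tensor_space (topspace T1) (topspace T2) \<in> shriek_base T1 T2"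
  unfolding shriek_base_def
  using subspace_tensor_space topspace_open_subspace[OF T1] topspace_open_subspace[OF T2] by blast

lemma shriek_base_subset_star_base: "shriek_base T1 T2 \<subseteq> star_base T1 T2"
proof
  fix E assume "E \<in> shriek_base T1 T2"
  then obtain P1 P2 where E: "csubspace E" "E \<subseteq> tensor_space (topspace T1) (topspace T2)"
    and P: "P1 \<in> open_subspaces T1" "P2 \<in> open_subspaces T2"
      "tensor_space P1 (topspace T2) \<subseteq> E" "tensor_space (topspace T1) P2 \<subseteq> E"
    unfolding shriek_base_def by blast
  have "tensor_space P1 P2 \<subseteq> E"
    using P(4) tensor_space_mono[OF open_subspaces_subset[OF P(1)] subset_refl[of P2]] by blast
  moreover have "w \<otimes> y \<in> E" if "w \<in> topspace T1" "y \<in> P2" for w y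
    using P(4) pure2_in_tensor_space[OF that] by blast
  moreover have "x \<otimes> w \<in> E" if "w \<in> topspace T2" "x \<in> P1" for w x
    using P(3) pure2_in_tensor_space[OF that(2,1)] by blast
  ultimately show "E \<in> star_base T1 T2"
    using E P(1,2) unfolding star_base_def by blast
qed

lemma zero_base_star: "zero_base (tensor_space (topspace T1) (topspace T2)) (star_base T1 T2)"
  unfolding zero_base_def
proof (intro conjI ballI)
  show "star_base T1 T2 \<noteq> {}"
    using tensor_space_in_shriek_base shriek_base_subset_star_base by blast
  show "\<exists>E''\<in>star_base T1 T2. E'' \<subseteq> E \<inter> E'" if "E \<in> star_base T1 T2" "E' \<in> star_base T1 T2" for E E'
    using star_base_Int[OF that] by blast
qed (auto simp: subspace_tensor_space star_base_def)

lemma shriek_base_Int: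
  assumes E: "E \<in> shriek_base T1 T2" and E': "E' \<in> shriek_base T1 T2"
  shows "E \<inter> E' \<in> shriek_base T1 T2"
proof -
  obtain P1 P2 where s: "csubspace E" "E \<subseteq> tensor_space (topspace T1) (topspace T2)"
    and P: "P1 \<in> open_subspaces T1" "P2 \<in> open_subspaces T2"
      "tensor_space P1 (topspace T2) \<subseteq> E" "tensor_space (topspace T1) P2 \<subseteq> E"
    using E unfolding shriek_base_def by blast
  obtain P1' P2' where s': "csubspace E'"
    and P': "P1' \<in> open_subspaces T1" "P2' \<in> open_subspaces T2"
      "tensor_space P1' (topspace T2) \<subseteq> E'" "tensor_space (topspace T1) P2' \<subseteq> E'"
    using E' unfolding shriek_base_def by blast
  have "tensor_space (P1 \<inter> P1') (topspace T2) \<subseteq> E \<inter> E'"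
    using P(3) P'(3) tensor_space_mono[of "P1 \<inter> P1'" P1 "topspace T2" "topspace T2"]
      tensor_space_mono[of "P1 \<inter> P1'" P1' "topspace T2" "topspace T2"] by blast
  moreover have "tensor_space (topspace T1) (P2 \<inter> P2') \<subseteq> E \<inter> E'"
    using P(4) P'(4) tensor_space_mono[of "topspace T1" "topspace T1" "P2 \<inter> P2'" P2]
      tensor_space_mono[of "topspace T1" "topspace T1" "P2 \<inter> P2'" P2'] by blast
  moreover have "P1 \<inter> P1' \<in> open_subspaces T1" "P2 \<inter> P2' \<in> open_subspaces T2"
    using P P' open_subspaces_Int by blast+
  ultimately show ?thesis
    using s s' csubspace_inter[OF s(1) s'] unfolding shriek_base_def by blast
qed

lemma zero_base_shriek: "zero_base (tensor_space (topspace T1) (topspace T2)) (shriek_base T1 T2)"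
  unfolding zero_base_def
proof (intro conjI ballI)
  show "shriek_base T1 T2 \<noteq> {}" using tensor_space_in_shriek_base by blast
  show "\<exists>E''\<in>shriek_base T1 T2. E'' \<subseteq> E \<inter> E'"
    if "E \<in> shriek_base T1 T2" "E' \<in> shriek_base T1 T2" for E E'
    using shriek_base_Int[OF that] by blast
qed (auto simp: subspace_tensor_space shriek_base_def)

lemma is_linear_star: "is_linear_topology (star_tensor T1 T2)"
  unfolding star_tensor_base by (rule is_linear_topology_zero_base[OF zero_base_star])

lemma topspace_star: "topspace (star_tensor T1 T2) = tensor_space (topspace T1) (topspace T2)"
  unfolding star_tensor_base by (rule topspace_zero_base[OF zero_base_star])

lemma is_linear_shriek: "is_linear_topology (shriek_tensor T1 T2)"
  unfolding shriek_tensor_base by (rule is_linear_topology_zero_base[OF zero_base_shriek])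

lemma topspace_shriek: "topspace (shriek_tensor T1 T2) = tensor_space (topspace T1) (topspace T2)"
  unfolding shriek_tensor_base by (rule topspace_zero_base[OF zero_base_shriek])

end

text \<open>The next two lemmas are the continuity of a tensor product of continuous linear maps.\<close>

lemma star_base_vimage:
  assumes "\<And>P. P \<in> open_subspaces T1' \<Longrightarrow> {x \<in> topspace T1. \<phi>1 x \<in> P} \<in> open_subspaces T1"
    and "\<And>P. P \<in> open_subspaces T2' \<Longrightarrow> {x \<in> topspace T2. \<phi>2 x \<in> P} \<in> open_subspaces T2"
    and in1: "\<And>x. x \<in> topspace T1 \<Longrightarrow> \<phi>1 x \<in> topspace T1'"
    and in2: "\<And>x. x \<in> topspace T2 \<Longrightarrow> \<phi>2 x \<in> topspace T2'"
    and L: "clinear \<Theta>"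
    and \<Theta>: "\<And>x y. x \<in> topspace T1 \<Longrightarrow> y \<in> topspace T2 \<Longrightarrow> \<Theta> (x \<otimes> y) = \<phi>1 x \<otimes> \<phi>2 y"
    and E: "E \<in> star_base T1' T2'"
  shows "{t \<in> tensor_space (topspace T1) (topspace T2). \<Theta> t \<in> E} \<in> star_base T1 T2"
proof -
  let ?W = "tensor_space (topspace T1) (topspace T2)" and ?E = "{t \<in> tensor_space (topspace T1) (topspace T2). \<Theta> t \<in> E}"
  have sE: "csubspace E" using E by (simp add: star_base_def)
  have s: "csubspace ?E"
    by (rule subspace_vimage_Int[OF clinear_imp_linear_on[OF L] subspace_tensor_space sE])
  have mem: "x \<otimes> y \<in> ?E" if "x \<in> topspace T1" "y \<in> topspace T2" "\<phi>1 x \<otimes> \<phi>2 y \<in> E" for x y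
    using that pure2_in_tensor_space[OF that(1,2)] \<Theta>[OF that(1,2)] by simp
  obtain P1 P2 where P: "P1 \<in> open_subspaces T1'" "P2 \<in> open_subspaces T2'" "tensor_space P1 P2 \<subseteq> E"
    using E unfolding star_base_def by blast
  have "tensor_space {x \<in> topspace T1. \<phi>1 x \<in> P1} {x \<in> topspace T2. \<phi>2 x \<in> P2} \<subseteq> ?E"
    unfolding tensor_space_subset_iff[OF s]
  proof (intro ballI mem)
    fix a b assume "a \<in> {x \<in> topspace T1. \<phi>1 x \<in> P1}" "b \<in> {x \<in> topspace T2. \<phi>2 x \<in> P2}"
    then show "a \<in> topspace T1" "b \<in> topspace T2" "\<phi>1 a \<otimes> \<phi>2 b \<in> E"
      using P(3) pure2_in_tensor_space[of "\<phi>1 a" P1 "\<phi>2 b" P2] by auto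
  qed
  moreover have "\<exists>Q\<in>open_subspaces T2. \<forall>y\<in>Q. w \<otimes> y \<in> ?E" if w: "w \<in> topspace T1" for w
  proof -
    obtain Q where Q: "Q \<in> open_subspaces T2'" "\<forall>y\<in>Q. \<phi>1 w \<otimes> y \<in> E"
      using E in1[OF w] unfolding star_base_def by blast
    show ?thesis by (rule bexI[OF _ assms(2)[OF Q(1)]]) (use mem[OF w] Q(2) in auto)
  qed
  moreover have "\<exists>Q\<in>open_subspaces T1. \<forall>x\<in>Q. x \<otimes> w \<in> ?E" if w: "w \<in> topspace T2" for w
  proof -
    obtain Q where Q: "Q \<in> open_subspaces T1'" "\<forall>x\<in>Q. x \<otimes> \<phi>2 w \<in> E"
      using E in2[OF w] unfolding star_base_def by blast
    show ?thesis by (rule bexI[OF _ assms(1)[OF Q(1)]]) (use mem[OF _ w] Q(2) in auto)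
  qed
  moreover have "\<exists>P1\<in>open_subspaces T1. \<exists>P2\<in>open_subspaces T2. tensor_space P1 P2 \<subseteq> ?E"
    using calculation(1) assms(1)[OF P(1)] assms(2)[OF P(2)] by blast
  ultimately show ?thesis using s unfolding star_base_def by simp
qed

lemma shriek_base_vimage:
  assumes "\<And>P. P \<in> open_subspaces T1' \<Longrightarrow> {x \<in> topspace T1. \<phi>1 x \<in> P} \<in> open_subspaces T1"
    and "\<And>P. P \<in> open_subspaces T2' \<Longrightarrow> {x \<in> topspace T2. \<phi>2 x \<in> P} \<in> open_subspaces T2"
    and in1: "\<And>x. x \<in> topspace T1 \<Longrightarrow> \<phi>1 x \<in> topspace T1'"
    and in2: "\<And>x. x \<in> topspace T2 \<Longrightarrow> \<phi>2 x \<in> topspace T2'"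
    and L: "clinear \<Theta>"
    and \<Theta>: "\<And>x y. x \<in> topspace T1 \<Longrightarrow> y \<in> topspace T2 \<Longrightarrow> \<Theta> (x \<otimes> y) = \<phi>1 x \<otimes> \<phi>2 y"
    and E: "E \<in> shriek_base T1' T2'"
  shows "{t \<in> tensor_space (topspace T1) (topspace T2). \<Theta> t \<in> E} \<in> shriek_base T1 T2"
proof -
  let ?W = "tensor_space (topspace T1) (topspace T2)" and ?E = "{t \<in> tensor_space (topspace T1) (topspace T2). \<Theta> t \<in> E}"
  have sE: "csubspace E" using E by (simp add: shriek_base_def)
  have s: "csubspace ?E"
    by (rule subspace_vimage_Int[OF clinear_imp_linear_on[OF L] subspace_tensor_space sE])
  have mem: "x \<otimes> y \<in> ?E" if "x \<in> topspace T1" "y \<in> topspace T2" "\<phi>1 x \<otimes> \<phi>2 y \<in> E" for x y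
    using that pure2_in_tensor_space[OF that(1,2)] \<Theta>[OF that(1,2)] by simp
  obtain P1 P2 where P: "P1 \<in> open_subspaces T1'" "P2 \<in> open_subspaces T2'"
      "tensor_space P1 (topspace T2') \<subseteq> E" "tensor_space (topspace T1') P2 \<subseteq> E"
    using E unfolding shriek_base_def by blast
  have "tensor_space {x \<in> topspace T1. \<phi>1 x \<in> P1} (topspace T2) \<subseteq> ?E"
    unfolding tensor_space_subset_iff[OF s]
  proof (intro ballI mem)
    fix a b assume "a \<in> {x \<in> topspace T1. \<phi>1 x \<in> P1}" "b \<in> topspace T2"
    then show "a \<in> topspace T1" "b \<in> topspace T2" "\<phi>1 a \<otimes> \<phi>2 b \<in> E"
      using P(3) pure2_in_tensor_space[of "\<phi>1 a" P1 "\<phi>2 b" "topspace T2'"] in2[of b] by auto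
  qed
  moreover have "tensor_space (topspace T1) {x \<in> topspace T2. \<phi>2 x \<in> P2} \<subseteq> ?E"
    unfolding tensor_space_subset_iff[OF s]
  proof (intro ballI mem)
    fix a b assume "a \<in> topspace T1" "b \<in> {x \<in> topspace T2. \<phi>2 x \<in> P2}"
    then show "a \<in> topspace T1" "b \<in> topspace T2" "\<phi>1 a \<otimes> \<phi>2 b \<in> E"
      using P(4) pure2_in_tensor_space[of "\<phi>1 a" "topspace T1'" "\<phi>2 b" P2] in1[of a] by auto
  qed
  ultimately have "\<exists>P1\<in>open_subspaces T1. \<exists>P2\<in>open_subspaces T2.
      tensor_space P1 (topspace T2) \<subseteq> ?E \<and> tensor_space (topspace T1) P2 \<subseteq> ?E"
    using assms(1)[OF P(1)] assms(2)[OF P(2)] by blast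
  then show ?thesis using s unfolding shriek_base_def by simp
qed

text \<open>Functoriality. The maps given on the subspaces are extended linearly to the ambient types, where the
  universal property provides their tensor product; the tensor product of the inverses is inverse to
  it on the subspaces.\<close>

lemma tensor_iso:
  assumes T1: "is_linear_topology T1" and T2: "is_linear_topology T2"
    and T1': "is_linear_topology T1'" and T2': "is_linear_topology T2'"
    and \<phi>1: "tvs_iso T1 T1' \<phi>1" and \<phi>2: "tvs_iso T2 T2' \<phi>2"
  obtains \<Theta> where "tvs_iso (star_tensor T1 T2) (star_tensor T1' T2') \<Theta>"
    "tvs_iso (shriek_tensor T1 T2) (shriek_tensor T1' T2') \<Theta>"
    "\<And>x y. x \<in> topspace T1 \<Longrightarrow> y \<in> topspace T2 \<Longrightarrow> \<Theta> (x \<otimes> y) = \<phi>1 x \<otimes> \<phi>2 y"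
proof -
  have map: "\<exists>\<Theta>. clinear \<Theta> \<and>
      (\<forall>x y. x \<in> topspace S1 \<longrightarrow> y \<in> topspace S2 \<longrightarrow> \<Theta> (x \<otimes> y) = \<psi>1 x \<otimes> \<psi>2 y)"
    if S1: "is_linear_topology S1" and S2: "is_linear_topology S2"
      and \<psi>1: "tvs_iso S1 S1' \<psi>1" and \<psi>2: "tvs_iso S2 S2' \<psi>2"
    for S1 :: "'x::complex_vector topology" and S2 :: "'y::complex_vector topology"
      and S1' :: "'z::complex_vector topology" and S2' :: "'w::complex_vector topology" and \<psi>1 \<psi>2
  proof -
    obtain g1 where g1: "clinear g1" "\<And>x. x \<in> topspace S1 \<Longrightarrow> g1 x = \<psi>1 x"
      using linear_on_extend[OF tvs_iso_linear[OF \<psi>1] subspace_topspace[OF S1]] by blast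
    obtain g2 where g2: "clinear g2" "\<And>x. x \<in> topspace S2 \<Longrightarrow> g2 x = \<psi>2 x"
      using linear_on_extend[OF tvs_iso_linear[OF \<psi>2] subspace_topspace[OF S2]] by blast
    obtain L where "clinear L" "\<And>x y. L (x \<otimes> y) = g1 x \<otimes> g2 y"
    proof (rule tensor_universal)
      show "clinear (\<lambda>x. g1 x \<otimes> g2 y)" for y
        by (rule clinear_compose[OF g1(1) clinear_pure2_left])
      show "clinear (\<lambda>y. g1 x \<otimes> g2 y)" for x
        by (rule clinear_compose[OF g2(1) clinear_pure2_right])
    qed (use that in blast)
    then show ?thesis using g1(2) g2(2) by auto
  qed
  obtain \<psi>1 where \<psi>1: "tvs_iso T1' T1 \<psi>1" "\<And>x. x \<in> topspace T1 \<Longrightarrow> \<psi>1 (\<phi>1 x) = x"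
    "\<And>y. y \<in> topspace T1' \<Longrightarrow> \<phi>1 (\<psi>1 y) = y"
    using tvs_iso_inverse[OF \<phi>1 T1] by blast
  obtain \<psi>2 where \<psi>2: "tvs_iso T2' T2 \<psi>2" "\<And>x. x \<in> topspace T2 \<Longrightarrow> \<psi>2 (\<phi>2 x) = x"
    "\<And>y. y \<in> topspace T2' \<Longrightarrow> \<phi>2 (\<psi>2 y) = y"
    using tvs_iso_inverse[OF \<phi>2 T2] by blast
  obtain \<Theta> where \<Theta>: "clinear \<Theta>"
      "\<And>x y. x \<in> topspace T1 \<Longrightarrow> y \<in> topspace T2 \<Longrightarrow> \<Theta> (x \<otimes> y) = \<phi>1 x \<otimes> \<phi>2 y"
    using map[OF T1 T2 \<phi>1 \<phi>2] by blast
  obtain \<Psi> where \<Psi>: "clinear \<Psi>"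
      "\<And>x y. x \<in> topspace T1' \<Longrightarrow> y \<in> topspace T2' \<Longrightarrow> \<Psi> (x \<otimes> y) = \<psi>1 x \<otimes> \<psi>2 y"
    using map[OF T1' T2' \<psi>1(1) \<psi>2(1)] by blast
  let ?W = "tensor_space (topspace T1) (topspace T2)"
  let ?W' = "tensor_space (topspace T1') (topspace T2')"
  have in\<Theta>: "\<Theta> t \<in> ?W'" if "t \<in> ?W" for t
  proof (rule clinear_tensor_space[OF \<Theta>(1) subspace_tensor_space _ that])
    fix a b assume "a \<in> topspace T1" "b \<in> topspace T2"
    then show "\<Theta> (a \<otimes> b) \<in> ?W'"
      using \<Theta>(2) pure2_in_tensor_space tvs_iso_in[OF \<phi>1] tvs_iso_in[OF \<phi>2] by metis
  qed
  have in\<Psi>: "\<Psi> t \<in> ?W" if "t \<in> ?W'" for t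
  proof (rule clinear_tensor_space[OF \<Psi>(1) subspace_tensor_space _ that])
    fix a b assume "a \<in> topspace T1'" "b \<in> topspace T2'"
    then show "\<Psi> (a \<otimes> b) \<in> ?W"
      using \<Psi>(2) pure2_in_tensor_space tvs_iso_in[OF \<psi>1(1)] tvs_iso_in[OF \<psi>2(1)] by metis
  qed
  have \<Psi>\<Theta>: "\<Psi> (\<Theta> t) = t" if "t \<in> ?W" for t
  proof (rule clinear_eq_on_tensor_space[OF clinear_compose[OF \<Theta>(1) \<Psi>(1)] _ _ that])
    show "clinear (\<lambda>x::('a, 'b) tensor. x)" by (rule clinearI) auto
    show "\<Psi> (\<Theta> (a \<otimes> b)) = a \<otimes> b" if "a \<in> topspace T1" "b \<in> topspace T2" for a b
      using that by (simp add: \<Theta>(2) \<Psi>(2) \<psi>1(2) \<psi>2(2) tvs_iso_in[OF \<phi>1] tvs_iso_in[OF \<phi>2])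
  qed
  have \<Theta>\<Psi>: "\<Theta> (\<Psi> t) = t" if "t \<in> ?W'" for t
  proof (rule clinear_eq_on_tensor_space[OF clinear_compose[OF \<Psi>(1) \<Theta>(1)] _ _ that])
    show "clinear (\<lambda>x::('c, 'd) tensor. x)" by (rule clinearI) auto
    show "\<Theta> (\<Psi> (a \<otimes> b)) = a \<otimes> b" if "a \<in> topspace T1'" "b \<in> topspace T2'" for a b
      using that by (simp add: \<Theta>(2) \<Psi>(2) \<psi>1(3) \<psi>2(3) tvs_iso_in[OF \<psi>1(1)] tvs_iso_in[OF \<psi>2(1)])
  qed
  have bij: "bij_betw \<Theta> ?W ?W'"
    by (rule bij_betw_byWitness[of _ \<Psi>]) (use in\<Theta> in\<Psi> \<Psi>\<Theta> \<Theta>\<Psi> in auto)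
  have return_sub: "{t \<in> ?W. \<Theta> t \<in> {s \<in> ?W'. \<Psi> s \<in> E}} \<subseteq> E" for E using \<Psi>\<Theta> by auto
  have "tvs_iso (star_tensor T1 T2) (star_tensor T1' T2') \<Theta>"
    unfolding star_tensor_base
  proof (rule tvs_iso_zero_baseI[OF zero_base_star[OF T1 T2] zero_base_star[OF T1' T2']
        clinear_imp_linear_on[OF \<Theta>(1)] bij])
    show "\<exists>E\<in>star_base T1 T2. \<Theta> ` E \<subseteq> E'" if "E' \<in> star_base T1' T2'" for E'
      using star_base_vimage[OF tvs_iso_vimage[OF \<phi>1 T1] tvs_iso_vimage[OF \<phi>2 T2]
          tvs_iso_in[OF \<phi>1] tvs_iso_in[OF \<phi>2] \<Theta> that]
      by (rule bexI[rotated]) auto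
    show "\<exists>E'\<in>star_base T1' T2'. {x \<in> ?W. \<Theta> x \<in> E'} \<subseteq> E" if "E \<in> star_base T1 T2" for E
      using star_base_vimage[OF tvs_iso_vimage[OF \<psi>1(1) T1'] tvs_iso_vimage[OF \<psi>2(1) T2']
          tvs_iso_in[OF \<psi>1(1)] tvs_iso_in[OF \<psi>2(1)] \<Psi> that] return_sub[of E]
      by (rule bexI[rotated])
  qed
  moreover have "tvs_iso (shriek_tensor T1 T2) (shriek_tensor T1' T2') \<Theta>"
    unfolding shriek_tensor_base
  proof (rule tvs_iso_zero_baseI[OF zero_base_shriek[OF T1 T2] zero_base_shriek[OF T1' T2']
        clinear_imp_linear_on[OF \<Theta>(1)] bij])
    show "\<exists>E\<in>shriek_base T1 T2. \<Theta> ` E \<subseteq> E'" if "E' \<in> shriek_base T1' T2'" for E'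
      using shriek_base_vimage[OF tvs_iso_vimage[OF \<phi>1 T1] tvs_iso_vimage[OF \<phi>2 T2]
          tvs_iso_in[OF \<phi>1] tvs_iso_in[OF \<phi>2] \<Theta> that]
      by (rule bexI[rotated]) auto
    show "\<exists>E'\<in>shriek_base T1' T2'. {x \<in> ?W. \<Theta> x \<in> E'} \<subseteq> E" if "E \<in> shriek_base T1 T2" for E
      using shriek_base_vimage[OF tvs_iso_vimage[OF \<psi>1(1) T1'] tvs_iso_vimage[OF \<psi>2(1) T2']
          tvs_iso_in[OF \<psi>1(1)] tvs_iso_in[OF \<psi>2(1)] \<Psi> that] return_sub[of E]
      by (rule bexI[rotated])
  qed
  ultimately show ?thesis using that \<Theta>(2) by blast
qed

section \<open>Spaces on which the two tensor products agree\<close>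

text \<open>With \<open>0\<close> open in both factors, every subspace is open for both topologies.\<close>

lemma star_eq_shriek_discrete:
  assumes "is_linear_topology T1" "is_linear_topology T2"
    and "{0} \<in> open_subspaces T1" "{0} \<in> open_subspaces T2"
  shows "star_tensor T1 T2 = shriek_tensor T1 T2"
proof -
  have "star_base T1 T2 \<subseteq> shriek_base T1 T2"
  proof
    fix E assume "E \<in> star_base T1 T2"
    then have E: "csubspace E" "E \<subseteq> tensor_space (topspace T1) (topspace T2)"
      by (auto simp: star_base_def)
    have "tensor_space {0} (topspace T2) \<subseteq> E" "tensor_space (topspace T1) {0} \<subseteq> E"
      unfolding tensor_space_subset_iff[OF E(1)]
      by (simp_all add: clinear_0[OF clinear_pure2_left] clinear_0[OF clinear_pure2_right]
          csubspace_0[OF E(1)])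
    then show "E \<in> shriek_base T1 T2" using E assms(3,4) unfolding shriek_base_def by blast
  qed
  then show ?thesis
    using shriek_base_subset_star_base[OF assms(1,2)] unfolding star_tensor_base shriek_tensor_base
    by simp
qed

text \<open>Open subspaces have finite codimension. For complete Hausdorff spaces this is linear compactness.\<close>

definition cofinite_topology :: "'a::complex_vector topology \<Rightarrow> bool" where
  "cofinite_topology T \<longleftrightarrow> (\<forall>E\<in>open_subspaces T. \<exists>S\<subseteq>topspace T. finite S \<and>
     (\<forall>x\<in>topspace T. \<exists>y\<in>cspan S. x - y \<in> E))"

lemma open_subspace_finite_Inter:
  assumes "finite S" "is_linear_topology T"
    and "\<And>s. s \<in> S \<Longrightarrow> \<exists>Q\<in>open_subspaces T. \<forall>x\<in>Q. R s x"
  shows "\<exists>Q\<in>open_subspaces T. \<forall>x\<in>Q. \<forall>s\<in>S. R s x"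
  using assms(1,3)
proof (induction S rule: finite_induct)
  case empty
  then show ?case using topspace_open_subspace[OF assms(2)] by blast
next
  case (insert s S)
  obtain Q where Q: "Q \<in> open_subspaces T" "\<forall>x\<in>Q. \<forall>s\<in>S. R s x"
    using insert.IH insert.prems by blast
  obtain Q' where Q': "Q' \<in> open_subspaces T" "\<forall>x\<in>Q'. R s x" using insert.prems by blast
  show ?case by (rule bexI[OF _ open_subspaces_Int[OF Q(1) Q'(1)]]) (use Q(2) Q'(2) in auto)
qed

text \<open>Let \<open>P\<^sub>1 \<otimes> P\<^sub>2\<close> lie in \<open>E\<close>. The second factor is the sum of \<open>P\<^sub>2\<close> and the span of a finite set \<open>S\<^sub>2\<close>. For
  each \<open>s\<close> in \<open>S\<^sub>2\<close> some open subspace \<open>Q\<close> has \<open>Q \<otimes> s\<close> inside \<open>E\<close>. The intersection of \<open>P\<^sub>1\<close> with these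
  finitely many subspaces therefore gives, tensored with the whole second factor, a subspace of
  \<open>E\<close>; likewise with the factors exchanged.\<close>

lemma star_eq_shriek_cofinite:
  assumes T1: "is_linear_topology T1" and T2: "is_linear_topology T2"
    and c1: "cofinite_topology T1" and c2: "cofinite_topology T2"
  shows "star_tensor T1 T2 = shriek_tensor T1 T2"
proof -
  have "star_base T1 T2 \<subseteq> shriek_base T1 T2"
  proof
    fix E assume "E \<in> star_base T1 T2"
    then obtain P1 P2 where E: "csubspace E" "E \<subseteq> tensor_space (topspace T1) (topspace T2)"
      and P: "P1 \<in> open_subspaces T1" "P2 \<in> open_subspaces T2" "tensor_space P1 P2 \<subseteq> E"
      and w: "\<forall>w1\<in>topspace T1. \<exists>Q\<in>open_subspaces T2. \<forall>y\<in>Q. w1 \<otimes> y \<in> E"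
        "\<forall>w2\<in>topspace T2. \<exists>Q\<in>open_subspaces T1. \<forall>x\<in>Q. x \<otimes> w2 \<in> E"
      unfolding star_base_def by blast
    have PE: "x \<otimes> y \<in> E" if "x \<in> P1" "y \<in> P2" for x y
      using P(3) pure2_in_tensor_space[OF that] by blast
    obtain S1 where S1: "S1 \<subseteq> topspace T1" "finite S1"
        "\<forall>x\<in>topspace T1. \<exists>y\<in>cspan S1. x - y \<in> P1"
      using c1 P(1) unfolding cofinite_topology_def by blast
    obtain S2 where S2: "S2 \<subseteq> topspace T2" "finite S2"
        "\<forall>x\<in>topspace T2. \<exists>y\<in>cspan S2. x - y \<in> P2"
      using c2 P(2) unfolding cofinite_topology_def by blast
    obtain Q1 where Q1: "Q1 \<in> open_subspaces T1" "\<forall>x\<in>Q1. \<forall>s\<in>S2. x \<otimes> s \<in> E"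
      using open_subspace_finite_Inter[OF S2(2) T1, of "\<lambda>s x. x \<otimes> s \<in> E"] w(2) S2(1) by blast
    obtain Q2 where Q2: "Q2 \<in> open_subspaces T2" "\<forall>y\<in>Q2. \<forall>s\<in>S1. s \<otimes> y \<in> E"
      using open_subspace_finite_Inter[OF S1(2) T2, of "\<lambda>s x. s \<otimes> x \<in> E"] w(1) S1(1) by blast
    have "tensor_space (P1 \<inter> Q1) (topspace T2) \<subseteq> E"
      unfolding tensor_space_subset_iff[OF E(1)]
    proof (intro ballI)
      fix x z assume x: "x \<in> P1 \<inter> Q1" and z: "z \<in> topspace T2"
      obtain y where y: "y \<in> cspan S2" "z - y \<in> P2" using S2(3) z by blast
      have "cspan S2 \<subseteq> {y. x \<otimes> y \<in> E}"
        using Q1(2) x subspace_vimage[OF clinear_pure2_right E(1)]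
        by (intro cspan_minimal) auto
      then have "x \<otimes> y \<in> E" using y(1) by blast
      moreover have "x \<otimes> (z - y) \<in> E" using PE x y(2) by blast
      ultimately have "x \<otimes> y + x \<otimes> (z - y) \<in> E" by (rule csubspace_add[OF E(1)])
      then show "x \<otimes> z \<in> E" by (simp add: pure2_add_right[symmetric])
    qed
    moreover have "tensor_space (topspace T1) (P2 \<inter> Q2) \<subseteq> E"
      unfolding tensor_space_subset_iff[OF E(1)]
    proof (intro ballI)
      fix z x assume x: "x \<in> P2 \<inter> Q2" and z: "z \<in> topspace T1"
      obtain y where y: "y \<in> cspan S1" "z - y \<in> P1" using S1(3) z by blast
      have "cspan S1 \<subseteq> {y. y \<otimes> x \<in> E}"
        using Q2(2) x subspace_vimage[OF clinear_pure2_left E(1)]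
        by (intro cspan_minimal) auto
      then have "y \<otimes> x \<in> E" using y(1) by blast
      moreover have "(z - y) \<otimes> x \<in> E" using PE x y(2) by blast
      ultimately have "y \<otimes> x + (z - y) \<otimes> x \<in> E" by (rule csubspace_add[OF E(1)])
      then show "z \<otimes> x \<in> E" by (simp add: pure2_add_left[symmetric])
    qed
    ultimately show "E \<in> shriek_base T1 T2"
      using E open_subspaces_Int[OF P(1) Q1(1)] open_subspaces_Int[OF P(2) Q2(1)]
      unfolding shriek_base_def by blast
  qed
  then show ?thesis
    using shriek_base_subset_star_base[OF assms(1,2)] unfolding star_tensor_base shriek_tensor_base
    by simp
qed

lemma zero_open_iso:
  assumes \<phi>: "tvs_iso T T' \<phi>" and T: "is_linear_topology T" and z: "{0} \<in> open_subspaces T'"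
  shows "{0} \<in> open_subspaces T"
proof -
  have "0 \<in> topspace T" using csubspace_0[OF subspace_topspace[OF T]] .
  moreover have "\<phi> 0 = 0" using linear_on_0[OF tvs_iso_linear[OF \<phi>] subspace_topspace[OF T]] .
  moreover have "inj_on \<phi> (topspace T)" using tvs_iso_bij[OF \<phi>] by (simp add: bij_betw_def)
  ultimately have "{x \<in> topspace T. \<phi> x \<in> {0}} = {0}" unfolding inj_on_def by auto
  then show ?thesis using tvs_iso_vimage[OF \<phi> T z] by simp
qed

lemma cofinite_topology_iso:
  assumes \<phi>: "tvs_iso T T' \<phi>" and T: "is_linear_topology T" and T': "is_linear_topology T'"
    and c: "cofinite_topology T'"
  shows "cofinite_topology T"
  unfolding cofinite_topology_def
proof
  obtain \<psi> where \<psi>: "tvs_iso T' T \<psi>" "\<And>x. x \<in> topspace T \<Longrightarrow> \<psi> (\<phi> x) = x"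
    "\<And>y. y \<in> topspace T' \<Longrightarrow> \<phi> (\<psi> y) = y"
    using tvs_iso_inverse[OF \<phi> T] by blast
  obtain g where g: "clinear g" "\<And>y. y \<in> topspace T' \<Longrightarrow> g y = \<psi> y"
    using linear_on_extend[OF tvs_iso_linear[OF \<psi>(1)] subspace_topspace[OF T']] by blast
  fix E assume "E \<in> open_subspaces T"
  then obtain S where S: "S \<subseteq> topspace T'" "finite S"
      "\<forall>x\<in>topspace T'. \<exists>y\<in>cspan S. x - y \<in> {y \<in> topspace T'. \<psi> y \<in> E}"
    using c tvs_iso_vimage[OF \<psi>(1) T'] unfolding cofinite_topology_def by meson
  have "\<exists>y\<in>cspan (g ` S). x - y \<in> E" if x: "x \<in> topspace T" for x
  proof -
    obtain y where y: "y \<in> cspan S" "\<phi> x - y \<in> topspace T'" "\<psi> (\<phi> x - y) \<in> E"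
      using S(3) tvs_iso_in[OF \<phi> x] by blast
    have "g (\<phi> x - y) = x - g y"
      using g(2)[OF tvs_iso_in[OF \<phi> x]] \<psi>(2)[OF x] by (simp add: clinear_diff[OF g(1)])
    then have "x - g y \<in> E" using y(2,3) g(2) by simp
    moreover have "g y \<in> cspan (g ` S)"
      using complex_vector_pair.linear_span_image[OF g(1), of S] y(1) by simp
    ultimately show ?thesis by blast
  qed
  moreover have "g ` S \<subseteq> topspace T" using S(1) g(2) tvs_iso_in[OF \<psi>(1)] by auto
  ultimately show "\<exists>S\<subseteq>topspace T. finite S \<and>
      (\<forall>x\<in>topspace T. \<exists>y\<in>cspan S. x - y \<in> E)"
    using S(2) by blast
qed

section \<open>Column-finite matrices\<close>

type_synonym matrix = "nat list \<times> nat list \<Rightarrow> complex"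

text \<open>Matrices of linear maps from \<open>V\<^sup>\<otimes>\<^sup>q\<close> to \<open>V\<^sup>\<otimes>\<^sup>p\<close>, with respect to the bases indexed by lists. For \<open>q = 0\<close>
  there is a single column, and the space is discrete; for \<open>p = 0\<close> there is a single row, whose
  entries are arbitrary.\<close>

definition colfin :: "nat \<Rightarrow> nat \<Rightarrow> matrix set" where
  "colfin p q = {m. (\<forall>a b. m (a, b) \<noteq> 0 \<longrightarrow> length a = p \<and> length b = q) \<and>
                    (\<forall>b. finite {a. m (a, b) \<noteq> 0})}"

definition colfin_kernel :: "nat \<Rightarrow> nat \<Rightarrow> nat list set \<Rightarrow> matrix set" where
  "colfin_kernel p q F = {m \<in> colfin p q. \<forall>a. \<forall>b\<in>F. m (a, b) = 0}"

definition colfin_base :: "nat \<Rightarrow> nat \<Rightarrow> matrix set set" where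
  "colfin_base p q = colfin_kernel p q ` {F. finite F \<and> F \<subseteq> {b. length b = q}}"

definition colfin_topology :: "nat \<Rightarrow> nat \<Rightarrow> matrix topology" where
  "colfin_topology p q = linear_topology (colfin p q) (colfin_base p q)"

definition unit_matrix :: "nat list \<Rightarrow> nat list \<Rightarrow> matrix" where
  "unit_matrix a b = (\<lambda>x. if x = (a, b) then 1 else 0)"

lemma scaleC_fun_apply [simp]: "(c *\<^sub>C f) x = c *\<^sub>C f x"
  by (simp add: scaleC_fun_def)

lemma scaleC_complex [simp]: "c *\<^sub>C (z :: complex) = c * z"
  by (simp add: scaleC_complex_def)

lemma sum_fun_apply: "(\<Sum>i\<in>I. f i) x = (\<Sum>i\<in>I. f i x)" for f :: "'i \<Rightarrow> 'x \<Rightarrow> 'y::comm_monoid_add"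
  by (induction I rule: infinite_finite_induct) auto

lemma colfin_length: "m \<in> colfin p q \<Longrightarrow> m (a, b) \<noteq> 0 \<Longrightarrow> length a = p \<and> length b = q"
  by (simp add: colfin_def)

lemma colfin_finite: "m \<in> colfin p q \<Longrightarrow> finite {a. m (a, b) \<noteq> 0}"
  by (simp add: colfin_def)

lemma subspace_colfin: "csubspace (colfin p q)"
  unfolding csubspace_def
proof (intro conjI ballI allI)
  show "0 \<in> colfin p q" by (simp add: colfin_def)
  fix m n assume m: "m \<in> colfin p q" and n: "n \<in> colfin p q"
  have "finite {a. (m + n) (a, b) \<noteq> 0}" for b
    by (rule finite_subset[OF _ finite_UnI[OF colfin_finite[OF m, of b] colfin_finite[OF n, of b]]]) auto
  moreover have "length a = p \<and> length b = q" if "(m + n) (a, b) \<noteq> 0" for a b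
    using that colfin_length[OF m, of a b] colfin_length[OF n, of a b] by (cases "m (a, b) = 0") auto
  ultimately show "m + n \<in> colfin p q" by (simp add: colfin_def)
next
  fix c m assume m: "m \<in> colfin p q"
  have "finite {a. (c *\<^sub>C m) (a, b) \<noteq> 0}" for b
    by (rule finite_subset[OF _ colfin_finite[OF m, of b]]) auto
  then show "c *\<^sub>C m \<in> colfin p q"
    using m by (auto simp: colfin_def)
qed

lemma subspace_colfin_kernel: "csubspace (colfin_kernel p q F)"
  using subspace_colfin[of p q] unfolding csubspace_def colfin_kernel_def by auto

lemma zero_base_colfin: "zero_base (colfin p q) (colfin_base p q)"
  unfolding zero_base_def
proof (intro conjI ballI)
  show "colfin_base p q \<noteq> {}" unfolding colfin_base_def by blast
  fix E E' assume "E \<in> colfin_base p q" "E' \<in> colfin_base p q"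
  then obtain F F' where F: "E = colfin_kernel p q F" "E' = colfin_kernel p q F'"
      "finite F" "finite F'" "F \<subseteq> {b. length b = q}" "F' \<subseteq> {b. length b = q}"
    by (auto simp: colfin_base_def)
  then have "colfin_kernel p q (F \<union> F') \<in> colfin_base p q" unfolding colfin_base_def by blast
  then show "\<exists>E''\<in>colfin_base p q. E'' \<subseteq> E \<inter> E'"
    by (rule bexI[rotated]) (auto simp: F colfin_kernel_def)
qed (auto simp: subspace_colfin colfin_base_def subspace_colfin_kernel, auto simp: colfin_kernel_def)

lemma topspace_colfin: "topspace (colfin_topology p q) = colfin p q"
  unfolding colfin_topology_def by (rule topspace_zero_base[OF zero_base_colfin])

lemma is_linear_colfin: "is_linear_topology (colfin_topology p q)"
  unfolding colfin_topology_def by (rule is_linear_topology_zero_base[OF zero_base_colfin])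

lemma open_subspaces_colfin:
  "E \<in> open_subspaces (colfin_topology p q) \<longleftrightarrow> csubspace E \<and> E \<subseteq> colfin p q \<and>
     (\<exists>F. finite F \<and> F \<subseteq> {b. length b = q} \<and> colfin_kernel p q F \<subseteq> E)"
  unfolding colfin_topology_def open_subspaces_zero_base[OF zero_base_colfin]
  by (auto simp: colfin_base_def)

lemma colfin_kernel_open:
  assumes "finite F" shows "colfin_kernel p q F \<in> open_subspaces (colfin_topology p q)"
  unfolding open_subspaces_colfin
proof (intro conjI exI subspace_colfin_kernel)
  show "finite (F \<inter> {b. length b = q})" using assms by simp
  show "colfin_kernel p q F \<subseteq> colfin p q" by (auto simp: colfin_kernel_def)
  show "colfin_kernel p q (F \<inter> {b. length b = q}) \<subseteq> colfin_kernel p q F"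
  proof
    fix m assume m: "m \<in> colfin_kernel p q (F \<inter> {b. length b = q})"
    then have "m (a, b) = 0" if "b \<in> F" for a b
      using that colfin_length[of m p q a b] by (auto simp: colfin_kernel_def)
    then show "m \<in> colfin_kernel p q F" using m by (simp add: colfin_kernel_def)
  qed
qed auto

lemma complete_zero_baseI:
  assumes base: "zero_base W \<B>"
    and lim: "\<And>\<F>. \<F> \<noteq> bot \<Longrightarrow> (\<And>E. E \<in> \<B> \<Longrightarrow> \<exists>x\<in>W. eventually (\<lambda>y. y - x \<in> E) \<F>) \<Longrightarrow>
                \<exists>l\<in>W. \<forall>E\<in>\<B>. eventually (\<lambda>y. y - l \<in> E) \<F>"
  shows "complete_linear_topology (linear_topology W \<B>)"
  unfolding complete_linear_topology_def
proof (intro allI impI, elim conjE)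
  fix \<F> assume F: "\<F> \<noteq> bot"
    and cauchy: "\<forall>E\<in>open_subspaces (linear_topology W \<B>).
        \<exists>x\<in>topspace (linear_topology W \<B>). eventually (\<lambda>y. y - x \<in> E) \<F>"
  have "\<exists>x\<in>W. eventually (\<lambda>y. y - x \<in> E) \<F>" if "E \<in> \<B>" for E
    using cauchy zero_base_open[OF base that] unfolding topspace_zero_base[OF base] by blast
  then obtain l where l: "l \<in> W" "\<forall>E\<in>\<B>. eventually (\<lambda>y. y - l \<in> E) \<F>" using lim[OF F] by blast
  have "limitin (linear_topology W \<B>) (\<lambda>y. y) l \<F>"
    unfolding limitin_def topspace_zero_base[OF base]
  proof (intro conjI l(1) allI impI)
    fix U assume "openin (linear_topology W \<B>) U \<and> l \<in> U"
    then obtain E where E: "E \<in> \<B>" "(+) l ` E \<subseteq> U" using openin_zero_base[OF base, of U] by blast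
    have "eventually (\<lambda>y. y - l \<in> E) \<F>" using l(2) E(1) by blast
    then show "eventually (\<lambda>y. y \<in> U) \<F>"
      by (rule eventually_mono) (use E(2) in_coset_iff[of _ l E] in blast)
  qed
  then show "\<exists>l. limitin (linear_topology W \<B>) (\<lambda>y. y) l \<F>" by blast
qed

lemma Hausdorff_zero_baseI:
  assumes base: "zero_base W \<B>" and "\<And>x. x \<in> W \<Longrightarrow> x \<noteq> 0 \<Longrightarrow> \<exists>E\<in>\<B>. x \<notin> E"
  shows "Hausdorff_space (linear_topology W \<B>)"
  by (rule Hausdorff_linear_topology[OF is_linear_topology_zero_base[OF base]])
    (use assms(2) zero_base_open[OF base] in \<open>unfold topspace_zero_base[OF base], blast\<close>)

lemma Hausdorff_colfin: "Hausdorff_space (colfin_topology p q)"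
  unfolding colfin_topology_def
proof (rule Hausdorff_zero_baseI[OF zero_base_colfin])
  fix m assume m: "m \<in> colfin p q" "m \<noteq> 0"
  then obtain a b where "m (a, b) \<noteq> 0" by (auto simp: fun_eq_iff)
  moreover from this have "colfin_kernel p q {b} \<in> colfin_base p q"
    using colfin_length[OF m(1)] by (auto simp: colfin_base_def)
  ultimately show "\<exists>E\<in>colfin_base p q. m \<notin> E" by (intro bexI) (auto simp: colfin_kernel_def)
qed

text \<open>A Cauchy filter is eventually constant on each column; the eventual columns form its limit.\<close>

lemma complete_colfin: "complete_linear_topology (colfin_topology p q)"
  unfolding colfin_topology_def
proof (rule complete_zero_baseI[OF zero_base_colfin])
  fix \<F> :: "matrix filter" assume ne: "\<F> \<noteq> bot"
    and cauchy: "\<And>E. E \<in> colfin_base p q \<Longrightarrow> \<exists>x\<in>colfin p q. eventually (\<lambda>y. y - x \<in> E) \<F>"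
  have "\<exists>x\<in>colfin p q. eventually (\<lambda>y. \<forall>a. y (a, b) = x (a, b)) \<F>" if "length b = q" for b
  proof -
    have "colfin_kernel p q {b} \<in> colfin_base p q" using that by (auto simp: colfin_base_def)
    then obtain x where x: "x \<in> colfin p q" "eventually (\<lambda>y. y - x \<in> colfin_kernel p q {b}) \<F>"
      using cauchy by blast
    from x(2) have "eventually (\<lambda>y. \<forall>a. y (a, b) = x (a, b)) \<F>"
      by (rule eventually_mono) (simp add: colfin_kernel_def)
    then show ?thesis using x(1) by blast
  qed
  then have "\<forall>b\<in>{b. length b = q}. \<exists>x. x \<in> colfin p q \<and> eventually (\<lambda>y. \<forall>a. y (a, b) = x (a, b)) \<F>"
    by blast
  then obtain x where "\<forall>b\<in>{b. length b = q}.
      x b \<in> colfin p q \<and> eventually (\<lambda>y. \<forall>a. y (a, b) = x b (a, b)) \<F>"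
    by (rule bchoice[THEN exE])
  then have x: "\<And>b. length b = q \<Longrightarrow> x b \<in> colfin p q"
      "\<And>b. length b = q \<Longrightarrow> eventually (\<lambda>y. \<forall>a. y (a, b) = x b (a, b)) \<F>" by auto
  define l :: matrix where "l = (\<lambda>(a, b). if length b = q then x b (a, b) else 0)"
  have "finite {a. l (a, b) \<noteq> 0}" for b
    using colfin_finite[OF x(1), of b b] by (cases "length b = q") (simp_all add: l_def)
  moreover have "length a = p \<and> length b = q" if "l (a, b) \<noteq> 0" for a b
    using that colfin_length[OF x(1), of b a b] by (auto simp: l_def split: if_splits)
  ultimately have l: "l \<in> colfin p q" by (simp add: colfin_def)
  have "eventually (\<lambda>y. y - l \<in> E) \<F>" if E: "E \<in> colfin_base p q" for E
  proof -
    obtain F where F: "E = colfin_kernel p q F" "finite F" "F \<subseteq> {b. length b = q}"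
      using E unfolding colfin_base_def by blast
    obtain z where z: "z \<in> colfin p q" "eventually (\<lambda>y. y - z \<in> E) \<F>" using cauchy[OF E] by blast
    have "eventually (\<lambda>y. \<forall>b\<in>F. \<forall>a. y (a, b) = x b (a, b)) \<F>"
      by (rule eventually_ball_finite[OF F(2)]) (use F(3) x(2) in blast)
    with z(2) show ?thesis
    proof eventually_elim
      case (elim y)
      have "y - z \<in> colfin p q" using elim(1) by (simp add: F(1) colfin_kernel_def)
      from csubspace_diff[OF subspace_colfin
          csubspace_add[OF subspace_colfin this z(1)] l]
      have "y - l \<in> colfin p q" by simp
      moreover have "(y - l) (a, b) = 0" if "b \<in> F" for a b
        using elim(2) F(3) that by (auto simp: l_def)
      ultimately show ?case by (simp add: F(1) colfin_kernel_def)
    qed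
  qed
  then show "\<exists>l\<in>colfin p q. \<forall>E\<in>colfin_base p q. eventually (\<lambda>y. y - l \<in> E) \<F>" using l by blast
qed

lemma zero_open_colfin: "{0} \<in> open_subspaces (colfin_topology p 0)"
proof -
  have "colfin_kernel p 0 {[]} = {0}"
  proof
    show "colfin_kernel p 0 {[]} \<subseteq> {0}"
    proof
      fix m assume m: "m \<in> colfin_kernel p 0 {[]}"
      then have "m (a, b) = 0" for a b
        using colfin_length[of m p 0 a b] by (auto simp: colfin_kernel_def)
      then show "m \<in> {0}" by (simp add: fun_eq_iff)
    qed
  qed (use csubspace_0[OF subspace_colfin_kernel] in simp)
  then show ?thesis using colfin_kernel_open[of "{[]}" p 0] by simp
qed

lemma unit_matrix_colfin: "length a = p \<Longrightarrow> length b = q \<Longrightarrow> unit_matrix a b \<in> colfin p q"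
  by (auto simp: colfin_def unit_matrix_def)

lemma colfin_sum_unit_matrix:
  assumes "finite A" "finite F"
  shows "(\<Sum>a\<in>A. \<Sum>b\<in>F. m (a, b) *\<^sub>C unit_matrix a b) =
           (\<lambda>(a, b). if a \<in> A \<and> b \<in> F then m (a, b) else 0)"
proof (rule ext)
  fix x :: "nat list \<times> nat list"
  obtain a b where x: "x = (a, b)" by (cases x)
  have "(\<Sum>a\<in>A. \<Sum>b\<in>F. m (a, b) *\<^sub>C unit_matrix a b) x =
      (\<Sum>a'\<in>A. \<Sum>b'\<in>F. if a' = a then (if b' = b then m (a, b) else 0) else 0)"
    unfolding sum_fun_apply by (intro sum.cong refl) (auto simp: unit_matrix_def x)
  also have "\<dots> = (\<Sum>a'\<in>A. if a' = a then (\<Sum>b'\<in>F. if b' = b then m (a, b) else 0) else 0)"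
    by (intro sum.cong refl) auto
  also have "\<dots> = (if a \<in> A then (if b \<in> F then m (a, b) else 0) else 0)"
    using assms by (simp add: sum.delta)
  also have "\<dots> = (case x of (a, b) \<Rightarrow> if a \<in> A \<and> b \<in> F then m (a, b) else 0)"
    by (simp add: x)
  finally show "(\<Sum>a\<in>A. \<Sum>b\<in>F. m (a, b) *\<^sub>C unit_matrix a b) x =
      (case x of (a, b) \<Rightarrow> if a \<in> A \<and> b \<in> F then m (a, b) else 0)" .
qed

lemma cofinite_colfin: "cofinite_topology (colfin_topology 0 q)"
  unfolding cofinite_topology_def topspace_colfin
proof
  fix E assume "E \<in> open_subspaces (colfin_topology 0 q)"
  then obtain F where F: "finite F" "F \<subseteq> {b. length b = q}" "colfin_kernel 0 q F \<subseteq> E"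
    unfolding open_subspaces_colfin by blast
  let ?S = "unit_matrix [] ` F"
  have S: "?S \<subseteq> colfin 0 q" using F(2) unit_matrix_colfin[of "[]" 0 _ q] by auto
  have "\<exists>y\<in>cspan ?S. x - y \<in> E" if x: "x \<in> colfin 0 q" for x
  proof -
    define y where "y = (\<Sum>a\<in>{[]}. \<Sum>b\<in>F. x (a, b) *\<^sub>C unit_matrix a b)"
    have y: "y \<in> cspan ?S"
      unfolding y_def
      by (intro cspan_sum cspan_scale cspan_base) auto
    have "y \<in> colfin 0 q" using y cspan_minimal[OF S subspace_colfin] by blast
    then have "x - y \<in> colfin 0 q" by (rule csubspace_diff[OF subspace_colfin x])
    moreover have "(x - y) (a, b) = 0" if "b \<in> F" for a b
      unfolding y_def colfin_sum_unit_matrix[OF finite.insertI[OF finite.emptyI] F(1)]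
      using that colfin_length[OF x, of a b] by auto
    ultimately have "x - y \<in> colfin_kernel 0 q F" by (simp add: colfin_kernel_def)
    then show ?thesis using y F(3) by blast
  qed
  then show "\<exists>S\<subseteq>colfin 0 q. finite S \<and> (\<forall>x\<in>colfin 0 q. \<exists>y\<in>cspan S. x - y \<in> E)"
    using S F(1) by blast
qed

text \<open>A matrix is embedded into \<open>coeffs\<close> by enumerating its entries; only the head of the list that is the
  argument matters.\<close>

lemma completion_iso_matrix:
  fixes M :: "matrix topology"
  assumes T: "is_linear_topology T" and c: "is_completion T M \<kappa>"
  obtains \<phi> where "tvs_iso (completion T) M \<phi>"
    "\<And>x. x \<in> topspace T \<Longrightarrow> \<phi> (completion_map T x) = \<kappa> x"
    "is_linear_topology (completion T)"
    "\<And>x. x \<in> topspace T \<Longrightarrow> completion_map T x \<in> topspace (completion T)"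
proof -
  let ?e = "\<lambda>m::matrix. \<lambda>l. m (from_nat (hd l))"
  have lin: "linear_on (topspace M) ?e" by (auto simp: linear_on_def fun_eq_iff)
  have "m x = n x" if "?e m = ?e n" for m n x
    using fun_cong[OF that, of "[to_nat x]"] by simp
  then have inj: "inj_on ?e (topspace M)" by (auto simp: inj_on_def fun_eq_iff)
  obtain \<phi> where \<phi>: "tvs_iso (completion T) M \<phi>"
    "\<And>x. x \<in> topspace T \<Longrightarrow> \<phi> (completion_map T x) = \<kappa> x"
    "is_completion T (completion T) (completion_map T)"
    using completion_iso[OF T c lin inj] by metis
  show ?thesis by (rule that[OF \<phi>(1,2) is_completionD(1)[OF \<phi>(3) T] is_completionD(5)[OF \<phi>(3) T]])
qed

section \<open>Kronecker products\<close>

text \<open>Kronecker product of matrices of which the first has format \<open>(p, q)\<close>. The pairs of indices by which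
  its rows and columns are usually labelled are encoded by concatenation, so that products of lists
  of basis vectors correspond to products of matrices.\<close>

definition kron :: "nat \<Rightarrow> nat \<Rightarrow> matrix \<Rightarrow> matrix \<Rightarrow> matrix" where
  "kron p q f g = (\<lambda>(a, b). f (take p a, take q b) * g (drop p a, drop q b))"

lemma clinear_kron_left: "clinear (\<lambda>f. kron p q f g)"
  by (rule clinearI) (auto simp: kron_def fun_eq_iff algebra_simps)

lemma clinear_kron_right: "clinear (\<lambda>g. kron p q f g)"
  by (rule clinearI) (auto simp: kron_def fun_eq_iff algebra_simps)

lemma kron_append: "length a = p \<Longrightarrow> length b = q \<Longrightarrow> kron p q f g (a @ a', b @ b') = f (a, b) * g (a', b')"
  by (simp add: kron_def)

lemma kron_length:
  assumes f: "f \<in> colfin p q" and g: "g \<in> colfin p' q'" and nz: "kron p q f g (a, b) \<noteq> 0"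
  shows "length a = p + p' \<and> length b = q + q'"
proof -
  have "f (take p a, take q b) \<noteq> 0" "g (drop p a, drop q b) \<noteq> 0" using nz by (auto simp: kron_def)
  then have "length (take p a) = p \<and> length (take q b) = q" "length (drop p a) = p' \<and> length (drop q b) = q'"
    using colfin_length[OF f, of "take p a" "take q b"] colfin_length[OF g, of "drop p a" "drop q b"]
    by blast+
  then show ?thesis by auto
qed

lemma kron_colfin:
  assumes f: "f \<in> colfin p q" and g: "g \<in> colfin p' q'"
  shows "kron p q f g \<in> colfin (p + p') (q + q')"
proof -
  have "finite {a. kron p q f g (a, b) \<noteq> 0}" for b
  proof (rule finite_subset)
    let ?A = "{a. f (a, take q b) \<noteq> 0}" and ?B = "{a. g (a, drop q b) \<noteq> 0}"
    show "finite ((\<lambda>(x, y). x @ y) ` (?A \<times> ?B))"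
      using colfin_finite[OF f] colfin_finite[OF g] by (intro finite_imageI finite_cartesian_product)
    show "{a. kron p q f g (a, b) \<noteq> 0} \<subseteq> (\<lambda>(x, y). x @ y) ` (?A \<times> ?B)"
    proof
      fix a assume "a \<in> {a. kron p q f g (a, b) \<noteq> 0}"
      then have "(take p a, drop p a) \<in> ?A \<times> ?B" by (auto simp: kron_def)
      moreover have "a = (\<lambda>(x, y). x @ y) (take p a, drop p a)" by simp
      ultimately show "a \<in> (\<lambda>(x, y). x @ y) ` (?A \<times> ?B)" by (rule rev_image_eqI)
    qed
  qed
  then show ?thesis using kron_length[OF f g] by (simp add: colfin_def)
qed

lemma kron_unit_matrix:
  assumes "length a = p" "length b = q"
  shows "kron p q (unit_matrix a b) (unit_matrix a' b') = unit_matrix (a @ a') (b @ b')"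
proof (rule ext, clarify)
  fix x y
  have "take p x = a \<and> drop p x = a' \<longleftrightarrow> x = a @ a'" for x
    using assms(1) by (metis append_eq_conv_conj)
  moreover have "take q y = b \<and> drop q y = b' \<longleftrightarrow> y = b @ b'" for y
    using assms(2) by (metis append_eq_conv_conj)
  ultimately show "kron p q (unit_matrix a b) (unit_matrix a' b') (x, y) = unit_matrix (a @ a') (b @ b') (x, y)"
    by (auto simp: kron_def unit_matrix_def)
qed

lemma kron_lift:
  obtains L where "clinear L" "\<And>f g. L (f \<otimes> g) = kron p q f g"
  using tensor_universal[OF clinear_kron_left clinear_kron_right] by blast

text \<open>Modulo an open subspace only finitely many columns of either factor matter, and these have
  finitely many non-zero entries.\<close>

lemma kron_expansion:
  assumes L: "clinear L" "\<And>f g. L (f \<otimes> g) = kron p q f g"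
    and F: "finite F" "F \<subseteq> {b. length b = q}" and F': "finite F'" "F' \<subseteq> {b. length b = q'}"
    and E: "csubspace E"
      "tensor_space (colfin_kernel p q F) (colfin p' q') \<subseteq> E"
      "tensor_space (colfin p q) (colfin_kernel p' q' F') \<subseteq> E"
    and t: "t \<in> tensor_space (colfin p q) (colfin p' q')"
  obtains A A' where "t - (\<Sum>a\<in>A. \<Sum>b\<in>F. \<Sum>a'\<in>A'. \<Sum>b'\<in>F'.
      L t (a @ a', b @ b') *\<^sub>C (unit_matrix a b \<otimes> unit_matrix a' b')) \<in> E"
proof -
  \<comment> \<open>A bound for the rows depends on \<open>t\<close>. To have a condition that is linear in \<open>t\<close>, the claim is made
    for all sufficiently large finite sets \<open>C\<close> of rows.\<close>
  define R where "R C t = (\<Sum>a\<in>{a\<in>C. length a = p}. \<Sum>b\<in>F. \<Sum>a'\<in>{a\<in>C. length a = p'}. \<Sum>b'\<in>F'.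
      L t (a @ a', b @ b') *\<^sub>C (unit_matrix a b \<otimes> unit_matrix a' b'))" for C t
  have R0: "R C 0 = 0" for C by (simp add: R_def clinear_0[OF L(1)])
  have Radd: "R C (s + t) = R C s + R C t" for C s t
    by (simp add: R_def clinear_add[OF L(1)] scaleC_add_left sum.distrib)
  have Rscale: "R C (c *\<^sub>C t) = c *\<^sub>C R C t" for C c t
    by (simp add: R_def clinear_scale[OF L(1)] scaleC_scaleC complex_vector.scale_sum_right)
  let ?P = "\<lambda>t. eventually (\<lambda>C. t - R C t \<in> E) (finite_subsets_at_top UNIV)"
  have "csubspace {t. ?P t}"
    unfolding csubspace_def mem_Collect_eq
  proof (intro conjI ballI allI)
    show "?P 0" by (simp add: R0 csubspace_0[OF E(1)])
    fix s t assume "s \<in> {t. ?P t}" "t \<in> {t. ?P t}"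
    then have "?P s" "?P t" by simp_all
    then have "?P (s + t)"
    proof eventually_elim
      case (elim C)
      then have "(s - R C s) + (t - R C t) \<in> E" by (rule csubspace_add[OF E(1)])
      then show ?case by (simp add: Radd algebra_simps)
    qed
    then show "?P (s + t)" .
  next
    fix c t assume "t \<in> {t. ?P t}"
    then have "?P t" by simp
    then show "?P (c *\<^sub>C t)"
    proof eventually_elim
      case (elim C)
      then have "c *\<^sub>C (t - R C t) \<in> E" by (rule csubspace_scale[OF E(1)])
      then show ?case by (simp add: Rscale complex_vector.scale_right_diff_distrib)
    qed
  qed
  moreover have "f \<otimes> g \<in> {t. ?P t}" if f: "f \<in> colfin p q" and g: "g \<in> colfin p' q'" for f g
  proof -
    have trunc: "\<exists>A. finite A \<and> (\<forall>C. A \<subseteq> C \<longrightarrow> finite C \<longrightarrow>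
        h - (\<Sum>a\<in>{a\<in>C. length a = r}. \<Sum>b\<in>G. h (a, b) *\<^sub>C unit_matrix a b) \<in> colfin_kernel r s G \<and>
        (\<Sum>a\<in>{a\<in>C. length a = r}. \<Sum>b\<in>G. h (a, b) *\<^sub>C unit_matrix a b) \<in> colfin r s)"
      if h: "h \<in> colfin r s" and G: "finite G" "G \<subseteq> {b. length b = s}" for h r s G
    proof (intro exI conjI allI impI)
      show "finite (\<Union>b\<in>G. {a. h (a, b) \<noteq> 0})" using G(1) colfin_finite[OF h] by blast
      fix C assume C: "(\<Union>b\<in>G. {a. h (a, b) \<noteq> 0}) \<subseteq> C" "finite C"
      let ?h = "\<Sum>a\<in>{a\<in>C. length a = r}. \<Sum>b\<in>G. h (a, b) *\<^sub>C unit_matrix a b"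
      show h': "?h \<in> colfin r s"
        by (intro csubspace_sum[OF subspace_colfin]
            csubspace_scale[OF subspace_colfin] unit_matrix_colfin) (use G(2) in auto)
      have eq: "?h = (\<lambda>(a, b). if a \<in> {a\<in>C. length a = r} \<and> b \<in> G then h (a, b) else 0)"
        by (rule colfin_sum_unit_matrix) (use C G in auto)
      have "(h - ?h) (a, b) = 0" if "b \<in> G" for a b
        unfolding eq using that C(1) colfin_length[OF h, of a b] by auto
      then show "h - ?h \<in> colfin_kernel r s G"
        using csubspace_diff[OF subspace_colfin h h'] by (simp add: colfin_kernel_def)
    qed
    obtain A where A: "finite A" "\<And>C. A \<subseteq> C \<Longrightarrow> finite C \<Longrightarrow>
        f - (\<Sum>a\<in>{a\<in>C. length a = p}. \<Sum>b\<in>F. f (a, b) *\<^sub>C unit_matrix a b) \<in> colfin_kernel p q F \<and>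
        (\<Sum>a\<in>{a\<in>C. length a = p}. \<Sum>b\<in>F. f (a, b) *\<^sub>C unit_matrix a b) \<in> colfin p q"
      using trunc[OF f F] by blast
    obtain B where B: "finite B" "\<And>C. B \<subseteq> C \<Longrightarrow> finite C \<Longrightarrow>
        g - (\<Sum>a\<in>{a\<in>C. length a = p'}. \<Sum>b\<in>F'. g (a, b) *\<^sub>C unit_matrix a b) \<in> colfin_kernel p' q' F' \<and>
        (\<Sum>a\<in>{a\<in>C. length a = p'}. \<Sum>b\<in>F'. g (a, b) *\<^sub>C unit_matrix a b) \<in> colfin p' q'"
      using trunc[OF g F'] by blast
    have "f \<otimes> g - R C (f \<otimes> g) \<in> E" if C: "finite C" "A \<union> B \<subseteq> C" for C
    proof -
      define f' where "f' = (\<Sum>a\<in>{a\<in>C. length a = p}. \<Sum>b\<in>F. f (a, b) *\<^sub>C unit_matrix a b)"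
      define g' where "g' = (\<Sum>a\<in>{a\<in>C. length a = p'}. \<Sum>b\<in>F'. g (a, b) *\<^sub>C unit_matrix a b)"
      have f': "f - f' \<in> colfin_kernel p q F" "f' \<in> colfin p q"
        using A(2)[of C] C unfolding f'_def by auto
      have g': "g - g' \<in> colfin_kernel p' q' F'" using B(2)[of C] C unfolding g'_def by auto
      have Lfg: "L (f \<otimes> g) (a @ a', b @ b') = f (a, b) * g (a', b')"
        if "length a = p" "b \<in> F" for a b a' b'
        unfolding L(2) by (rule kron_append) (use that F(2) in auto)
      have "f' \<otimes> g' = (\<Sum>a\<in>{a\<in>C. length a = p}. \<Sum>b\<in>F.
          \<Sum>a'\<in>{a\<in>C. length a = p'}. \<Sum>b'\<in>F'. (f (a, b) * g (a', b')) *\<^sub>C (unit_matrix a b \<otimes> unit_matrix a' b'))"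
      proof -
        have "unit_matrix a b \<otimes> g' = (\<Sum>a'\<in>{a\<in>C. length a = p'}. \<Sum>b'\<in>F'.
            g (a', b') *\<^sub>C (unit_matrix a b \<otimes> unit_matrix a' b'))" for a b
          unfolding g'_def by (simp add: clinear_sum[OF clinear_pure2_right] pure2_scale_right)
        then show ?thesis
          unfolding f'_def
          by (simp add: clinear_sum[OF clinear_pure2_left] pure2_scale_left scaleC_scaleC
              complex_vector.scale_sum_right)
      qed
      also have "\<dots> = R C (f \<otimes> g)"
        unfolding R_def by (intro sum.cong refl) (simp add: Lfg)
      finally have "f \<otimes> g - R C (f \<otimes> g) = (f - f') \<otimes> g + f' \<otimes> (g - g')"
        by (simp add: clinear_diff[OF clinear_pure2_left] clinear_diff[OF clinear_pure2_right])
      moreover have "(f - f') \<otimes> g \<in> E" using pure2_in_tensor_space[OF f'(1) g] E(2) by blast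
      moreover have "f' \<otimes> (g - g') \<in> E" using pure2_in_tensor_space[OF f'(2) g'] E(3) by blast
      ultimately show ?thesis using csubspace_add[OF E(1)] by simp
    qed
    then show ?thesis
      unfolding mem_Collect_eq eventually_finite_subsets_at_top
      using A(1) B(1) by (intro exI[of _ "A \<union> B"]) auto
  qed
  ultimately have "tensor_space (colfin p q) (colfin p' q') \<subseteq> {t. ?P t}"
    using tensor_space_subset_iff by blast
  then have "?P t" using t by blast
  then obtain C where "t - R C t \<in> E"
    using eventually_happens'[OF finite_subsets_at_top_neq_bot] by blast
  then show ?thesis using that unfolding R_def by blast
qed

text \<open>The images of products of matrix units are all matrix units, whence density. If the entries of \<open>L t\<close>
  vanish in the columns \<open>b @ b'\<close> with \<open>b \<in> F\<close> and \<open>b' \<in> F'\<close>, then the expansion of \<open>t\<close> modulo \<open>E\<close> is zero;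
  so the subspaces \<open>E\<close> that are open in the tensor product contain preimages of open subspaces.\<close>

lemma kron_completion:
  assumes L: "clinear L" "\<And>f g. L (f \<otimes> g) = kron p q f g"
  shows "is_completion (shriek_tensor (colfin_topology p q) (colfin_topology p' q'))
           (colfin_topology (p + p') (q + q')) L"
proof (rule is_completionI)
  let ?W = "tensor_space (colfin p q) (colfin p' q')"
  let ?S = "shriek_tensor (colfin_topology p q) (colfin_topology p' q')"
  note lin = is_linear_colfin[of p q] is_linear_colfin[of p' q']
  have top: "topspace ?S = ?W" unfolding topspace_shriek[OF lin] topspace_colfin by (rule refl)
  have op: "E \<in> open_subspaces ?S \<longleftrightarrow> E \<in> shriek_base (colfin_topology p q) (colfin_topology p' q')" for E
    unfolding shriek_tensor_base open_subspaces_zero_base[OF zero_base_shriek[OF lin]]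
    unfolding shriek_base_def by blast
  show "is_linear_topology ?S" by (rule is_linear_shriek[OF lin])
  show "is_linear_topology (colfin_topology (p + p') (q + q'))"
    "Hausdorff_space (colfin_topology (p + p') (q + q'))"
    "complete_linear_topology (colfin_topology (p + p') (q + q'))"
    by (rule is_linear_colfin Hausdorff_colfin complete_colfin)+
  show "linear_on (topspace ?S) L" by (rule clinear_imp_linear_on[OF L(1)])
  have LW: "L t \<in> colfin (p + p') (q + q')" if "t \<in> ?W" for t
    by (rule clinear_tensor_space[OF L(1) subspace_colfin _ that]) (simp add: L(2) kron_colfin)
  then show "L ` topspace ?S \<subseteq> topspace (colfin_topology (p + p') (q + q'))"
    by (auto simp: top topspace_colfin)
  show "\<exists>x\<in>topspace ?S. L x - y \<in> E"
    if y: "y \<in> topspace (colfin_topology (p + p') (q + q'))"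
      and E: "E \<in> open_subspaces (colfin_topology (p + p') (q + q'))" for y E
  proof -
    obtain F where F: "finite F" "F \<subseteq> {b. length b = q + q'}" "colfin_kernel (p + p') (q + q') F \<subseteq> E"
      using E unfolding open_subspaces_colfin by blast
    have y: "y \<in> colfin (p + p') (q + q')" using y by (simp add: topspace_colfin)
    define A where "A = (\<Union>b\<in>F. {a. y (a, b) \<noteq> 0})"
    have A: "finite A" using F(1) colfin_finite[OF y] by (auto simp: A_def)
    have lenA: "length a = p + p'" if "a \<in> A" for a
      using that colfin_length[OF y] by (auto simp: A_def)
    define x where "x = (\<Sum>a\<in>A. \<Sum>b\<in>F. y (a, b) *\<^sub>C
      (unit_matrix (take p a) (take q b) \<otimes> unit_matrix (drop p a) (drop q b)))"
    have x: "x \<in> ?W"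
      unfolding x_def
      by (intro csubspace_sum[OF subspace_tensor_space]
          csubspace_scale[OF subspace_tensor_space] pure2_in_tensor_space
          unit_matrix_colfin) (use lenA F(2) in auto)
    have "L x = (\<Sum>a\<in>A. \<Sum>b\<in>F. y (a, b) *\<^sub>C unit_matrix a b)"
      unfolding x_def using lenA F(2)
      by (auto simp: clinear_sum[OF L(1)] clinear_scale[OF L(1)] L(2) kron_unit_matrix intro!: sum.cong)
    then have Lx: "L x = (\<lambda>(a, b). if a \<in> A \<and> b \<in> F then y (a, b) else 0)"
      using colfin_sum_unit_matrix[OF A F(1)] by simp
    have "(L x - y) (a, b) = 0" if "b \<in> F" for a b
      using that by (auto simp: Lx A_def)
    then have "L x - y \<in> colfin_kernel (p + p') (q + q') F"
      using csubspace_diff[OF subspace_colfin LW[OF x] y] by (simp add: colfin_kernel_def)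
    then show ?thesis using x F(3) top by blast
  qed
  show "\<exists>E\<in>open_subspaces ?S. L ` E \<subseteq> E'"
    if E': "E' \<in> open_subspaces (colfin_topology (p + p') (q + q'))" for E'
  proof -
    obtain F where F: "finite F" "F \<subseteq> {b. length b = q + q'}" "colfin_kernel (p + p') (q + q') F \<subseteq> E'"
      using E' unfolding open_subspaces_colfin by blast
    let ?K = "colfin_kernel (p + p') (q + q') F"
    let ?E = "{t \<in> ?W. L t \<in> ?K}"
    have s: "csubspace ?E"
      by (rule subspace_vimage_Int[OF clinear_imp_linear_on[OF L(1)] subspace_tensor_space
            subspace_colfin_kernel])
    have in1: "f \<otimes> g \<in> ?E" if f: "f \<in> colfin_kernel p q (take q ` F)" and g: "g \<in> colfin p' q'" for f g
    proof -
      have f': "f \<in> colfin p q" using f by (simp add: colfin_kernel_def)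
      have "kron p q f g (a, b) = 0" if "b \<in> F" for a b
        using f that by (simp add: colfin_kernel_def kron_def)
      then show ?thesis
        using pure2_in_tensor_space[OF f' g] kron_colfin[OF f' g] by (simp add: L(2) colfin_kernel_def)
    qed
    have in2: "f \<otimes> g \<in> ?E" if f: "f \<in> colfin p q" and g: "g \<in> colfin_kernel p' q' (drop q ` F)" for f g
    proof -
      have g': "g \<in> colfin p' q'" using g by (simp add: colfin_kernel_def)
      have "kron p q f g (a, b) = 0" if "b \<in> F" for a b
        using g that by (simp add: colfin_kernel_def kron_def)
      then show ?thesis
        using pure2_in_tensor_space[OF f g'] kron_colfin[OF f g'] by (simp add: L(2) colfin_kernel_def)
    qed
    have "tensor_space (colfin_kernel p q (take q ` F)) (colfin p' q') \<subseteq> ?E"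
      "tensor_space (colfin p q) (colfin_kernel p' q' (drop q ` F)) \<subseteq> ?E"
      unfolding tensor_space_subset_iff[OF s] using in1 in2 by blast+
    then have "?E \<in> open_subspaces ?S"
      unfolding op shriek_base_def topspace_colfin mem_Collect_eq
      by (intro conjI s bexI[OF _ colfin_kernel_open[OF finite_imageI[OF F(1)]]]) auto
    then show ?thesis by (rule bexI[rotated]) (use F(3) in auto)
  qed
  show "\<exists>E'\<in>open_subspaces (colfin_topology (p + p') (q + q')). {x \<in> topspace ?S. L x \<in> E'} \<subseteq> E"
    if E: "E \<in> open_subspaces ?S" for E
  proof -
    obtain P1 P2 where sE: "csubspace E"
      and P: "P1 \<in> open_subspaces (colfin_topology p q)" "P2 \<in> open_subspaces (colfin_topology p' q')"
        "tensor_space P1 (colfin p' q') \<subseteq> E" "tensor_space (colfin p q) P2 \<subseteq> E"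
      using E unfolding op shriek_base_def topspace_colfin mem_Collect_eq by (elim conjE bexE)
    obtain F where F: "finite F" "F \<subseteq> {b. length b = q}" "colfin_kernel p q F \<subseteq> P1"
      using P(1) unfolding open_subspaces_colfin by blast
    obtain F' where F': "finite F'" "F' \<subseteq> {b. length b = q'}" "colfin_kernel p' q' F' \<subseteq> P2"
      using P(2) unfolding open_subspaces_colfin by blast
    have E12: "tensor_space (colfin_kernel p q F) (colfin p' q') \<subseteq> E"
        "tensor_space (colfin p q) (colfin_kernel p' q' F') \<subseteq> E"
      using P(3,4) tensor_space_mono[OF F(3) subset_refl] tensor_space_mono[OF subset_refl F'(3)]
      by blast+
    let ?G = "(\<lambda>(b, b'). b @ b') ` (F \<times> F')"
    have "t \<in> E" if t: "t \<in> ?W" "L t \<in> colfin_kernel (p + p') (q + q') ?G" for t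
    proof -
      obtain A A' where AA: "t - (\<Sum>a\<in>A. \<Sum>b\<in>F. \<Sum>a'\<in>A'. \<Sum>b'\<in>F'.
          L t (a @ a', b @ b') *\<^sub>C (unit_matrix a b \<otimes> unit_matrix a' b')) \<in> E"
        using kron_expansion[OF L F(1,2) F'(1,2) sE E12 t(1)] by blast
      have "L t (a @ a', b @ b') = 0" if "b \<in> F" "b' \<in> F'" for a a' b b'
        using t(2) that by (auto simp: colfin_kernel_def)
      then show ?thesis using AA by simp
    qed
    moreover have "colfin_kernel (p + p') (q + q') ?G \<in> open_subspaces (colfin_topology (p + p') (q + q'))"
      using F(1) F'(1) by (intro colfin_kernel_open) auto
    ultimately show ?thesis unfolding top by (intro bexI) auto
  qed
qed

lemma completed_shriek_colfin:
  assumes T1: "is_linear_topology T1" and T2: "is_linear_topology T2"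
    and \<phi>1: "tvs_iso T1 (colfin_topology p q) \<phi>1" and \<phi>2: "tvs_iso T2 (colfin_topology p' q') \<phi>2"
  obtains \<Phi> where "tvs_iso (completed_shriek T1 T2) (colfin_topology (p + p') (q + q')) \<Phi>"
    "\<And>x y. x \<in> topspace T1 \<Longrightarrow> y \<in> topspace T2 \<Longrightarrow> \<Phi> (shriek_pure T1 T2 x y) = kron p q (\<phi>1 x) (\<phi>2 y)"
    "is_linear_topology (completed_shriek T1 T2)"
    "\<And>x y. x \<in> topspace T1 \<Longrightarrow> y \<in> topspace T2 \<Longrightarrow>
       shriek_pure T1 T2 x y \<in> topspace (completed_shriek T1 T2)"
proof -
  obtain L where L: "clinear L" "\<And>f g. L (f \<otimes> g) = kron p q f g" using kron_lift by blast
  obtain \<Theta> where \<Theta>: "tvs_iso (shriek_tensor T1 T2)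
      (shriek_tensor (colfin_topology p q) (colfin_topology p' q')) \<Theta>"
    "\<And>x y. x \<in> topspace T1 \<Longrightarrow> y \<in> topspace T2 \<Longrightarrow> \<Theta> (x \<otimes> y) = \<phi>1 x \<otimes> \<phi>2 y"
    using tensor_iso[OF T1 T2 is_linear_colfin is_linear_colfin \<phi>1 \<phi>2] by metis
  note lin = is_linear_shriek[OF T1 T2]
  have c: "is_completion (shriek_tensor T1 T2) (colfin_topology (p + p') (q + q')) (\<lambda>t. L (\<Theta> t))"
    by (rule is_completion_compose_iso[OF \<Theta>(1) lin
          is_linear_shriek[OF is_linear_colfin is_linear_colfin] kron_completion[OF L]])
  obtain \<Phi> where \<Phi>: "tvs_iso (completion (shriek_tensor T1 T2)) (colfin_topology (p + p') (q + q')) \<Phi>"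
    "\<And>x. x \<in> topspace (shriek_tensor T1 T2) \<Longrightarrow>
       \<Phi> (completion_map (shriek_tensor T1 T2) x) = L (\<Theta> x)"
    "is_linear_topology (completion (shriek_tensor T1 T2))"
    "\<And>x. x \<in> topspace (shriek_tensor T1 T2) \<Longrightarrow>
       completion_map (shriek_tensor T1 T2) x \<in> topspace (completion (shriek_tensor T1 T2))"
    using completion_iso_matrix[OF lin c] by metis
  have "x \<otimes> y \<in> topspace (shriek_tensor T1 T2)" if "x \<in> topspace T1" "y \<in> topspace T2" for x y
    unfolding topspace_shriek[OF T1 T2] by (rule pure2_in_tensor_space[OF that])
  then show ?thesis
    using that[unfolded completed_shriek_def shriek_pure_def, OF \<Phi>(1) _ \<Phi>(3)] \<Phi>(2,4) \<Theta>(2) L(2) by simp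
qed

section \<open>Matrices with finitely many non-zero rows\<close>

text \<open>The tensors in \<open>V\<^sup>\<otimes>\<^sup>p \<otimes> (V\<^sup>\<otimes>\<^sup>q)\<^sup>*\<close>: finitely many rows, each of them an arbitrary functional on \<open>V\<^sup>\<otimes>\<^sup>q\<close>.\<close>

definition rowfin :: "nat \<Rightarrow> nat \<Rightarrow> matrix set" where
  "rowfin p q = {m. (\<forall>a b. m (a, b) \<noteq> 0 \<longrightarrow> length a = p \<and> length b = q) \<and>
                    finite {a. \<exists>b. m (a, b) \<noteq> 0}}"

text \<open>In the inductive limit topology an open subspace may be chosen independently in each row. Hence the
  finite set of columns depends on the row.\<close>

definition rowfin_kernel :: "nat \<Rightarrow> nat \<Rightarrow> (nat list \<Rightarrow> nat list set) \<Rightarrow> matrix set" where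
  "rowfin_kernel p q N = {m \<in> rowfin p q. \<forall>a. \<forall>b\<in>N a. m (a, b) = 0}"

definition rowfin_base :: "nat \<Rightarrow> nat \<Rightarrow> matrix set set" where
  "rowfin_base p q = rowfin_kernel p q ` {N. \<forall>a. finite (N a)}"

definition rowfin_topology :: "nat \<Rightarrow> nat \<Rightarrow> matrix topology" where
  "rowfin_topology p q = linear_topology (rowfin p q) (rowfin_base p q)"

lemma rowfin_length: "m \<in> rowfin p q \<Longrightarrow> m (a, b) \<noteq> 0 \<Longrightarrow> length a = p \<and> length b = q"
  by (simp add: rowfin_def)

lemma rowfin_finite: "m \<in> rowfin p q \<Longrightarrow> finite {a. \<exists>b. m (a, b) \<noteq> 0}"
  by (simp add: rowfin_def)

lemma subspace_rowfin: "csubspace (rowfin p q)"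
  unfolding csubspace_def
proof (intro conjI ballI allI)
  show "0 \<in> rowfin p q" by (simp add: rowfin_def)
  fix m n assume m: "m \<in> rowfin p q" and n: "n \<in> rowfin p q"
  have "{a. \<exists>b. (m + n) (a, b) \<noteq> 0} \<subseteq> {a. \<exists>b. m (a, b) \<noteq> 0} \<union> {a. \<exists>b. n (a, b) \<noteq> 0}"
  proof
    fix a assume "a \<in> {a. \<exists>b. (m + n) (a, b) \<noteq> 0}"
    then obtain b where "m (a, b) + n (a, b) \<noteq> 0" by auto
    then have "m (a, b) \<noteq> 0 \<or> n (a, b) \<noteq> 0" by auto
    then show "a \<in> {a. \<exists>b. m (a, b) \<noteq> 0} \<union> {a. \<exists>b. n (a, b) \<noteq> 0}" by blast
  qed
  then have "finite {a. \<exists>b. (m + n) (a, b) \<noteq> 0}"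
    using finite_UnI[OF rowfin_finite[OF m] rowfin_finite[OF n]] finite_subset by blast
  moreover have "length a = p \<and> length b = q" if "(m + n) (a, b) \<noteq> 0" for a b
    using that rowfin_length[OF m, of a b] rowfin_length[OF n, of a b] by (cases "m (a, b) = 0") auto
  ultimately show "m + n \<in> rowfin p q" by (simp add: rowfin_def)
next
  fix c m assume m: "m \<in> rowfin p q"
  have "finite {a. \<exists>b. (c *\<^sub>C m) (a, b) \<noteq> 0}"
    by (rule finite_subset[OF _ rowfin_finite[OF m]]) auto
  then show "c *\<^sub>C m \<in> rowfin p q"
    using m by (auto simp: rowfin_def)
qed

lemma subspace_rowfin_kernel: "csubspace (rowfin_kernel p q N)"
  using subspace_rowfin[of p q] unfolding csubspace_def rowfin_kernel_def by auto

lemma zero_base_rowfin: "zero_base (rowfin p q) (rowfin_base p q)"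
  unfolding zero_base_def
proof (intro conjI ballI)
  have "rowfin_kernel p q (\<lambda>_. {}) \<in> rowfin_base p q" unfolding rowfin_base_def by blast
  then show "rowfin_base p q \<noteq> {}" by blast
  fix E E' assume "E \<in> rowfin_base p q" "E' \<in> rowfin_base p q"
  then obtain N N' where N: "E = rowfin_kernel p q N" "E' = rowfin_kernel p q N'"
      "\<forall>a. finite (N a)" "\<forall>a. finite (N' a)"
    by (auto simp: rowfin_base_def)
  then have "rowfin_kernel p q (\<lambda>a. N a \<union> N' a) \<in> rowfin_base p q" unfolding rowfin_base_def by blast
  then show "\<exists>E''\<in>rowfin_base p q. E'' \<subseteq> E \<inter> E'"
    by (rule bexI[rotated]) (auto simp: N rowfin_kernel_def)
qed (auto simp: subspace_rowfin rowfin_base_def subspace_rowfin_kernel, auto simp: rowfin_kernel_def)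

lemma is_linear_rowfin: "is_linear_topology (rowfin_topology p q)"
  unfolding rowfin_topology_def by (rule is_linear_topology_zero_base[OF zero_base_rowfin])

lemma Hausdorff_rowfin: "Hausdorff_space (rowfin_topology p q)"
  unfolding rowfin_topology_def
proof (rule Hausdorff_zero_baseI[OF zero_base_rowfin])
  fix m assume m: "m \<in> rowfin p q" "m \<noteq> 0"
  then obtain a b where "m (a, b) \<noteq> 0" by (auto simp: fun_eq_iff)
  moreover have "rowfin_kernel p q (\<lambda>_. {b}) \<in> rowfin_base p q" by (auto simp: rowfin_base_def)
  ultimately show "\<exists>E\<in>rowfin_base p q. m \<notin> E" by (intro bexI) (auto simp: rowfin_kernel_def)
qed

text \<open>The entrywise limit of a Cauchy filter has finitely many non-zero rows: otherwise one non-zero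
  entry in each of them defines an open subspace, modulo which the filter would not be constant.\<close>

lemma complete_rowfin: "complete_linear_topology (rowfin_topology p q)"
  unfolding rowfin_topology_def
proof (rule complete_zero_baseI[OF zero_base_rowfin])
  fix \<F> :: "matrix filter" assume ne: "\<F> \<noteq> bot"
    and cauchy: "\<And>E. E \<in> rowfin_base p q \<Longrightarrow> \<exists>x\<in>rowfin p q. eventually (\<lambda>y. y - x \<in> E) \<F>"
  have cauchy': "\<exists>x\<in>rowfin p q. eventually (\<lambda>y. y - x \<in> rowfin_kernel p q N) \<F>"
    if "\<forall>a. finite (N a)" for N
    by (rule cauchy) (use that in \<open>auto simp: rowfin_base_def\<close>)
  have "\<exists>z. eventually (\<lambda>y. y (a, b) = z) \<F>" for a b
  proof -
    obtain x where "eventually (\<lambda>y. y - x \<in> rowfin_kernel p q (\<lambda>_. {b})) \<F>"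
      using cauchy'[of "\<lambda>_. {b}"] by auto
    then have "eventually (\<lambda>y. y (a, b) = x (a, b)) \<F>"
      by (rule eventually_mono) (simp add: rowfin_kernel_def)
    then show ?thesis by blast
  qed
  then have "\<forall>c. \<exists>z. eventually (\<lambda>y. y c = z) \<F>" by auto
  then obtain l where l: "\<And>c. eventually (\<lambda>y. y c = l c) \<F>" by metis
  have agree: "l (a, b) = x (a, b)"
    if "eventually (\<lambda>y. y - x \<in> rowfin_kernel p q N) \<F>" "b \<in> N a" for x N a b
  proof -
    have "eventually (\<lambda>y. y (a, b) = l (a, b) \<and> y - x \<in> rowfin_kernel p q N) \<F>"
      by (rule eventually_conj[OF l that(1)])
    then obtain y where "y (a, b) = l (a, b)" "y - x \<in> rowfin_kernel p q N"
      using eventually_happens'[OF ne] by blast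
    then show ?thesis using that(2) by (auto simp: rowfin_kernel_def)
  qed
  have "l \<in> rowfin p q"
  proof -
    \<comment> \<open>One column for each row, with a non-zero entry of \<open>l\<close> if there is one.\<close>
    define N where "N a = {SOME b. l (a, b) \<noteq> 0}" for a
    obtain x where x: "x \<in> rowfin p q" "eventually (\<lambda>y. y - x \<in> rowfin_kernel p q N) \<F>"
      using cauchy'[of N] by (auto simp: N_def)
    have "{a. \<exists>b. l (a, b) \<noteq> 0} \<subseteq> {a. \<exists>b. x (a, b) \<noteq> 0}"
    proof
      fix a assume "a \<in> {a. \<exists>b. l (a, b) \<noteq> 0}"
      then have "l (a, SOME b. l (a, b) \<noteq> 0) \<noteq> 0"
        using someI_ex[of "\<lambda>b. l (a, b) \<noteq> 0"] by simp
      moreover have "l (a, SOME b. l (a, b) \<noteq> 0) = x (a, SOME b. l (a, b) \<noteq> 0)"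
        by (rule agree[OF x(2)]) (simp add: N_def)
      ultimately show "a \<in> {a. \<exists>b. x (a, b) \<noteq> 0}" by auto
    qed
    then have "finite {a. \<exists>b. l (a, b) \<noteq> 0}" using rowfin_finite[OF x(1)] finite_subset by blast
    moreover have "length a = p \<and> length b = q" if nz: "l (a, b) \<noteq> 0" for a b
    proof -
      obtain x where x: "x \<in> rowfin p q" "eventually (\<lambda>y. y - x \<in> rowfin_kernel p q (\<lambda>_. {b})) \<F>"
        using cauchy'[of "\<lambda>_. {b}"] by auto
      then have "x (a, b) \<noteq> 0" using nz agree[OF x(2), of b a] by simp
      then show ?thesis by (rule rowfin_length[OF x(1)])
    qed
    ultimately show ?thesis by (simp add: rowfin_def)
  qed
  moreover have "eventually (\<lambda>y. y - l \<in> E) \<F>" if E: "E \<in> rowfin_base p q" for E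
  proof -
    obtain N where N: "E = rowfin_kernel p q N" using E unfolding rowfin_base_def by blast
    obtain x where x: "x \<in> rowfin p q" "eventually (\<lambda>y. y - x \<in> E) \<F>" using cauchy[OF E] by blast
    have "x - l \<in> E"
      unfolding N rowfin_kernel_def
      using csubspace_diff[OF subspace_rowfin x(1) \<open>l \<in> rowfin p q\<close>]
        agree[OF x(2)[unfolded N]] by simp
    show ?thesis
      using x(2)
    proof (rule eventually_mono)
      fix y assume "y - x \<in> E"
      then have "(y - x) + (x - l) \<in> E"
        using csubspace_add[OF subspace_rowfin_kernel] \<open>x - l \<in> E\<close> unfolding N by blast
      then show "y - l \<in> E" by simp
    qed
  qed
  ultimately show "\<exists>l\<in>rowfin p q. \<forall>E\<in>rowfin_base p q. eventually (\<lambda>y. y - l \<in> E) \<F>" by blast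
qed

definition matrix_row :: "nat list \<Rightarrow> matrix \<Rightarrow> matrix" where
  "matrix_row a m = (\<lambda>(x, b). if x = [] then m (a, b) else 0)"

lemma clinear_matrix_row: "clinear (matrix_row a)"
  by (rule clinearI) (auto simp: matrix_row_def fun_eq_iff)

lemma matrix_row_colfin:
  assumes "m \<in> rowfin p q" shows "matrix_row a m \<in> colfin 0 q"
proof -
  have "finite {x. matrix_row a m (x, b) \<noteq> 0}" for b
    by (rule finite_subset[of _ "{[]}"]) (auto simp: matrix_row_def)
  then show ?thesis using rowfin_length[OF assms] by (auto simp: colfin_def matrix_row_def)
qed

lemma kron_row_rowfin:
  assumes f: "f \<in> colfin p 0" and g: "g \<in> colfin 0 q"
  shows "kron p 0 f g \<in> rowfin p q"
proof -
  have "{a. \<exists>b. kron p 0 f g (a, b) \<noteq> 0} \<subseteq> {a. f (a, []) \<noteq> 0}"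
  proof
    fix a assume "a \<in> {a. \<exists>b. kron p 0 f g (a, b) \<noteq> 0}"
    then obtain b where b: "kron p 0 f g (a, b) \<noteq> 0" by blast
    then have "length a = p" using kron_length[OF f g] by auto
    then show "a \<in> {a. f (a, []) \<noteq> 0}" using b by (auto simp: kron_def)
  qed
  then have "finite {a. \<exists>b. kron p 0 f g (a, b) \<noteq> 0}" using colfin_finite[OF f] finite_subset by blast
  then show ?thesis using kron_length[OF f g] by (auto simp: rowfin_def)
qed

lemma matrix_row_kron:
  assumes g: "g \<in> colfin 0 q" and a: "length a = p"
  shows "matrix_row a (kron p 0 f g) = f (a, []) *\<^sub>C g"
proof (rule ext, clarify)
  fix x b
  show "matrix_row a (kron p 0 f g) (x, b) = (f (a, []) *\<^sub>C g) (x, b)"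
    using a colfin_length[OF g, of x b] by (auto simp: matrix_row_def kron_def)
qed

text \<open>The left factor of a pure tensor has finitely many entries. As before, the equation is shown for all
  large finite sets of rows, since these tensors form a subspace.\<close>

lemma tensor_rows:
  assumes L: "clinear L" "\<And>f g. L (f \<otimes> g) = kron p 0 f g"
    and t: "t \<in> tensor_space (colfin p 0) (colfin 0 q)"
  obtains A where "finite A" "A \<subseteq> {a. length a = p}"
    "t = (\<Sum>a\<in>A. unit_matrix a [] \<otimes> matrix_row a (L t))"
proof -
  define R where "R A t = (\<Sum>a\<in>A. unit_matrix a [] \<otimes> matrix_row a (L t))" for A t
  note row0 = clinear_0[OF clinear_matrix_row] and row_add = clinear_add[OF clinear_matrix_row]
    and row_scale = clinear_scale[OF clinear_matrix_row]
  let ?P = "\<lambda>t. eventually (\<lambda>A. t = R A t) (finite_subsets_at_top {a. length a = p})"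
  have "csubspace {t. ?P t}"
    unfolding csubspace_def mem_Collect_eq
  proof (intro conjI ballI allI)
    show "?P 0" by (simp add: R_def clinear_0[OF L(1)] row0 clinear_0[OF clinear_pure2_right])
    fix s t assume "s \<in> {t. ?P t}" "t \<in> {t. ?P t}"
    then have "?P s" "?P t" by simp_all
    then show "?P (s + t)"
    proof eventually_elim
      case (elim A)
      have "R A (s + t) = R A s + R A t"
        by (simp add: R_def clinear_add[OF L(1)] row_add pure2_add_right sum.distrib)
      then show ?case using elim by simp
    qed
  next
    fix c t assume "t \<in> {t. ?P t}"
    then have "?P t" by simp
    then show "?P (c *\<^sub>C t)"
    proof eventually_elim
      case (elim A)
      have "R A (c *\<^sub>C t) = c *\<^sub>C R A t"
        by (simp add: R_def clinear_scale[OF L(1)] row_scale pure2_scale_right complex_vector.scale_sum_right)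
      then show ?case using elim by simp
    qed
  qed
  moreover have "f \<otimes> g \<in> {t. ?P t}" if f: "f \<in> colfin p 0" and g: "g \<in> colfin 0 q" for f g
  proof -
    let ?A = "{a. f (a, []) \<noteq> 0}"
    have "f \<otimes> g = R C (f \<otimes> g)" if C: "finite C" "?A \<subseteq> C" "C \<subseteq> {a. length a = p}" for C
    proof -
      have "(\<Sum>a\<in>C. f (a, []) *\<^sub>C unit_matrix a []) =
          (\<Sum>a\<in>C. \<Sum>b\<in>{[]}. f (a, b) *\<^sub>C unit_matrix a b)" by simp
      also have "\<dots> = (\<lambda>(a, b). if a \<in> C \<and> b \<in> {[]} then f (a, b) else 0)"
        by (rule colfin_sum_unit_matrix) (use C in auto)
      also have "\<dots> = f"
      proof (rule ext, clarify)
        fix a b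
        show "(if a \<in> C \<and> b \<in> {[]} then f (a, b) else 0) = f (a, b)"
          using C(2) colfin_length[OF f, of a b] by auto
      qed
      finally have "f \<otimes> g = (\<Sum>a\<in>C. f (a, []) *\<^sub>C unit_matrix a []) \<otimes> g" by simp
      also have "\<dots> = (\<Sum>a\<in>C. f (a, []) *\<^sub>C (unit_matrix a [] \<otimes> g))"
        by (simp add: clinear_sum[OF clinear_pure2_left] pure2_scale_left)
      also have "\<dots> = R C (f \<otimes> g)"
        unfolding R_def L(2)
        by (intro sum.cong refl) (use C(3) in \<open>auto simp: matrix_row_kron[OF g] pure2_scale_right\<close>)
      finally show ?thesis .
    qed
    moreover have "?A \<subseteq> {a. length a = p}" using colfin_length[OF f] by blast
    ultimately show ?thesis
      unfolding mem_Collect_eq eventually_finite_subsets_at_top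
      using colfin_finite[OF f] by (intro exI[of _ ?A]) auto
  qed
  ultimately have "tensor_space (colfin p 0) (colfin 0 q) \<subseteq> {t. ?P t}"
    using tensor_space_subset_iff by blast
  then have "?P t" using t by blast
  then have "eventually (\<lambda>A. t = R A t \<and> finite A \<and> A \<subseteq> {a. length a = p})
      (finite_subsets_at_top {a. length a = p})"
    by (intro eventually_conj) auto
  then obtain A where "t = R A t \<and> finite A \<and> A \<subseteq> {a. length a = p}"
    using eventually_happens'[OF finite_subsets_at_top_neq_bot] by blast
  then show ?thesis using that unfolding R_def by blast
qed

text \<open>An open subspace of the \<open>\<otimes>\<^sup>*\<close> product contains, for each row index \<open>a\<close>, the product of the matrix unit in
  row \<open>a\<close> with the functionals vanishing on some finite set \<open>N a\<close> of columns, and a tensor is the sum of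
  its rows.\<close>

lemma star_rowfin_iso:
  assumes L: "clinear L" "\<And>f g. L (f \<otimes> g) = kron p 0 f g"
  shows "tvs_iso (star_tensor (colfin_topology p 0) (colfin_topology 0 q)) (rowfin_topology p q) L"
proof -
  let ?W = "tensor_space (colfin p 0) (colfin 0 q)"
  let ?S = "star_base (colfin_topology p 0) (colfin_topology 0 q)"
  note lin = is_linear_colfin[of p 0] is_linear_colfin[of 0 q]
  have LW: "L t \<in> rowfin p q" if "t \<in> ?W" for t
    by (rule clinear_tensor_space[OF L(1) subspace_rowfin _ that]) (simp add: L(2) kron_row_rowfin)
  have "inj_on L ?W"
  proof (rule inj_onI)
    fix s t assume st: "s \<in> ?W" "t \<in> ?W" "L s = L t"
    have "s - t \<in> ?W" by (rule csubspace_diff[OF subspace_tensor_space st(1,2)])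
    then obtain A where "s - t = (\<Sum>a\<in>A. unit_matrix a [] \<otimes> matrix_row a (L (s - t)))"
      by (rule tensor_rows[OF L])
    also have "\<dots> = 0"
      by (simp add: clinear_diff[OF L(1)] st(3) clinear_0[OF clinear_matrix_row]
          clinear_0[OF clinear_pure2_right])
    finally show "s = t" by simp
  qed
  moreover have "m \<in> L ` ?W" if m: "m \<in> rowfin p q" for m
  proof -
    let ?A = "{a. \<exists>b. m (a, b) \<noteq> 0}"
    have fin: "finite ?A" by (rule rowfin_finite[OF m])
    have lenA: "length a = p" if "a \<in> ?A" for a using that rowfin_length[OF m] by blast
    define t where "t = (\<Sum>a\<in>?A. unit_matrix a [] \<otimes> matrix_row a m)"
    have "t \<in> ?W"
      unfolding t_def using lenA
      by (intro csubspace_sum[OF subspace_tensor_space] pure2_in_tensor_space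
          unit_matrix_colfin matrix_row_colfin[OF m]) auto
    moreover have "L t = m"
    proof (rule ext)
      fix x :: "nat list \<times> nat list"
      obtain a b where x: "x = (a, b)" by (cases x)
      have "L t x = (\<Sum>a'\<in>?A. kron p 0 (unit_matrix a' []) (matrix_row a' m) (a, b))"
        by (simp add: t_def clinear_sum[OF L(1)] L(2) sum_fun_apply x)
      also have "\<dots> = (\<Sum>a'\<in>?A. if a' = a then m (a, b) else 0)"
      proof (rule sum.cong[OF refl])
        fix a' assume "a' \<in> ?A"
        then have "length a' = p" by (rule lenA)
        then have "take p a = a' \<and> drop p a = [] \<longleftrightarrow> a = a'" by auto
        then show "kron p 0 (unit_matrix a' []) (matrix_row a' m) (a, b) = (if a' = a then m (a, b) else 0)"
          by (auto simp: kron_def unit_matrix_def matrix_row_def)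
      qed
      also have "\<dots> = m x" using fin by (simp add: sum.delta x)
      finally show "L t x = m x" .
    qed
    ultimately show ?thesis by blast
  qed
  ultimately have bij: "bij_betw L ?W (rowfin p q)"
    using LW unfolding bij_betw_def by blast
  have cont: "\<exists>E\<in>?S. L ` E \<subseteq> E'" if E': "E' \<in> rowfin_base p q" for E'
  proof -
    obtain N where N: "E' = rowfin_kernel p q N" "\<forall>a. finite (N a)"
      using E' unfolding rowfin_base_def by blast
    let ?E = "{t \<in> ?W. L t \<in> E'}"
    have s: "csubspace ?E"
      unfolding N
      by (rule subspace_vimage_Int[OF clinear_imp_linear_on[OF L(1)] subspace_tensor_space
            subspace_rowfin_kernel])
    have zero: "f \<otimes> g \<in> ?E" if "f = 0 \<or> g = 0" for f g
      using that csubspace_0[OF s]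
      by (auto simp: clinear_0[OF clinear_pure2_right] clinear_0[OF clinear_pure2_left])
    have "\<exists>Q\<in>open_subspaces (colfin_topology 0 q). \<forall>g\<in>Q. f \<otimes> g \<in> ?E" if f: "f \<in> colfin p 0" for f
    proof (rule bexI)
      let ?F = "\<Union>a\<in>{a. f (a, []) \<noteq> 0}. N a"
      have "finite ?F" using colfin_finite[OF f] N(2) by blast
      then show "colfin_kernel 0 q ?F \<in> open_subspaces (colfin_topology 0 q)"
        by (rule colfin_kernel_open)
      show "\<forall>g\<in>colfin_kernel 0 q ?F. f \<otimes> g \<in> ?E"
      proof
        fix g assume g: "g \<in> colfin_kernel 0 q ?F"
        then have g': "g \<in> colfin 0 q" by (simp add: colfin_kernel_def)
        have "kron p 0 f g (a, b) = 0" if b: "b \<in> N a" for a b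
        proof (rule ccontr)
          assume nz: "kron p 0 f g (a, b) \<noteq> 0"
          then have "length a = p" using kron_length[OF f g'] by auto
          then have "f (a, []) \<noteq> 0" "g ([], b) \<noteq> 0" using nz by (auto simp: kron_def)
          then show False using g b by (auto simp: colfin_kernel_def)
        qed
        then show "f \<otimes> g \<in> ?E"
          using pure2_in_tensor_space[OF f g'] kron_row_rowfin[OF f g']
          by (simp add: L(2) N(1) rowfin_kernel_def)
      qed
    qed
    moreover have "\<exists>P1\<in>open_subspaces (colfin_topology p 0). \<exists>P2\<in>open_subspaces (colfin_topology 0 q).
        tensor_space P1 P2 \<subseteq> ?E"
    proof (intro bexI)
      show "tensor_space {0} (colfin 0 q) \<subseteq> ?E"
        unfolding tensor_space_subset_iff[OF s] using zero by blast
      show "{0} \<in> open_subspaces (colfin_topology p 0)" by (rule zero_open_colfin)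
      show "colfin 0 q \<in> open_subspaces (colfin_topology 0 q)"
        using topspace_open_subspace[OF lin(2)] unfolding topspace_colfin .
    qed
    moreover have "\<exists>Q\<in>open_subspaces (colfin_topology p 0). \<forall>x\<in>Q. x \<otimes> g \<in> ?E" for g
      using zero_open_colfin zero by (intro bexI[of _ "{0}"]) blast+
    ultimately have "?E \<in> ?S"
      unfolding star_base_def topspace_colfin using s by simp
    then show ?thesis by (rule bexI[rotated]) auto
  qed
  have opn: "\<exists>E'\<in>rowfin_base p q. {t \<in> ?W. L t \<in> E'} \<subseteq> E" if E: "E \<in> ?S" for E
  proof -
    have sE: "csubspace E" using E by (simp add: star_base_def)
    have "\<exists>F. finite F \<and> (length a = p \<longrightarrow> (\<forall>g\<in>colfin_kernel 0 q F. unit_matrix a [] \<otimes> g \<in> E))" for a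
    proof (cases "length a = p")
      case True
      then have "unit_matrix a [] \<in> colfin p 0" by (simp add: unit_matrix_colfin)
      then obtain Q where Q: "Q \<in> open_subspaces (colfin_topology 0 q)"
          "\<forall>g\<in>Q. unit_matrix a [] \<otimes> g \<in> E"
        using E unfolding star_base_def topspace_colfin by blast
      then obtain F where "finite F" "colfin_kernel 0 q F \<subseteq> Q"
        unfolding open_subspaces_colfin by blast
      then show ?thesis using Q(2) by blast
    qed blast
    then obtain N where N: "\<And>a. finite (N a)"
        "\<And>a g. length a = p \<Longrightarrow> g \<in> colfin_kernel 0 q (N a) \<Longrightarrow> unit_matrix a [] \<otimes> g \<in> E"
      by metis
    have "t \<in> E" if t: "t \<in> ?W" "L t \<in> rowfin_kernel p q N" for t
    proof -
      obtain A where A: "A \<subseteq> {a. length a = p}"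
          "t = (\<Sum>a\<in>A. unit_matrix a [] \<otimes> matrix_row a (L t))"
        using tensor_rows[OF L t(1)] by blast
      have "matrix_row a (L t) \<in> colfin_kernel 0 q (N a)" for a
        using t(2) matrix_row_colfin[OF LW[OF t(1)], of a]
        by (auto simp: colfin_kernel_def rowfin_kernel_def matrix_row_def)
      then have "(\<Sum>a\<in>A. unit_matrix a [] \<otimes> matrix_row a (L t)) \<in> E"
        using A(1) N(2) by (intro csubspace_sum[OF sE]) auto
      then show ?thesis using A(2) by simp
    qed
    moreover have "rowfin_kernel p q N \<in> rowfin_base p q" using N(1) by (auto simp: rowfin_base_def)
    ultimately show ?thesis by blast
  qed
  have "zero_base ?W ?S" using zero_base_star[OF lin] unfolding topspace_colfin .
  from tvs_iso_zero_baseI[OF this zero_base_rowfin clinear_imp_linear_on[OF L(1)] bij cont opn]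
  show ?thesis unfolding star_tensor_base rowfin_topology_def topspace_colfin .
qed

section \<open>Coordinates\<close>

text \<open>A basis \<open>e\<close> of \<open>X\<close>, indexed by lists, with its dual family \<open>c\<close> of coordinate functionals.\<close>

definition coord_system ::
    "nat \<Rightarrow> 'x::complex_vector set \<Rightarrow> (nat list \<Rightarrow> 'x) \<Rightarrow> (nat list \<Rightarrow> 'x \<Rightarrow> complex) \<Rightarrow> bool" where
  "coord_system p X e c \<longleftrightarrow> X = cspan (e ` {a. length a = p}) \<and>
     (\<forall>a. length a = p \<longrightarrow> clinear (c a)) \<and>
     (\<forall>a b. length a = p \<longrightarrow> length b = p \<longrightarrow> c a (e b) = (if a = b then 1 else 0))"

text \<open>The indices of the basis of \<open>V\<^sub>i\<^sup>\<otimes>\<^sup>q\<close>. These sets exhaust the lists of length \<open>q\<close>, and a finite set of lists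
  is contained in one of them.\<close>

definition box :: "nat \<Rightarrow> nat \<Rightarrow> nat list set" where
  "box q i = {b. length b = q \<and> set b \<subseteq> {..<i}}"

lemma finite_box: "finite (box q i)"
  using finite_lists_length_eq[of "{..<i}" q] by (simp add: box_def conj_commute)

lemma box_length: "box q i \<subseteq> {b. length b = q}"
  by (auto simp: box_def)

lemma box_mono: "i \<le> j \<Longrightarrow> box q i \<subseteq> box q j"
  by (auto simp: box_def)

lemma finite_subset_box:
  assumes "finite G" "G \<subseteq> {b. length b = q}"
  obtains i where "G \<subseteq> box q i"
proof -
  have "finite (\<Union>b\<in>G. set b)" using assms(1) by blast
  then obtain i where "(\<Union>b\<in>G. set b) \<subseteq> {..<i}" using finite_nat_iff_bounded by blast
  then have "G \<subseteq> box q i" using assms(2) by (auto simp: box_def)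
  then show ?thesis using that by blast
qed

context
  fixes p X and e :: "nat list \<Rightarrow> 'x::complex_vector" and c
  assumes sys: "coord_system p X e c"
begin

lemma coord_span: "X = cspan (e ` {a. length a = p})"
  using sys by (simp add: coord_system_def)

lemma subspace_coord: "csubspace X"
  by (simp add: coord_span)

lemma coord_in: "length a = p \<Longrightarrow> e a \<in> X"
  unfolding coord_span by (rule cspan_base) blast

lemma coord_linear: "length a = p \<Longrightarrow> clinear (c a)"
  using sys by (simp add: coord_system_def)

lemma coord_dual: "length a = p \<Longrightarrow> length b = p \<Longrightarrow> c a (e b) = (if a = b then 1 else 0)"
  using sys unfolding coord_system_def by blast

lemma coord_sum:
  assumes A: "finite A" "A \<subseteq> {a. length a = p}" and a: "length a = p"
  shows "c a (\<Sum>b\<in>A. k b *\<^sub>C e b) = (if a \<in> A then k a else 0)"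
proof -
  note lin = coord_linear[OF a]
  have "c a (\<Sum>b\<in>A. k b *\<^sub>C e b) = (\<Sum>b\<in>A. k b * c a (e b))"
    by (simp add: clinear_sum[OF lin] clinear_scale[OF lin])
  also have "\<dots> = (\<Sum>b\<in>A. if b = a then k a else 0)"
    by (intro sum.cong refl) (use A(2) a coord_dual in auto)
  also have "\<dots> = (if a \<in> A then k a else 0)" using A(1) by (simp add: sum.delta)
  finally show ?thesis .
qed

lemma coord_expansion:
  assumes x: "x \<in> X"
  obtains A where "finite A" "A \<subseteq> {a. length a = p}" "x = (\<Sum>a\<in>A. c a x *\<^sub>C e a)"
    "\<And>a. length a = p \<Longrightarrow> a \<notin> A \<Longrightarrow> c a x = 0"
proof -
  let ?L = "{a::nat list. length a = p}"
  have "\<exists>A k. finite A \<and> A \<subseteq> ?L \<and> x = (\<Sum>a\<in>A. k a *\<^sub>C e a)"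
    using x unfolding coord_span
  proof (induction rule: cspan_induct_alt)
    case base
    then show ?case by (intro exI[of _ "{}"]) simp
  next
    case (step s y z)
    then obtain a A k where a: "length a = p" "y = e a" and A: "finite A" "A \<subseteq> ?L"
        "z = (\<Sum>a\<in>A. k a *\<^sub>C e a)" by blast
    let ?k = "\<lambda>b. (if b \<in> A then k b else 0) + (if b = a then s else 0)"
    have "(\<Sum>b\<in>insert a A. ?k b *\<^sub>C e b) =
        (\<Sum>b\<in>insert a A. (if b \<in> A then k b *\<^sub>C e b else 0)) + (\<Sum>b\<in>insert a A. if b = a then s *\<^sub>C e a else 0)"
      unfolding sum.distrib[symmetric] by (intro sum.cong refl) (auto simp: scaleC_add_left)
    also have "(\<Sum>b\<in>insert a A. (if b \<in> A then k b *\<^sub>C e b else 0)) = z"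
      unfolding A(3) using A(1) by (intro sum.mono_neutral_cong_right) auto
    also have "(\<Sum>b\<in>insert a A. if b = a then s *\<^sub>C e a else 0) = s *\<^sub>C y"
      using A(1) by (simp add: sum.delta a(2))
    finally have "s *\<^sub>C y + z = (\<Sum>b\<in>insert a A. ?k b *\<^sub>C e b)" by (simp add: add.commute)
    moreover have "finite (insert a A)" "insert a A \<subseteq> ?L" using a A by auto
    ultimately show ?case by (intro exI[of _ "insert a A"] exI[of _ ?k] conjI)
  qed
  then obtain A k where A: "finite A" "A \<subseteq> ?L" "x = (\<Sum>a\<in>A. k a *\<^sub>C e a)" by blast
  then have k: "c a x = (if a \<in> A then k a else 0)" if "length a = p" for a
    using coord_sum[OF A(1,2) that] by simp
  have "x = (\<Sum>a\<in>A. c a x *\<^sub>C e a)"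
    using A(3)
  proof (rule trans)
    show "(\<Sum>a\<in>A. k a *\<^sub>C e a) = (\<Sum>a\<in>A. c a x *\<^sub>C e a)"
    proof (rule sum.cong[OF refl])
      fix a assume "a \<in> A"
      then show "k a *\<^sub>C e a = c a x *\<^sub>C e a" using A(2) k[of a] by (simp add: subset_eq)
    qed
  qed
  moreover have "c a x = 0" if "length a = p" "a \<notin> A" for a using k[OF that(1)] that(2) by simp
  ultimately show ?thesis using that A(1,2) by blast
qed

lemma coord_finite:
  assumes "x \<in> X" shows "finite {a. length a = p \<and> c a x \<noteq> 0}"
proof -
  obtain A where A: "finite A" "\<And>a. length a = p \<Longrightarrow> a \<notin> A \<Longrightarrow> c a x = 0"
    using coord_expansion[OF assms] by metis
  then show ?thesis by (intro finite_subset[OF _ A(1)]) blast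
qed

lemma coord_eqI:
  assumes "x \<in> X" "y \<in> X" "\<And>a. length a = p \<Longrightarrow> c a x = c a y"
  shows "x = y"
proof -
  have "x - y \<in> X" by (rule csubspace_diff[OF subspace_coord assms(1,2)])
  then obtain A where A: "A \<subseteq> {a. length a = p}" "x - y = (\<Sum>a\<in>A. c a (x - y) *\<^sub>C e a)"
    by (rule coord_expansion)
  have "c a (x - y) = 0" if "a \<in> A" for a
    using that A(1) assms(3)[of a] clinear_diff[OF coord_linear, of a x y] by auto
  then have "x - y = 0" using A(2) by simp
  then show ?thesis by simp
qed

text \<open>The dual family shows that the vectors \<open>e a\<close> are independent: \<open>c a\<close> vanishes on the span of the others.\<close>

lemma coord_extend:
  fixes w :: "nat list \<Rightarrow> 'y::complex_vector"
  obtains g where "clinear g" "\<And>a. length a = p \<Longrightarrow> g (e a) = w a"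
proof -
  let ?L = "{a::nat list. length a = p}"
  have inj: "inj_on e ?L"
  proof (rule inj_onI)
    fix a b assume ab: "a \<in> ?L" "b \<in> ?L" "e a = e b"
    then have "c a (e b) = 1" using coord_dual[of a a] by simp
    then show "a = b" using ab coord_dual[of a b] by (simp split: if_splits)
  qed
  have indep: "\<not> complex_vector.dependent (e ` ?L)"
    unfolding complex_vector.dependent_def
  proof (rule notI, elim bexE)
    fix x assume x: "x \<in> e ` ?L" "x \<in> cspan (e ` ?L - {x})"
    then obtain a where a: "length a = p" "x = e a" by blast
    have "c a y = 0" if "y \<in> e ` ?L - {x}" for y using that a coord_dual by auto
    then have "c a x = 0" using clinear_eq_0_on_span[OF coord_linear[OF a(1)]] x(2) by blast
    then show False using a coord_dual[of a a] by simp
  qed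
  obtain g where g: "clinear g" "\<forall>x\<in>e ` ?L. g x = w (inv_into ?L e x)"
    using complex_vector_pair.linear_independent_extend[OF indep, of "\<lambda>x. w (inv_into ?L e x)"]
    by (elim exE conjE)
  have "g (e a) = w a" if "length a = p" for a
    using g(2) that inv_into_f_f[OF inj, of a] by simp
  then show ?thesis using that g(1) by blast
qed

text \<open>A discrete space with such a basis is the space of its coordinate columns.\<close>

definition column :: "'x \<Rightarrow> matrix" where
  "column x = (\<lambda>(a, b). if length a = p \<and> b = [] then c a x else 0)"

lemma column_iso: "tvs_iso (discrete_topology X) (colfin_topology p 0) column"
proof (rule tvs_isoI)
  show "is_linear_topology (discrete_topology X)" by (rule is_linear_discrete[OF subspace_coord])
  have z: "{0} \<in> open_subspaces (discrete_topology X)"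
    using csubspace_0[OF subspace_coord] by (auto simp: open_subspaces_def)
  have "clinear column"
  proof (rule clinearI)
    fix x y show "column (x + y) = column x + column y"
      by (rule ext) (simp add: column_def clinear_add[OF coord_linear] split: prod.split)
  next
    fix k x show "column (k *\<^sub>C x) = k *\<^sub>C column x"
      by (rule ext) (simp add: column_def clinear_scale[OF coord_linear] split: prod.split)
  qed
  then show lin: "linear_on (topspace (discrete_topology X)) column" by (rule clinear_imp_linear_on)
  have inC: "column x \<in> colfin p 0" if "x \<in> X" for x
  proof -
    have "finite {a. column x (a, b) \<noteq> 0}" for b
      by (rule finite_subset[OF _ coord_finite[OF that]]) (auto simp: column_def)
    then show ?thesis by (auto simp: colfin_def column_def)
  qed
  have "inj_on column X"
  proof (rule inj_onI)
    fix x y assume xy: "x \<in> X" "y \<in> X" "column x = column y"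
    show "x = y"
    proof (rule coord_eqI[OF xy(1,2)])
      fix a :: "nat list" assume "length a = p"
      then show "c a x = c a y" using fun_cong[OF xy(3), of "(a, [])"] by (simp add: column_def)
    qed
  qed
  moreover have "m \<in> column ` X" if m: "m \<in> colfin p 0" for m
  proof -
    let ?A = "{a. m (a, []) \<noteq> 0}"
    have A: "finite ?A" "?A \<subseteq> {a. length a = p}" using colfin_finite[OF m] colfin_length[OF m] by auto
    let ?x = "\<Sum>a\<in>?A. m (a, []) *\<^sub>C e a"
    have "?x \<in> X"
      using A(2) by (intro csubspace_sum[OF subspace_coord]
          csubspace_scale[OF subspace_coord] coord_in) auto
    moreover have "column ?x = m"
    proof (rule ext, clarify)
      fix a b
      show "column ?x (a, b) = m (a, b)"
        using coord_sum[OF A, of a "\<lambda>a. m (a, [])"] colfin_length[OF m, of a b]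
        by (auto simp: column_def)
    qed
    ultimately show ?thesis by (intro image_eqI[of m column ?x]) simp_all
  qed
  ultimately show "bij_betw column (topspace (discrete_topology X)) (topspace (colfin_topology p 0))"
    using inC by (auto simp: topspace_colfin bij_betw_def)
  show "\<exists>E\<in>open_subspaces (discrete_topology X). column ` E \<subseteq> E'"
    if "E' \<in> open_subspaces (colfin_topology p 0)" for E'
    using z linear_on_0[OF lin] subspace_coord
      csubspace_0[OF open_subspaces_subspace[OF that]] by (intro bexI[of _ "{0}"]) auto
  show "\<exists>E'\<in>open_subspaces (colfin_topology p 0). {x \<in> topspace (discrete_topology X). column x \<in> E'} \<subseteq> E"
    if E: "E \<in> open_subspaces (discrete_topology X)" for E
  proof (rule bexI[OF _ zero_open_colfin], rule subsetI)
    fix x assume x: "x \<in> {x \<in> topspace (discrete_topology X). column x \<in> {0}}"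
    have "x = 0"
    proof (rule coord_eqI)
      show "x \<in> X" "0 \<in> X" using x csubspace_0[OF subspace_coord] by auto
      fix a :: "nat list" assume a: "length a = p"
      have "column x (a, []) = 0" using x by simp
      then show "c a x = c a 0" using a by (simp add: column_def clinear_0[OF coord_linear])
    qed
    then show "x \<in> E" using csubspace_0[OF open_subspaces_subspace[OF E]] by simp
  qed
qed (rule is_linear_colfin)

end

subsection \<open>Spaces of linear maps\<close>

lemma Hom_linear: "f \<in> Hom S X \<Longrightarrow> linear_on S f"
  and Hom_in: "f \<in> Hom S X \<Longrightarrow> x \<in> S \<Longrightarrow> f x \<in> X"
  and Hom_off: "f \<in> Hom S X \<Longrightarrow> x \<notin> S \<Longrightarrow> f x = 0"
  by (auto simp: Hom_def)

lemma subspace_Hom: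
  assumes S: "csubspace S" and X: "csubspace X"
  shows "csubspace (Hom S X)"
  unfolding csubspace_def
proof (intro conjI ballI allI)
  show "0 \<in> Hom S X" using csubspace_0[OF X] by (auto simp: Hom_def linear_on_def)
  fix f g assume f: "f \<in> Hom S X" and g: "g \<in> Hom S X"
  show "f + g \<in> Hom S X"
    unfolding Hom_def mem_Collect_eq
  proof (intro conjI)
    show "linear_on S (f + g)"
      using linear_on_add[OF Hom_linear[OF f]] linear_on_add[OF Hom_linear[OF g]]
        linear_on_scale[OF Hom_linear[OF f]] linear_on_scale[OF Hom_linear[OF g]]
      by (simp add: linear_on_def scaleC_add_right)
    show "(f + g) ` S \<subseteq> X"
      using Hom_in[OF f] Hom_in[OF g] csubspace_add[OF X] by auto
  qed (simp add: Hom_off[OF f] Hom_off[OF g])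
next
  fix k f assume f: "f \<in> Hom S X"
  show "k *\<^sub>C f \<in> Hom S X"
    unfolding Hom_def mem_Collect_eq
  proof (intro conjI)
    show "linear_on S (k *\<^sub>C f)"
      using linear_on_add[OF Hom_linear[OF f]] linear_on_scale[OF Hom_linear[OF f]]
      by (simp add: linear_on_def scaleC_add_right scaleC_scaleC mult.commute)
    show "(k *\<^sub>C f) ` S \<subseteq> X"
      using Hom_in[OF f] csubspace_scale[OF X] by auto
  qed (simp add: Hom_off[OF f])
qed

lemma linear_on_zero_on_span:
  assumes f: "linear_on S f" and S: "csubspace S" and A: "A \<subseteq> S"
    and zero: "\<And>x. x \<in> A \<Longrightarrow> f x = 0" and x: "x \<in> cspan A"
  shows "f x = 0"
proof -
  obtain g where g: "clinear g" "\<And>x. x \<in> S \<Longrightarrow> g x = f x" using linear_on_extend[OF f S] by blast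
  have "g x = 0" by (rule clinear_eq_0_on_span[OF g(1) _ x]) (use g(2) zero A in auto)
  moreover have "x \<in> S" using x cspan_minimal[OF A S] by blast
  ultimately show ?thesis using g(2) by simp
qed

lemma Hom_restrict:
  assumes g: "clinear g" and "g ` S \<subseteq> X" and S: "csubspace S"
  shows "(\<lambda>x. if x \<in> S then g x else 0) \<in> Hom S X"
  using assms(1,2) csubspace_add[OF S] csubspace_scale[OF S]
  by (auto simp: Hom_def linear_on_def clinear_add clinear_scale)

text \<open>The basis \<open>e\<close> belongs to the source of the map, the functionals \<open>c\<close> to its target.\<close>

definition hom_matrix ::
    "nat \<Rightarrow> nat \<Rightarrow> (nat list \<Rightarrow> 'x) \<Rightarrow> (nat list \<Rightarrow> 'y \<Rightarrow> complex) \<Rightarrow> ('x \<Rightarrow> 'y) \<Rightarrow> matrix" where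
  "hom_matrix p q e c f = (\<lambda>(a, b). if length a = p \<and> length b = q then c a (f (e b)) else 0)"

lemma zero_base_Hom:
  fixes F :: "nat \<Rightarrow> 'x::complex_vector set" and X :: "'y::complex_vector set"
  assumes S: "csubspace S" and X: "csubspace X"
    and F: "\<And>i j. i \<le> j \<Longrightarrow> F i \<subseteq> F j"
  shows "zero_base (Hom S X) (range (\<lambda>i. {f \<in> Hom S X. \<forall>x\<in>F i. f x = 0}))"
  unfolding zero_base_def
proof (intro conjI ballI subspace_Hom[OF S X])
  fix E assume "E \<in> range (\<lambda>i. {f \<in> Hom S X. \<forall>x\<in>F i. f x = 0})"
  then obtain i where "E = {f \<in> Hom S X. \<forall>x\<in>F i. f x = 0}" by blast
  then show "csubspace E" "E \<subseteq> Hom S X"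
    using subspace_Hom[OF S X] unfolding csubspace_def by auto
next
  fix E E' assume "E \<in> range (\<lambda>i. {f \<in> Hom S X. \<forall>x\<in>F i. f x = 0})"
    "E' \<in> range (\<lambda>i. {f \<in> Hom S X. \<forall>x\<in>F i. f x = 0})"
  then obtain i j where E: "E = {f \<in> Hom S X. \<forall>x\<in>F i. f x = 0}" "E' = {f \<in> Hom S X. \<forall>x\<in>F j. f x = 0}"
    by blast
  have "{f \<in> Hom S X. \<forall>x\<in>F (max i j). f x = 0} \<subseteq> E \<inter> E'"
    unfolding E using F[OF max.cobounded1[of i j]] F[OF max.cobounded2[of j i]] by auto
  then show "\<exists>E''\<in>range (\<lambda>i. {f \<in> Hom S X. \<forall>x\<in>F i. f x = 0}). E'' \<subseteq> E \<inter> E'" by blast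
qed blast

context
  fixes p q :: nat and S :: "'x::complex_vector set" and X :: "'y::complex_vector set"
    and e c e' c' and F :: "nat \<Rightarrow> 'x set"
  assumes S: "coord_system q S e c" and X: "coord_system p X e' c'"
    and F: "\<And>i. F i = cspan (e ` box q i)"
begin

lemma zero_base_Hom_coord: "zero_base (Hom S X) (range (\<lambda>i. {f \<in> Hom S X. \<forall>x\<in>F i. f x = 0}))"
proof (rule zero_base_Hom[OF subspace_coord[OF S] subspace_coord[OF X]])
  show "F i \<subseteq> F j" if "i \<le> j" for i j
    unfolding F by (rule cspan_mono[OF image_mono[OF box_mono[OF that]]])
qed

lemma topspace_Hom: "topspace (Hom_topology S F X) = Hom S X"
  unfolding Hom_topology_def by (rule topspace_zero_base[OF zero_base_Hom_coord])

lemma is_linear_Hom: "is_linear_topology (Hom_topology S F X)"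
  unfolding Hom_topology_def by (rule is_linear_topology_zero_base[OF zero_base_Hom_coord])

lemma hom_matrix_colfin:
  assumes f: "f \<in> Hom S X" shows "hom_matrix p q e c' f \<in> colfin p q"
proof -
  have "finite {a. hom_matrix p q e c' f (a, b) \<noteq> 0}" for b
  proof (cases "length b = q")
    case True
    show ?thesis
      by (rule finite_subset[OF _ coord_finite[OF X Hom_in[OF f coord_in[OF S True]]]])
        (auto simp: hom_matrix_def)
  qed (simp add: hom_matrix_def)
  then show ?thesis by (auto simp: colfin_def hom_matrix_def)
qed

lemma hom_matrix_column_eq_0:
  assumes f: "f \<in> Hom S X" and b: "length b = q" and "\<And>a. hom_matrix p q e c' f (a, b) = 0"
  shows "f (e b) = 0"
proof (rule coord_eqI[OF X Hom_in[OF f coord_in[OF S b]] csubspace_0[OF subspace_coord[OF X]]])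
  fix a :: "nat list" assume a: "length a = p"
  then show "c' a (f (e b)) = c' a 0"
    using assms(3)[of a] b by (simp add: hom_matrix_def clinear_0[OF coord_linear[OF X]])
qed

lemma hom_matrix_inj: "inj_on (hom_matrix p q e c') (Hom S X)"
proof (rule inj_onI)
  fix f g assume fg: "f \<in> Hom S X" "g \<in> Hom S X" "hom_matrix p q e c' f = hom_matrix p q e c' g"
  have h: "f - g \<in> Hom S X"
    by (rule csubspace_diff[OF subspace_Hom[OF subspace_coord[OF S] subspace_coord[OF X]] fg(1,2)])
  have "hom_matrix p q e c' (f - g) (a, b) = hom_matrix p q e c' f (a, b) - hom_matrix p q e c' g (a, b)" for a b
    by (auto simp: hom_matrix_def clinear_diff[OF coord_linear[OF X]])
  then have z: "(f - g) (e b) = 0" if "length b = q" for b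
    using hom_matrix_column_eq_0[OF h that] fg(3) by simp
  have "(f - g) x = 0" if x: "x \<in> S" for x
  proof (rule linear_on_zero_on_span[OF Hom_linear[OF h] subspace_coord[OF S]])
    show "e ` {b. length b = q} \<subseteq> S" using coord_in[OF S] by blast
    show "x \<in> cspan (e ` {b. length b = q})" using x coord_span[OF S] by simp
  qed (use z in auto)
  then have "f x = g x" for x using Hom_off[OF h, of x] by (cases "x \<in> S") auto
  then show "f = g" by (rule ext)
qed

lemma hom_matrix_surj:
  assumes m: "m \<in> colfin p q"
  obtains f where "f \<in> Hom S X" "hom_matrix p q e c' f = m"
proof -
  define w where "w b = (\<Sum>a\<in>{a. m (a, b) \<noteq> 0}. m (a, b) *\<^sub>C e' a)" for b
  have A: "finite {a. m (a, b) \<noteq> 0}" "{a. m (a, b) \<noteq> 0} \<subseteq> {a. length a = p}" for b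
    using colfin_finite[OF m] colfin_length[OF m] by auto
  have wX: "w b \<in> X" for b
    unfolding w_def using A(2)[of b]
    by (intro csubspace_sum[OF subspace_coord[OF X]]
        csubspace_scale[OF subspace_coord[OF X]] coord_in[OF X]) auto
  obtain g where g: "clinear g" "\<And>b. length b = q \<Longrightarrow> g (e b) = w b"
    using coord_extend[OF S, of w] by blast
  have "S \<subseteq> {x. g x \<in> X}"
    unfolding coord_span[OF S] using g(2) wX
    by (intro cspan_minimal subspace_vimage[OF g(1) subspace_coord[OF X]]) auto
  then have f: "(\<lambda>x. if x \<in> S then g x else 0) \<in> Hom S X"
    by (intro Hom_restrict[OF g(1) _ subspace_coord[OF S]]) auto
  have "hom_matrix p q e c' (\<lambda>x. if x \<in> S then g x else 0) = m"
  proof (rule ext, clarify)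
    fix a b
    have "c' a (w b) = m (a, b)" if "length a = p"
      unfolding w_def using coord_sum[OF X A(1)[of b] A(2)[of b] that, of "\<lambda>a. m (a, b)"] by auto
    then show "hom_matrix p q e c' (\<lambda>x. if x \<in> S then g x else 0) (a, b) = m (a, b)"
      using coord_in[OF S, of b] g(2)[of b] colfin_length[OF m, of a b] by (auto simp: hom_matrix_def)
  qed
  then show ?thesis using that f by blast
qed

text \<open>The functions vanishing on the \<open>i\<close>-th step of the filtration are those whose columns in \<open>box q i\<close>
  vanish, and these finite sets of columns are cofinal.\<close>

lemma Hom_iso: "tvs_iso (Hom_topology S F X) (colfin_topology p q) (hom_matrix p q e c')"
  unfolding Hom_topology_def colfin_topology_def
proof (rule tvs_iso_zero_baseI[OF zero_base_Hom_coord zero_base_colfin])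
  have "clinear (hom_matrix p q e c')"
  proof (rule clinearI)
    fix f g :: "'x \<Rightarrow> 'y"
    show "hom_matrix p q e c' (f + g) = hom_matrix p q e c' f + hom_matrix p q e c' g"
      by (rule ext) (simp add: hom_matrix_def clinear_add[OF coord_linear[OF X]] split: prod.split)
  next
    fix k and f :: "'x \<Rightarrow> 'y"
    show "hom_matrix p q e c' (k *\<^sub>C f) = k *\<^sub>C hom_matrix p q e c' f"
      by (rule ext) (simp add: hom_matrix_def clinear_scale[OF coord_linear[OF X]] split: prod.split)
  qed
  then show "linear_on (Hom S X) (hom_matrix p q e c')" by (rule clinear_imp_linear_on)
  have "m \<in> hom_matrix p q e c' ` Hom S X" if "m \<in> colfin p q" for m
    using hom_matrix_surj[OF that] by (metis imageI)
  then show "bij_betw (hom_matrix p q e c') (Hom S X) (colfin p q)"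
    unfolding bij_betw_def using hom_matrix_inj hom_matrix_colfin by blast
  show "\<exists>E\<in>range (\<lambda>i. {f \<in> Hom S X. \<forall>x\<in>F i. f x = 0}). hom_matrix p q e c' ` E \<subseteq> E'"
    if "E' \<in> colfin_base p q" for E'
  proof -
    obtain G where G: "E' = colfin_kernel p q G" "finite G" "G \<subseteq> {b. length b = q}"
      using \<open>E' \<in> colfin_base p q\<close> unfolding colfin_base_def by blast
    obtain i where i: "G \<subseteq> box q i" using finite_subset_box[OF G(2,3)] by blast
    have "hom_matrix p q e c' f \<in> E'" if f: "f \<in> Hom S X" "\<forall>x\<in>F i. f x = 0" for f
    proof -
      have "f (e b) = 0" if "b \<in> G" for b
        using f(2) that i cspan_base[of "e b" "e ` box q i"] unfolding F by blast
      then have "hom_matrix p q e c' f (a, b) = 0" if "b \<in> G" for a b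
        using that by (simp add: hom_matrix_def clinear_0[OF coord_linear[OF X]])
      then show ?thesis using hom_matrix_colfin[OF f(1)] by (simp add: G(1) colfin_kernel_def)
    qed
    then show ?thesis by (intro bexI[of _ "{f \<in> Hom S X. \<forall>x\<in>F i. f x = 0}"]) auto
  qed
  show "\<exists>E'\<in>colfin_base p q. {f \<in> Hom S X. hom_matrix p q e c' f \<in> E'} \<subseteq> E"
    if "E \<in> range (\<lambda>i. {f \<in> Hom S X. \<forall>x\<in>F i. f x = 0})" for E
  proof -
    obtain i where i: "E = {f \<in> Hom S X. \<forall>x\<in>F i. f x = 0}"
      using \<open>E \<in> range (\<lambda>i. {f \<in> Hom S X. \<forall>x\<in>F i. f x = 0})\<close> by blast
    have "f x = 0" if f: "f \<in> Hom S X" "hom_matrix p q e c' f \<in> colfin_kernel p q (box q i)"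
      and x: "x \<in> F i" for f x
    proof (rule linear_on_zero_on_span[OF Hom_linear[OF f(1)] subspace_coord[OF S]])
      show "e ` box q i \<subseteq> S" using coord_in[OF S] box_length by blast
      show "x \<in> cspan (e ` box q i)" using x F by simp
      fix y assume "y \<in> e ` box q i"
      then obtain b where b: "b \<in> box q i" "y = e b" by blast
      then have "length b = q" using box_length by blast
      then show "f y = 0"
        unfolding b(2) by (rule hom_matrix_column_eq_0[OF f(1)])
          (use f(2) b(1) in \<open>auto simp: colfin_kernel_def\<close>)
    qed
    moreover have "colfin_kernel p q (box q i) \<in> colfin_base p q"
      using finite_box box_length unfolding colfin_base_def by blast
    ultimately show ?thesis unfolding i by (intro bexI[of _ "colfin_kernel p q (box q i)"]) auto
  qed
qed

end

subsection \<open>Powers\<close>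

text \<open>The matrix of a pure tensor. The empty product is the matrix of format \<open>(0, 0)\<close> with entry \<open>1\<close>.\<close>

primrec kron_list :: "nat \<Rightarrow> nat \<Rightarrow> matrix list \<Rightarrow> matrix" where
  "kron_list r s [] = unit_matrix [] []"
| "kron_list r s (m # ms) = kron r s m (kron_list r s ms)"

lemma coord_system_complex: "coord_system 0 UNIV (\<lambda>_. 1 :: complex) (\<lambda>_ z. z)"
proof -
  have "z \<in> cspan {1}" for z :: complex
    using cspan_scale[OF cspan_base[of "1::complex" "{1}"], of z] by simp
  moreover have "(\<lambda>_. 1 :: complex) ` {a :: nat list. length a = 0} = {1}" by auto
  moreover have "clinear (\<lambda>z :: complex. z)" by (rule clinearI) auto
  ultimately show ?thesis by (auto simp: coord_system_def)
qed

text \<open>Induction with \<open>completed_shriek_colfin\<close>; the scalars are the matrices of format \<open>(0, 0)\<close>.\<close>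

lemma shriek_power_colfin:
  assumes T: "is_linear_topology T" and \<phi>: "tvs_iso T (colfin_topology r s) \<phi>"
  shows "\<exists>\<Phi>. tvs_iso (shriek_power T n) (colfin_topology (n * r) (n * s)) \<Phi> \<and>
    is_linear_topology (shriek_power T n) \<and>
    (\<forall>ws. length ws = n \<longrightarrow> set ws \<subseteq> topspace T \<longrightarrow>
       shriek_power_pure T ws \<in> topspace (shriek_power T n) \<and>
       \<Phi> (shriek_power_pure T ws) = kron_list r s (map \<phi> ws))"
proof (induction n)
  case 0
  let ?D = "discrete_topology (UNIV :: complex set)"
  have lin: "is_linear_topology ?D" by (rule is_linear_discrete) simp
  let ?col = "column 0 (\<lambda>_ z. z) :: complex \<Rightarrow> matrix"
  have "is_completion ?D (colfin_topology 0 0) ?col"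
    by (rule is_completion_compose_iso[OF column_iso[OF coord_system_complex] lin is_linear_colfin
          is_completion_self[OF is_linear_colfin Hausdorff_colfin complete_colfin]])
  then obtain \<Phi> where \<Phi>: "tvs_iso (completion ?D) (colfin_topology 0 0) \<Phi>"
    "\<And>x. x \<in> topspace ?D \<Longrightarrow> \<Phi> (completion_map ?D x) = ?col x"
    "is_linear_topology (completion ?D)"
    "\<And>x. x \<in> topspace ?D \<Longrightarrow> completion_map ?D x \<in> topspace (completion ?D)"
    using completion_iso_matrix[OF lin] by metis
  have "?col 1 = unit_matrix [] []"
    by (auto simp: column_def[OF coord_system_complex] unit_matrix_def fun_eq_iff)
  then show ?case using \<Phi> by (intro exI[of _ \<Phi>]) simp
next
  case (Suc n)
  then obtain \<Psi> where \<Psi>: "tvs_iso (shriek_power T n) (colfin_topology (n * r) (n * s)) \<Psi>"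
      "is_linear_topology (shriek_power T n)"
    and pure: "\<And>ws. length ws = n \<Longrightarrow> set ws \<subseteq> topspace T \<Longrightarrow>
       shriek_power_pure T ws \<in> topspace (shriek_power T n) \<and>
       \<Psi> (shriek_power_pure T ws) = kron_list r s (map \<phi> ws)" by blast
  obtain \<Phi> where \<Phi>: "tvs_iso (completed_shriek T (shriek_power T n))
      (colfin_topology (r + n * r) (s + n * s)) \<Phi>"
    "\<And>x y. x \<in> topspace T \<Longrightarrow> y \<in> topspace (shriek_power T n) \<Longrightarrow>
      \<Phi> (shriek_pure T (shriek_power T n) x y) = kron r s (\<phi> x) (\<Psi> y)"
    "is_linear_topology (completed_shriek T (shriek_power T n))"
    "\<And>x y. x \<in> topspace T \<Longrightarrow> y \<in> topspace (shriek_power T n) \<Longrightarrow>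
       shriek_pure T (shriek_power T n) x y \<in> topspace (completed_shriek T (shriek_power T n))"
    using completed_shriek_colfin[OF T \<Psi>(2) \<phi> \<Psi>(1)] by metis
  have "shriek_power_pure T ws \<in> topspace (shriek_power T (Suc n)) \<and>
       \<Phi> (shriek_power_pure T ws) = kron_list r s (map \<phi> ws)"
    if ws: "length ws = Suc n" "set ws \<subseteq> topspace T" for ws
  proof -
    obtain w us where us: "ws = w # us" using ws(1) by (cases ws) auto
    then show ?thesis using ws pure[of us] \<Phi>(2,4)[of w "shriek_power_pure T us"] by simp
  qed
  then show ?case using \<Phi>(1,3) by (intro exI[of _ \<Phi>]) simp
qed

text \<open>Completed products depend only on the topology that is completed, so that the iterated products and
  the choices made in them coincide literally.\<close>

lemma star_power_eq_shriek_power: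
  assumes T: "is_linear_topology T"
    and step: "\<And>n. star_tensor T (shriek_power T n) = shriek_tensor T (shriek_power T n)"
  shows "star_power T n = shriek_power T n" "star_power_pure T ws = shriek_power_pure T ws"
proof -
  show eq: "star_power T n = shriek_power T n" for n
    by (induction n) (simp_all add: completed_star_def completed_shriek_def step)
  show "star_power_pure T ws = shriek_power_pure T ws"
    by (induction ws) (simp_all add: eq star_pure_def shriek_pure_def step)
qed

lemma star_power_discrete:
  assumes T: "is_linear_topology T" and \<phi>: "tvs_iso T (colfin_topology r 0) \<phi>"
  shows "star_power T n = shriek_power T n" "star_power_pure T ws = shriek_power_pure T ws"
proof -
  have "star_tensor T (shriek_power T n) = shriek_tensor T (shriek_power T n)" for n
  proof -
    obtain \<Phi> where \<Phi>: "tvs_iso (shriek_power T n) (colfin_topology (n * r) (n * 0)) \<Phi>"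
        "is_linear_topology (shriek_power T n)"
      using shriek_power_colfin[OF T \<phi>, of n] by blast
    show ?thesis
      by (rule star_eq_shriek_discrete[OF T \<Phi>(2) zero_open_iso[OF \<phi> T zero_open_colfin]
            zero_open_iso[OF \<Phi>(1)[unfolded mult_0_right] \<Phi>(2) zero_open_colfin]])
  qed
  then show "star_power T n = shriek_power T n" "star_power_pure T ws = shriek_power_pure T ws"
    using star_power_eq_shriek_power[OF T] by blast+
qed

lemma star_power_cofinite:
  assumes T: "is_linear_topology T" and \<phi>: "tvs_iso T (colfin_topology 0 s) \<phi>"
  shows "star_power T n = shriek_power T n" "star_power_pure T ws = shriek_power_pure T ws"
proof -
  have "star_tensor T (shriek_power T n) = shriek_tensor T (shriek_power T n)" for n
  proof -
    obtain \<Phi> where \<Phi>: "tvs_iso (shriek_power T n) (colfin_topology (n * 0) (n * s)) \<Phi>"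
        "is_linear_topology (shriek_power T n)"
      using shriek_power_colfin[OF T \<phi>, of n] by blast
    show ?thesis
      by (rule star_eq_shriek_cofinite[OF T \<Phi>(2)
            cofinite_topology_iso[OF \<phi> T is_linear_colfin cofinite_colfin]
            cofinite_topology_iso[OF \<Phi>(1)[unfolded mult_0_right] \<Phi>(2) is_linear_colfin cofinite_colfin]])
  qed
  then show "star_power T n = shriek_power T n" "star_power_pure T ws = shriek_power_pure T ws"
    using star_power_eq_shriek_power[OF T] by blast+
qed

subsection \<open>Product functionals on the tensor algebra\<close>

text \<open>The product of the values \<open>f\<^sub>i x\<^sub>i\<close>, by recursion, and zero on lists of another length. This makes it
  defined and multilinear on lists of all lengths, as the universal property of the tensor algebra
  requires.\<close>

fun product_form :: "('a \<Rightarrow> complex) list \<Rightarrow> 'a list \<Rightarrow> complex" where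
  "product_form [] [] = 1"
| "product_form (f # fs) (x # xs) = f x * product_form fs xs"
| "product_form _ _ = 0"

lemma product_form_prod:
  "length xs = length fs \<Longrightarrow> product_form fs xs = (\<Prod>i<length fs. (fs ! i) (xs ! i))"
  by (induction xs fs rule: list_induct2) (simp_all add: prod.lessThan_Suc_shift del: prod.lessThan_Suc)

lemma clinear_product_form:
  "\<forall>f\<in>set fs. clinear f \<Longrightarrow> clinear (\<lambda>a. product_form fs (xs @ a # ys))"
proof (induction fs arbitrary: xs)
  case Nil
  have "product_form [] (xs @ a # ys) = 0" for a :: 'a by (cases xs) auto
  then show ?case by (intro clinearI) simp_all
next
  case (Cons f fs)
  have f: "clinear f" by (rule Cons.prems[rule_format]) simp
  show ?case
  proof (cases xs)
    case Nil
    show ?thesis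
      unfolding Nil by (rule clinearI) (simp_all add: clinear_add[OF f] clinear_scale[OF f] algebra_simps)
  next
    case xs: (Cons x xs')
    have IH: "clinear (\<lambda>a. product_form fs (xs' @ a # ys))"
      by (rule Cons.IH) (use Cons.prems in auto)
    show ?thesis
      unfolding xs
      by (rule clinearI) (simp_all add: clinear_add[OF IH] clinear_scale[OF IH] algebra_simps)
  qed
qed

lemma product_functional:
  assumes "\<forall>f\<in>set fs. clinear f"
  obtains G where "clinear G" "\<And>xs. G (pure xs) = product_form fs xs"
  using tensor_alg_universal[of "product_form fs"] clinear_product_form[OF assms] by blast

lemma pure_in_tensor_power: "set xs \<subseteq> S \<Longrightarrow> length xs = n \<Longrightarrow> pure xs \<in> tensor_power S n"
  unfolding tensor_power_def by (rule cspan_base) blast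

lemma subspace_tensor_power: "csubspace (tensor_power S n)"
  by (simp add: tensor_power_def)

lemma tensor_form_characterization:
  fixes fs :: "('a::complex_vector \<Rightarrow> complex) list"
  assumes "\<forall>f\<in>set fs. clinear f"
  shows "tensor_form fs \<in> Hom (tensor_power UNIV (length fs)) UNIV"
    "length xs = length fs \<Longrightarrow> tensor_form fs (pure xs) = product_form fs xs"
proof -
  let ?P = "\<lambda>g. g \<in> Hom (tensor_power UNIV (length fs)) UNIV \<and>
     (\<forall>xs. length xs = length fs \<longrightarrow> g (pure xs) = (\<Prod>i<length fs. (fs ! i) (xs ! i)))"
  obtain G where G: "clinear G" "\<And>xs. G (pure xs) = product_form fs xs"
    using product_functional[OF assms] by blast
  let ?g = "\<lambda>x. if x \<in> tensor_power UNIV (length fs) then G x else 0"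
  have "?P ?g"
    using Hom_restrict[OF G(1) _ subspace_tensor_power, of UNIV]
    by (auto simp: G(2) product_form_prod pure_in_tensor_power)
  moreover have "g = h" if g: "?P g" and h: "?P h" for g h
  proof -
    have gh: "g - h \<in> Hom (tensor_power UNIV (length fs)) UNIV"
      using csubspace_diff[OF subspace_Hom[OF subspace_tensor_power csubspace_UNIV]]
        conjunct1[OF g] conjunct1[OF h] .
    have "(g - h) x = 0" for x
    proof (cases "x \<in> tensor_power UNIV (length fs)")
      case True
      show ?thesis
      proof (rule linear_on_zero_on_span[OF Hom_linear[OF gh] subspace_tensor_power])
        show "x \<in> cspan {pure xs |xs :: 'a list. length xs = length fs \<and> set xs \<subseteq> UNIV}"
          using True by (simp add: tensor_power_def)
        show "{pure xs |xs :: 'a list. length xs = length fs \<and> set xs \<subseteq> UNIV} \<subseteq> tensor_power UNIV (length fs)"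
          using pure_in_tensor_power[of _ UNIV] by blast
        fix y assume "y \<in> {pure xs |xs :: 'a list. length xs = length fs \<and> set xs \<subseteq> UNIV}"
        then obtain xs where "length xs = length fs" "y = pure xs" by blast
        then show "(g - h) y = 0" using g h by simp
      qed
    qed (rule Hom_off[OF gh])
    then have "g x = h x" for x by simp
    then show "g = h" by (rule ext)
  qed
  ultimately have "\<exists>!g. ?P g" by (intro ex1I[of ?P ?g]) blast+
  then have "?P (tensor_form fs)"
    unfolding tensor_form_def by (rule theI')
  then show "tensor_form fs \<in> Hom (tensor_power UNIV (length fs)) UNIV"
    "length xs = length fs \<Longrightarrow> tensor_form fs (pure xs) = product_form fs xs"
    by (simp_all add: product_form_prod)
qed

lemma pure_in_span:
  assumes "set xs \<subseteq> cspan (v ` N)"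
  shows "pure (map v a @ xs) \<in> cspan
    ((\<lambda>b. pure (map v b)) ` {b. length b = length a + length xs \<and> set b \<subseteq> set a \<union> N})"
  using assms
proof (induction xs arbitrary: a)
  case Nil
  then show ?case by (intro cspan_base) auto
next
  case (Cons x xs)
  let ?Y = "cspan ((\<lambda>b. pure (map v b)) `
      {b. length b = length a + length (x # xs) \<and> set b \<subseteq> set a \<union> N})"
  have "v ` N \<subseteq> {x. pure (map v a @ x # xs) \<in> ?Y}"
  proof
    fix y assume "y \<in> v ` N"
    then obtain n where n: "n \<in> N" "y = v n" by blast
    have "set xs \<subseteq> cspan (v ` N)" using Cons.prems by simp
    from Cons.IH[OF this, of "a @ [n]"]
    have "pure (map v a @ y # xs) \<in> cspan
      ((\<lambda>b. pure (map v b)) ` {b. length b = length (a @ [n]) + length xs \<and> set b \<subseteq> set (a @ [n]) \<union> N})"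
      by (simp add: n(2))
    moreover have "{b. length b = length (a @ [n]) + length xs \<and> set b \<subseteq> set (a @ [n]) \<union> N} =
        {b. length b = length a + length (x # xs) \<and> set b \<subseteq> set a \<union> N}"
      using n(1) by auto
    ultimately show "y \<in> {x. pure (map v a @ x # xs) \<in> ?Y}" by simp
  qed
  then have "cspan (v ` N) \<subseteq> {x. pure (map v a @ x # xs) \<in> ?Y}"
    by (intro cspan_minimal subspace_vimage[OF clinear_pure]) simp_all
  then show ?case using Cons.prems by auto
qed

lemma tensor_power_span:
  "tensor_power (cspan (v ` N)) n =
     cspan ((\<lambda>b. pure (map v b)) ` {b. length b = n \<and> set b \<subseteq> N})"
proof
  show "tensor_power (cspan (v ` N)) n \<subseteq>
      cspan ((\<lambda>b. pure (map v b)) ` {b. length b = n \<and> set b \<subseteq> N})"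
    unfolding tensor_power_def
    using pure_in_span[of _ v N "[]"] by (intro cspan_minimal) auto
  show "cspan ((\<lambda>b. pure (map v b)) ` {b. length b = n \<and> set b \<subseteq> N}) \<subseteq>
      tensor_power (cspan (v ` N)) n"
    by (intro cspan_minimal subspace_tensor_power)
      (auto intro!: pure_in_tensor_power cspan_base imageI)
qed

section \<open>The spaces attached to a countable basis\<close>

text \<open>The evaluation \<open>(x, g) \<mapsto> g (h x)\<close> is bilinear only for functions \<open>g\<close> that are linear. Linear projections of
  the ambient types onto the two subspaces reduce such maps to \<open>tensor_universal\<close>.\<close>

lemma tensor_universal_on:
  fixes \<beta> :: "'a::complex_vector \<Rightarrow> 'b::complex_vector \<Rightarrow> 'c::complex_vector"
  assumes A: "csubspace A" and B: "csubspace B"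
    and left: "\<And>b. b \<in> B \<Longrightarrow> linear_on A (\<lambda>a. \<beta> a b)"
    and right: "\<And>a. a \<in> A \<Longrightarrow> linear_on B (\<lambda>b. \<beta> a b)"
  obtains L where "clinear L" "\<And>a b. a \<in> A \<Longrightarrow> b \<in> B \<Longrightarrow> L (a \<otimes> b) = \<beta> a b"
proof -
  have proj: "\<exists>\<pi>. clinear \<pi> \<and> (\<forall>x\<in>S. \<pi> x = x) \<and> (\<forall>x. \<pi> x \<in> S)"
    if S: "csubspace S" for S :: "'x::complex_vector set"
  proof -
    obtain C where C: "C \<subseteq> S" "complex_vector.independent C" "S \<subseteq> cspan C"
      using complex_vector.basis_exists by metis
    have span: "cspan C = S" using C cspan_minimal[OF C(1) S] by blast
    obtain g where g: "clinear g" "\<forall>x\<in>C. g x = x" "range g = cspan ((\<lambda>x. x) ` C)"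
      using complex_vector_pair.linear_independent_extend_subspace[OF C(2), of "\<lambda>x. x"]
      by (elim exE conjE)
    have id: "clinear (\<lambda>x::'x. x)" by (rule clinearI) auto
    have "g x = x" if "x \<in> S" for x
      using complex_vector_pair.linear_eq_on_span[OF g(1) id, of C x] g(2) that span by auto
    moreover have "g x \<in> S" for x using g(3) span by auto
    ultimately show ?thesis using g(1) by blast
  qed
  obtain \<pi> where \<pi>: "clinear \<pi>" "\<forall>x\<in>A. \<pi> x = x" "\<And>x. \<pi> x \<in> A" using proj[OF A] by blast
  obtain \<rho> where \<rho>: "clinear \<rho>" "\<forall>x\<in>B. \<rho> x = x" "\<And>x. \<rho> x \<in> B" using proj[OF B] by blast
  obtain L where "clinear L" "\<And>x y. L (x \<otimes> y) = \<beta> (\<pi> x) (\<rho> y)"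
  proof (rule tensor_universal)
    show "clinear (\<lambda>x. \<beta> (\<pi> x) (\<rho> y))" for y
      by (rule clinearI) (simp_all add: clinear_add[OF \<pi>(1)] clinear_scale[OF \<pi>(1)]
          linear_on_add[OF left[OF \<rho>(3)]] linear_on_scale[OF left[OF \<rho>(3)]] \<pi>(3))
    show "clinear (\<lambda>y. \<beta> (\<pi> x) (\<rho> y))" for x
      by (rule clinearI) (simp_all add: clinear_add[OF \<rho>(1)] clinear_scale[OF \<rho>(1)]
          linear_on_add[OF right[OF \<pi>(3)]] linear_on_scale[OF right[OF \<pi>(3)]] \<rho>(3))
  qed (use that in blast)
  then show ?thesis using that \<pi>(2) \<rho>(2) by simp
qed

text \<open>If the first factor is discrete, of the three conditions in the definition of \<open>\<otimes>\<^sup>*\<close> only the one on the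
  slices \<open>x \<otimes> -\<close> restricts \<open>E\<close>, the others being satisfied with the open subspace \<open>0\<close>.\<close>

lemma star_base_discrete:
  assumes X: "csubspace X" and T: "is_linear_topology T"
  shows "E \<in> star_base (discrete_topology X) T \<longleftrightarrow>
    csubspace E \<and> E \<subseteq> tensor_space X (topspace T) \<and>
    (\<forall>x\<in>X. \<exists>Q\<in>open_subspaces T. \<forall>y\<in>Q. x \<otimes> y \<in> E)"
proof -
  have z: "{0} \<in> open_subspaces (discrete_topology X)"
    using csubspace_0[OF X] by (auto simp: open_subspaces_def)
  have "0 \<otimes> y \<in> E" if "csubspace E" for y
    using csubspace_0[OF that] by (simp add: clinear_0[OF clinear_pure2_left])
  then have "\<exists>P1\<in>open_subspaces (discrete_topology X). \<exists>P2\<in>open_subspaces T. tensor_space P1 P2 \<subseteq> E"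
    and "\<forall>w\<in>topspace T. \<exists>Q\<in>open_subspaces (discrete_topology X). \<forall>x\<in>Q. x \<otimes> w \<in> E"
    if "csubspace E"
    using that z topspace_open_subspace[OF T] tensor_space_subset_iff[OF that, of "{0}"]
    by (intro bexI[of _ "{0}"] bexI[of _ "topspace T"] ballI; simp)+
  then show ?thesis unfolding star_base_def by auto
qed

lemma open_subspaces_star:
  assumes "is_linear_topology T1" "is_linear_topology T2"
  shows "open_subspaces (star_tensor T1 T2) = star_base T1 T2"
proof -
  have up: "E \<in> star_base T1 T2" if D: "D \<in> star_base T1 T2" and E: "csubspace E"
    "E \<subseteq> tensor_space (topspace T1) (topspace T2)" "D \<subseteq> E" for D E
  proof -
    have "\<exists>P1\<in>open_subspaces T1. \<exists>P2\<in>open_subspaces T2. tensor_space P1 P2 \<subseteq> E"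
      using D E(3) unfolding star_base_def mem_Collect_eq by (elim conjE) (meson subset_trans)
    moreover have "\<forall>w1\<in>topspace T1. \<exists>Q\<in>open_subspaces T2. \<forall>y\<in>Q. w1 \<otimes> y \<in> E"
      using D E(3) unfolding star_base_def mem_Collect_eq by (elim conjE) (meson subsetD)
    moreover have "\<forall>w2\<in>topspace T2. \<exists>Q\<in>open_subspaces T1. \<forall>x\<in>Q. x \<otimes> w2 \<in> E"
      using D E(3) unfolding star_base_def mem_Collect_eq by (elim conjE) (meson subsetD)
    ultimately show ?thesis using E(1,2) unfolding star_base_def by simp
  qed
  have "E \<in> open_subspaces (star_tensor T1 T2) \<longleftrightarrow> E \<in> star_base T1 T2" for E
    unfolding star_tensor_base open_subspaces_zero_base[OF zero_base_star[OF assms]]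
  proof
    assume "E \<in> star_base T1 T2"
    then show "csubspace E \<and> E \<subseteq> tensor_space (topspace T1) (topspace T2) \<and>
        (\<exists>D\<in>star_base T1 T2. D \<subseteq> E)"
      by (intro conjI bexI[of _ E]) (auto simp: star_base_def)
  qed (use up in blast)
  then show ?thesis by blast
qed

locale countable_basis =
  fixes v :: "nat \<Rightarrow> 'v::complex_vector"
  assumes inj: "inj v" and indep: "\<not> complex_vector.dependent (range v)"
    and span: "cspan (range v) = UNIV"
begin

definition crd :: "nat \<Rightarrow> 'v \<Rightarrow> complex" where
  "crd n = (SOME f. clinear f \<and> (\<forall>m. f (v m) = (if m = n then 1 else 0)))"

lemma crd: "clinear (crd n)" "crd n (v m) = (if m = n then 1 else 0)"
proof -
  obtain f :: "'v \<Rightarrow> complex" where f: "clinear f" "\<forall>x\<in>range v. f x = (if x = v n then 1 else 0)"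
    using complex_vector_pair.linear_independent_extend[OF indep, of "\<lambda>x. if x = v n then 1 else 0"]
    by (elim exE conjE)
  have "clinear f \<and> (\<forall>m. f (v m) = (if m = n then 1 else 0))"
    using f inj by (auto simp: inj_eq)
  then have "clinear (crd n) \<and> (\<forall>m. crd n (v m) = (if m = n then 1 else 0))"
    unfolding crd_def
    by (rule someI[where P = "\<lambda>f. clinear f \<and> (\<forall>m. f (v m) = (if m = n then 1 else 0))" and x = f])
  then show "clinear (crd n)" "crd n (v m) = (if m = n then 1 else 0)" by auto
qed

text \<open>The functionals \<open>crd a\<^sub>1 \<otimes> \<dots> \<otimes> crd a\<^sub>n\<close>, which are dual to the basis of \<open>V\<^sup>\<otimes>\<^sup>n\<close>.\<close>

definition tcrd :: "nat list \<Rightarrow> 'v tensor_alg \<Rightarrow> complex" where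
  "tcrd a = (SOME G. clinear G \<and> (\<forall>xs. G (pure xs) = product_form (map crd a) xs))"

lemma tcrd: "clinear (tcrd a)" "tcrd a (pure xs) = product_form (map crd a) xs"
proof -
  have "\<forall>f\<in>set (map crd a). clinear f" using crd(1) by auto
  then obtain G where "clinear G" "\<And>xs. G (pure xs) = product_form (map crd a) xs"
    using product_functional[of "map crd a"] by metis
  then have "clinear (tcrd a) \<and> (\<forall>xs. tcrd a (pure xs) = product_form (map crd a) xs)"
    unfolding tcrd_def
    by (intro someI[where P = "\<lambda>G. clinear G \<and> (\<forall>xs. G (pure xs) = product_form (map crd a) xs)" and x = G])
      simp
  then show "clinear (tcrd a)" "tcrd a (pure xs) = product_form (map crd a) xs" by auto
qed

lemma product_form_crd: "length a = length b \<Longrightarrow> product_form (map crd a) (map v b) = (if a = b then 1 else 0)"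
  by (induction a b rule: list_induct2) (auto simp: crd(2))

lemma singletons: "(\<lambda>b. v (hd b)) ` {b. length b = 1 \<and> set b \<subseteq> N} = v ` N"
proof
  show "v ` N \<subseteq> (\<lambda>b. v (hd b)) ` {b. length b = 1 \<and> set b \<subseteq> N}"
  proof
    fix x assume "x \<in> v ` N"
    then obtain n where "n \<in> N" "x = v n" by blast
    then show "x \<in> (\<lambda>b. v (hd b)) ` {b. length b = 1 \<and> set b \<subseteq> N}"
      by (intro image_eqI[of _ _ "[n]"]) auto
  qed
  show "(\<lambda>b. v (hd b)) ` {b. length b = 1 \<and> set b \<subseteq> N} \<subseteq> v ` N"
    by (auto simp: length_Suc_conv)
qed

lemma coord_V: "coord_system 1 UNIV (\<lambda>b. v (hd b)) (\<lambda>b. crd (hd b))"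
  using singletons[of UNIV] span by (auto simp: coord_system_def crd length_Suc_conv)

lemma flag_box: "flag v i = cspan ((\<lambda>b. v (hd b)) ` box 1 i)"
  unfolding flag_def box_def singletons ..

lemma coord_power: "coord_system n (tensor_power UNIV n) (\<lambda>b. pure (map v b)) tcrd"
proof -
  have "tensor_power UNIV n = cspan ((\<lambda>b. pure (map v b)) ` {b. length b = n})"
    using tensor_power_span[of v UNIV n] span by simp
  then show ?thesis by (simp add: coord_system_def tcrd product_form_crd)
qed

lemma power_flag_box: "tensor_power (flag v i) n = cspan ((\<lambda>b. pure (map v b)) ` box n i)"
  unfolding flag_def box_def by (rule tensor_power_span)

lemma pure_basis_in: "length b = n \<Longrightarrow> pure (map v b) \<in> tensor_power UNIV n"
  by (rule pure_in_tensor_power) auto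

subsection \<open>The powers of the space and of its dual in coordinates\<close>

abbreviation "V_top \<equiv> (discrete_topology UNIV :: 'v topology)"
abbreviation "V_column \<equiv> column 1 (\<lambda>b. crd (hd b)) :: 'v \<Rightarrow> matrix"
abbreviation "dual_row \<equiv> hom_matrix 0 1 (\<lambda>b. v (hd b)) (\<lambda>_ z. z) :: ('v \<Rightarrow> complex) \<Rightarrow> matrix"

lemma is_linear_V: "is_linear_topology V_top"
  by (rule is_linear_discrete) simp

lemma is_linear_dual: "is_linear_topology (dual_topology v)"
  unfolding dual_topology_def by (rule is_linear_Hom[OF coord_V coord_system_complex flag_box])

lemma topspace_dual: "f \<in> topspace (dual_topology v) \<longleftrightarrow> clinear f"
proof -
  have "linear_on UNIV f \<longleftrightarrow> clinear f"
    using clinear_imp_linear_on[of f UNIV] clinearI[of f] unfolding linear_on_def by blast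
  then show ?thesis
    unfolding dual_topology_def topspace_Hom[OF coord_V coord_system_complex flag_box] Hom_def by simp
qed

lemma dual_iso: "tvs_iso (dual_topology v) (colfin_topology 0 1) dual_row"
  unfolding dual_topology_def by (rule Hom_iso[OF coord_V coord_system_complex flag_box])

lemma take_drop_1: "take 1 (x # xs) = [x]" "drop 1 (x # xs) = xs"
  by simp_all

lemma kron_list_V:
  "kron_list 1 0 (map V_column ws) =
     (\<lambda>(a, b). if length a = length ws \<and> b = [] then product_form (map crd a) ws else 0)"
proof (induction ws)
  case Nil
  show ?case by (auto simp: unit_matrix_def fun_eq_iff)
next
  case (Cons w ws)
  show ?case
  proof (rule ext, clarify)
    fix a b
    show "kron_list 1 0 (map V_column (w # ws)) (a, b) =
      (if length a = length (w # ws) \<and> b = [] then product_form (map crd a) (w # ws) else 0)"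
      by (cases a) (simp_all add: Cons.IH kron_def column_def[OF coord_V] take_drop_1 del: One_nat_def)
  qed
qed

lemma kron_list_dual:
  "kron_list 0 1 (map dual_row fs) =
     (\<lambda>(a, b). if a = [] \<and> length b = length fs then product_form fs (map v b) else 0)"
proof (induction fs)
  case Nil
  show ?case by (auto simp: unit_matrix_def fun_eq_iff)
next
  case (Cons f fs)
  show ?case
  proof (rule ext, clarify)
    fix a b
    show "kron_list 0 1 (map dual_row (f # fs)) (a, b) =
      (if a = [] \<and> length b = length (f # fs) then product_form (f # fs) (map v b) else 0)"
      by (cases b) (simp_all add: Cons.IH kron_def hom_matrix_def take_drop_1 del: One_nat_def)
  qed
qed

text \<open>The map \<open>x \<mapsto> (f\<^sub>1 \<otimes> \<dots> \<otimes> f\<^sub>q)(x) v\<^sub>1 \<otimes> \<dots> \<otimes> v\<^sub>p\<close> in coordinates.\<close>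

definition pure_matrix :: "'v list \<Rightarrow> ('v \<Rightarrow> complex) list \<Rightarrow> matrix" where
  "pure_matrix vs fs = (\<lambda>(a, b). if length a = length vs \<and> length b = length fs
     then product_form (map crd a) vs * product_form fs (map v b) else 0)"

lemma kron_pure_matrix:
  "kron (length vs) 0 (kron_list 1 0 (map V_column vs)) (kron_list 0 1 (map dual_row fs)) = pure_matrix vs fs"
proof (rule ext, clarify)
  fix a b :: "nat list"
  show "kron (length vs) 0 (kron_list 1 0 (map V_column vs)) (kron_list 0 1 (map dual_row fs)) (a, b) =
      pure_matrix vs fs (a, b)"
    unfolding kron_list_V kron_list_dual by (auto simp: kron_def pure_matrix_def)
qed

lemma V_power:
  "\<exists>\<Phi>. tvs_iso (shriek_power V_top p) (colfin_topology p 0) \<Phi> \<and>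
    is_linear_topology (shriek_power V_top p) \<and>
    (\<forall>ws. length ws = p \<longrightarrow> shriek_power_pure V_top ws \<in> topspace (shriek_power V_top p) \<and>
       \<Phi> (shriek_power_pure V_top ws) = kron_list 1 0 (map V_column ws))"
  using shriek_power_colfin[OF is_linear_V column_iso[OF coord_V], of p] by simp

lemma dual_power:
  "\<exists>\<Phi>. tvs_iso (shriek_power (dual_topology v) q) (colfin_topology 0 q) \<Phi> \<and>
    is_linear_topology (shriek_power (dual_topology v) q) \<and>
    (\<forall>fs. length fs = q \<longrightarrow> set fs \<subseteq> topspace (dual_topology v) \<longrightarrow>
       shriek_power_pure (dual_topology v) fs \<in> topspace (shriek_power (dual_topology v) q) \<and>
       \<Phi> (shriek_power_pure (dual_topology v) fs) = kron_list 0 1 (map dual_row fs))"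
  using shriek_power_colfin[OF is_linear_dual dual_iso, of q] by simp

lemma completed_shriek_pure_matrix:
  obtains \<Phi> where "tvs_iso (completed_shriek (shriek_power V_top p) (shriek_power (dual_topology v) q))
      (colfin_topology p q) \<Phi>"
    "\<And>vs fs. length vs = p \<Longrightarrow> length fs = q \<Longrightarrow> set fs \<subseteq> topspace (dual_topology v) \<Longrightarrow>
      \<Phi> (shriek_pure (shriek_power V_top p) (shriek_power (dual_topology v) q)
          (shriek_power_pure V_top vs) (shriek_power_pure (dual_topology v) fs)) = pure_matrix vs fs"
proof -
  obtain \<Phi>1 where \<Phi>1: "tvs_iso (shriek_power V_top p) (colfin_topology p 0) \<Phi>1"
    "is_linear_topology (shriek_power V_top p)"
    "\<And>ws. length ws = p \<Longrightarrow> shriek_power_pure V_top ws \<in> topspace (shriek_power V_top p) \<and>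
       \<Phi>1 (shriek_power_pure V_top ws) = kron_list 1 0 (map V_column ws)"
    using V_power[of p] by blast
  obtain \<Phi>2 where \<Phi>2: "tvs_iso (shriek_power (dual_topology v) q) (colfin_topology 0 q) \<Phi>2"
    "is_linear_topology (shriek_power (dual_topology v) q)"
    "\<And>fs. length fs = q \<Longrightarrow> set fs \<subseteq> topspace (dual_topology v) \<Longrightarrow>
       shriek_power_pure (dual_topology v) fs \<in> topspace (shriek_power (dual_topology v) q) \<and>
       \<Phi>2 (shriek_power_pure (dual_topology v) fs) = kron_list 0 1 (map dual_row fs)"
    using dual_power[of q] by blast
  obtain \<Phi> where \<Phi>: "tvs_iso (completed_shriek (shriek_power V_top p) (shriek_power (dual_topology v) q))
      (colfin_topology (p + 0) (0 + q)) \<Phi>"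
    "\<And>x y. x \<in> topspace (shriek_power V_top p) \<Longrightarrow> y \<in> topspace (shriek_power (dual_topology v) q) \<Longrightarrow>
       \<Phi> (shriek_pure (shriek_power V_top p) (shriek_power (dual_topology v) q) x y) = kron p 0 (\<Phi>1 x) (\<Phi>2 y)"
    using completed_shriek_colfin[OF \<Phi>1(2) \<Phi>2(2) \<Phi>1(1) \<Phi>2(1)] by metis
  show ?thesis
  proof (rule that)
    show "tvs_iso (completed_shriek (shriek_power V_top p) (shriek_power (dual_topology v) q))
      (colfin_topology p q) \<Phi>" using \<Phi>(1) by simp
    fix vs :: "'v list" and fs :: "('v \<Rightarrow> complex) list"
    assume "length vs = p" "length fs = q" "set fs \<subseteq> topspace (dual_topology v)"
    then show "\<Phi> (shriek_pure (shriek_power V_top p) (shriek_power (dual_topology v) q)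
          (shriek_power_pure V_top vs) (shriek_power_pure (dual_topology v) fs)) = pure_matrix vs fs"
      using \<Phi>(2) \<Phi>1(3)[of vs] \<Phi>2(3)[of fs] kron_pure_matrix[of vs fs] by simp
  qed
qed

subsection \<open>The mixed tensor powers\<close>

lemma is_linear_dual_power: "is_linear_topology (dual_power_topology v n)"
  unfolding dual_power_topology_def by (rule is_linear_Hom[OF coord_power coord_system_complex power_flag_box])

lemma topspace_dual_power: "topspace (dual_power_topology v n) = Hom (tensor_power UNIV n) UNIV"
  unfolding dual_power_topology_def by (rule topspace_Hom[OF coord_power coord_system_complex power_flag_box])

abbreviation "power_row n \<equiv> hom_matrix 0 n (\<lambda>b. pure (map v b)) (\<lambda>_ z. z) :: ('v tensor_alg \<Rightarrow> complex) \<Rightarrow> matrix"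

lemma dual_power_iso: "tvs_iso (dual_power_topology v n) (colfin_topology 0 n) (power_row n)"
  unfolding dual_power_topology_def by (rule Hom_iso[OF coord_power coord_system_complex power_flag_box])

text \<open>The next two lemmas describe a base at zero of \<open>(V\<^sup>\<otimes>\<^sup>n)\<^sup>*\<close> by finitely many basis vectors of \<open>V\<^sup>\<otimes>\<^sup>n\<close>.\<close>

lemma open_dual_powerD:
  assumes "P \<in> open_subspaces (dual_power_topology v n)"
  obtains G where "finite G" "G \<subseteq> {b. length b = n}"
    "\<And>g. g \<in> topspace (dual_power_topology v n) \<Longrightarrow> (\<And>b. b \<in> G \<Longrightarrow> g (pure (map v b)) = 0) \<Longrightarrow> g \<in> P"
proof -
  have "\<exists>D\<in>range (\<lambda>i. {f \<in> Hom (tensor_power UNIV n) UNIV. \<forall>x\<in>tensor_power (flag v i) n. f x = 0}). D \<subseteq> P"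
    using assms unfolding dual_power_topology_def Hom_topology_def
      open_subspaces_zero_base[OF zero_base_Hom_coord[OF coord_power coord_system_complex power_flag_box]]
    by (elim conjE)
  then have "\<exists>i. {f \<in> Hom (tensor_power UNIV n) UNIV. \<forall>x\<in>tensor_power (flag v i) n. f x = 0} \<subseteq> P"
    by simp
  then obtain i where i: "{f \<in> Hom (tensor_power UNIV n) UNIV. \<forall>x\<in>tensor_power (flag v i) n. f x = 0} \<subseteq> P" ..
  have "g \<in> P" if g: "g \<in> topspace (dual_power_topology v n)"
    and z: "\<And>b. b \<in> box n i \<Longrightarrow> g (pure (map v b)) = 0" for g
  proof -
    have g': "g \<in> Hom (tensor_power UNIV n) UNIV" using g topspace_dual_power by simp
    have "g x = 0" if x: "x \<in> tensor_power (flag v i) n" for x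
    proof (rule linear_on_zero_on_span[OF Hom_linear[OF g'] subspace_tensor_power])
      show "(\<lambda>b. pure (map v b)) ` box n i \<subseteq> tensor_power UNIV n"
        using pure_basis_in box_length by blast
      show "x \<in> cspan ((\<lambda>b. pure (map v b)) ` box n i)"
        using x power_flag_box by simp
    qed (use z in auto)
    then show ?thesis using i g' by blast
  qed
  then show ?thesis using that[OF finite_box box_length, of i] by blast
qed

lemma open_dual_powerI:
  assumes G: "finite G" "G \<subseteq> {b. length b = n}"
  shows "{g \<in> topspace (dual_power_topology v n). \<forall>b\<in>G. g (pure (map v b)) = 0}
    \<in> open_subspaces (dual_power_topology v n)"
proof -
  obtain i where i: "G \<subseteq> box n i" using finite_subset_box[OF G] by blast
  show ?thesis
  proof (rule open_subspaceI[OF is_linear_dual_power])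
  have s: "csubspace (topspace (dual_power_topology v n))"
    by (rule subspace_topspace[OF is_linear_dual_power])
  show "csubspace {g \<in> topspace (dual_power_topology v n). \<forall>b\<in>G. g (pure (map v b)) = 0}"
    using s unfolding csubspace_def by auto
  show "{f \<in> Hom (tensor_power UNIV n) UNIV. \<forall>x\<in>tensor_power (flag v i) n. f x = 0}
      \<in> open_subspaces (dual_power_topology v n)"
    unfolding dual_power_topology_def Hom_topology_def
    by (rule zero_base_open[OF zero_base_Hom_coord[OF coord_power coord_system_complex power_flag_box]]) blast
  have "pure (map v b) \<in> tensor_power (flag v i) n" if "b \<in> G" for b
    unfolding power_flag_box using that i by (intro cspan_base) blast
  then show "{f \<in> Hom (tensor_power UNIV n) UNIV. \<forall>x\<in>tensor_power (flag v i) n. f x = 0}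
      \<subseteq> {g \<in> topspace (dual_power_topology v n). \<forall>b\<in>G. g (pure (map v b)) = 0}"
    unfolding topspace_dual_power by blast
  qed blast
qed

lemma tensor_power_exhausted:
  assumes "x \<in> tensor_power UNIV n"
  obtains i where "x \<in> tensor_power (flag v i) n"
proof -
  obtain A where A: "finite A" "A \<subseteq> {a. length a = n}" "x = (\<Sum>a\<in>A. tcrd a x *\<^sub>C pure (map v a))"
    using coord_expansion[OF coord_power assms] by metis
  obtain i where i: "A \<subseteq> box n i" using finite_subset_box[OF A(1,2)] by blast
  have "(\<Sum>a\<in>A. tcrd a x *\<^sub>C pure (map v a)) \<in> tensor_power (flag v i) n"
    unfolding power_flag_box
    by (intro cspan_sum cspan_scale cspan_base) (use i in blast)
  then show ?thesis using that A(3) by simp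
qed

text \<open>Openness in the inductive limit asks, for every \<open>i\<close>, for one open subspace \<open>P\<close> with \<open>V\<^sub>i\<^sup>\<otimes>\<^sup>p \<otimes> P\<close> in \<open>E\<close>;
  openness for \<open>\<otimes>\<^sup>*\<close> asks, for every \<open>x\<close>, for one with \<open>x \<otimes> P\<close> in \<open>E\<close>. These agree, as \<open>V\<^sub>i\<^sup>\<otimes>\<^sup>p\<close> has a finite
  basis and every \<open>x\<close> lies in some \<open>V\<^sub>i\<^sup>\<otimes>\<^sup>p\<close>.\<close>

lemma mixed_eq_star:
  "mixed_topology v p q = star_tensor (discrete_topology (tensor_power UNIV p)) (dual_power_topology v q)"
proof -
  let ?D = "dual_power_topology v q"
  let ?W = "tensor_space (tensor_power UNIV p) (topspace ?D)"
  have step: "openin (mixed_step v p q i) (E \<inter> topspace (mixed_step v p q i)) \<longleftrightarrow>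
      (\<exists>P\<in>open_subspaces ?D. tensor_space (tensor_power (flag v i) p) P \<subseteq> E)"
    if E: "csubspace E" for i E
  proof -
    let ?V = "tensor_power (flag v i) p"
    let ?B = "{tensor_space ?V P |P. P \<in> open_subspaces ?D}"
    have base: "zero_base (tensor_space ?V (topspace ?D)) ?B"
      unfolding zero_base_def
    proof (intro conjI ballI subspace_tensor_space)
      show "?B \<noteq> {}" using topspace_open_subspace[OF is_linear_dual_power] by blast
      fix F assume "F \<in> ?B"
      then obtain P where P: "P \<in> open_subspaces ?D" "F = tensor_space ?V P" by blast
      show "csubspace F" unfolding P(2) by (rule subspace_tensor_space)
      show "F \<subseteq> tensor_space ?V (topspace ?D)"
        unfolding P(2) by (rule tensor_space_mono[OF subset_refl open_subspaces_subset[OF P(1)]])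
    next
      fix F F' assume "F \<in> ?B" "F' \<in> ?B"
      then obtain P P' where P: "P \<in> open_subspaces ?D" "P' \<in> open_subspaces ?D"
          "F = tensor_space ?V P" "F' = tensor_space ?V P'" by blast
      have "tensor_space ?V (P \<inter> P') \<subseteq> F \<inter> F'"
        unfolding P(3,4)
        using tensor_space_mono[OF subset_refl Int_lower1] tensor_space_mono[OF subset_refl Int_lower2] by blast
      moreover have "tensor_space ?V (P \<inter> P') \<in> ?B" using open_subspaces_Int[OF P(1,2)] by blast
      ultimately show "\<exists>F''\<in>?B. F'' \<subseteq> F \<inter> F'" by blast
    qed
    have top: "topspace (mixed_step v p q i) = tensor_space ?V (topspace ?D)"
      unfolding mixed_step_def by (rule topspace_zero_base[OF base])
    have "openin (mixed_step v p q i) (E \<inter> tensor_space ?V (topspace ?D)) \<longleftrightarrow>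
        E \<inter> tensor_space ?V (topspace ?D) \<in> open_subspaces (mixed_step v p q i)"
      using csubspace_inter[OF E subspace_tensor_space[of ?V "topspace ?D"]]
      by (simp add: open_subspaces_def)
    also have "\<dots> \<longleftrightarrow> (\<exists>P\<in>open_subspaces ?D. tensor_space ?V P \<subseteq> E \<inter> tensor_space ?V (topspace ?D))"
      unfolding mixed_step_def open_subspaces_zero_base[OF base]
      using csubspace_inter[OF E subspace_tensor_space[of ?V "topspace ?D"]] by blast
    also have "\<dots> \<longleftrightarrow> (\<exists>P\<in>open_subspaces ?D. tensor_space ?V P \<subseteq> E)"
      using tensor_space_mono[OF subset_refl[of ?V] open_subspaces_subset[of _ ?D]] by auto
    finally show ?thesis unfolding top .
  qed
  have "(\<forall>i. \<exists>P\<in>open_subspaces ?D. tensor_space (tensor_power (flag v i) p) P \<subseteq> E) \<longleftrightarrow>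
      (\<forall>x\<in>tensor_power UNIV p. \<exists>Q\<in>open_subspaces ?D. \<forall>y\<in>Q. x \<otimes> y \<in> E)"
    (is "?l \<longleftrightarrow> ?r") if E: "csubspace E" for E
  proof
    assume l: ?l
    show ?r
    proof
      fix x :: "'v tensor_alg" assume "x \<in> tensor_power UNIV p"
      then obtain i where i: "x \<in> tensor_power (flag v i) p" by (rule tensor_power_exhausted)
      obtain P where P: "P \<in> open_subspaces ?D" "tensor_space (tensor_power (flag v i) p) P \<subseteq> E"
        using l by blast
      have "\<forall>y\<in>P. x \<otimes> y \<in> E" using P(2) pure2_in_tensor_space[OF i] by blast
      then show "\<exists>Q\<in>open_subspaces ?D. \<forall>y\<in>Q. x \<otimes> y \<in> E" using P(1) by (rule bexI)
    qed
  next
    assume r: ?r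
    show ?l
    proof
      fix i
      have "\<exists>Q\<in>open_subspaces ?D. \<forall>y\<in>Q. \<forall>b\<in>box p i. pure (map v b) \<otimes> y \<in> E"
      proof (rule open_subspace_finite_Inter[OF finite_box is_linear_dual_power])
        fix b assume "b \<in> box p i"
        then have "pure (map v b) \<in> tensor_power UNIV p" by (intro pure_basis_in) (simp add: box_def)
        then show "\<exists>Q\<in>open_subspaces ?D. \<forall>y\<in>Q. pure (map v b) \<otimes> y \<in> E" by (rule r[rule_format])
      qed
      then obtain Q where Q: "Q \<in> open_subspaces ?D" "\<forall>y\<in>Q. \<forall>b\<in>box p i. pure (map v b) \<otimes> y \<in> E"
        by blast
      have "x \<otimes> y \<in> E" if x: "x \<in> tensor_power (flag v i) p" and y: "y \<in> Q" for x y
      proof -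
        have "cspan ((\<lambda>b. pure (map v b)) ` box p i) \<subseteq> {x. x \<otimes> y \<in> E}"
          using Q(2) y by (intro cspan_minimal subspace_vimage[OF clinear_pure2_left E]) auto
        then show ?thesis using x power_flag_box by blast
      qed
      then have "tensor_space (tensor_power (flag v i) p) Q \<subseteq> E"
        unfolding tensor_space_subset_iff[OF E] by blast
      then show "\<exists>P\<in>open_subspaces ?D. tensor_space (tensor_power (flag v i) p) P \<subseteq> E" using Q(1) by (rule bexI)
    qed
  qed
  then have "{E. csubspace E \<and> E \<subseteq> ?W \<and>
        (\<forall>i. openin (mixed_step v p q i) (E \<inter> topspace (mixed_step v p q i)))} =
      star_base (discrete_topology (tensor_power UNIV p)) ?D"
    using step star_base_discrete[OF subspace_tensor_power is_linear_dual_power, of _ "UNIV :: 'v set" p q]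
    by (intro set_eqI) (simp cong: conj_cong)
  then show ?thesis unfolding mixed_topology_def star_tensor_base topspace_discrete_topology by simp
qed

end

context countable_basis
begin

lemma column_pure:
  assumes "length ws = p"
  shows "column p tcrd (pure ws) = kron_list 1 0 (map V_column ws)"
  unfolding kron_list_V column_def[OF coord_power] using assms by (auto simp: tcrd(2) fun_eq_iff)

lemma power_row_tensor_form:
  assumes "length fs = q" "set fs \<subseteq> topspace (dual_topology v)"
  shows "tensor_form fs \<in> topspace (dual_power_topology v q)"
    "power_row q (tensor_form fs) = kron_list 0 1 (map dual_row fs)"
proof -
  have fs: "\<forall>f\<in>set fs. clinear f" using assms(2) topspace_dual by blast
  show "tensor_form fs \<in> topspace (dual_power_topology v q)"
    using tensor_form_characterization(1)[OF fs] assms(1) by (simp add: topspace_dual_power)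
  show "power_row q (tensor_form fs) = kron_list 0 1 (map dual_row fs)"
    unfolding kron_list_dual hom_matrix_def
    using assms(1) by (auto simp: tensor_form_characterization(2)[OF fs] fun_eq_iff)
qed

text \<open>The uncompleted \<open>\<otimes>\<^sup>*\<close> product of the two powers is isomorphic both to the mixed tensor power and to the
  complete space of matrices with finitely many non-zero rows; so the map to its completion is an
  isomorphism.\<close>

lemma star_product_iso:
  "\<exists>\<phi>. tvs_iso (completed_star (star_power V_top p) (star_power (dual_topology v) q)) (mixed_topology v p q) \<phi> \<and>
    (\<forall>vs fs. length vs = p \<and> length fs = q \<and> set fs \<subseteq> topspace (dual_topology v) \<longrightarrow>
       \<phi> (star_pure (star_power V_top p) (star_power (dual_topology v) q)
            (star_power_pure V_top vs) (star_power_pure (dual_topology v) fs)) = pure vs \<otimes> tensor_form fs)"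
proof -
  let ?T1 = "shriek_power V_top p" and ?T2 = "shriek_power (dual_topology v) q"
  let ?D1 = "discrete_topology (tensor_power UNIV p) :: 'v tensor_alg topology"
    and ?D2 = "dual_power_topology v q"
  obtain \<Phi>1 where \<Phi>1: "tvs_iso ?T1 (colfin_topology p 0) \<Phi>1" "is_linear_topology ?T1"
    "\<And>ws. length ws = p \<Longrightarrow> shriek_power_pure V_top ws \<in> topspace ?T1 \<and>
       \<Phi>1 (shriek_power_pure V_top ws) = kron_list 1 0 (map V_column ws)"
    using V_power[of p] by blast
  obtain \<Phi>2 where \<Phi>2: "tvs_iso ?T2 (colfin_topology 0 q) \<Phi>2" "is_linear_topology ?T2"
    "\<And>fs. length fs = q \<Longrightarrow> set fs \<subseteq> topspace (dual_topology v) \<Longrightarrow>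
       shriek_power_pure (dual_topology v) fs \<in> topspace ?T2 \<and>
       \<Phi>2 (shriek_power_pure (dual_topology v) fs) = kron_list 0 1 (map dual_row fs)"
    using dual_power[of q] by blast
  have lin1: "is_linear_topology ?D1" by (rule is_linear_discrete[OF subspace_tensor_power])
  obtain \<chi>1 where \<chi>1: "tvs_iso (colfin_topology p 0) ?D1 \<chi>1"
      "\<And>x. x \<in> topspace ?D1 \<Longrightarrow> \<chi>1 (column p tcrd x) = x"
    using tvs_iso_inverse[OF column_iso[OF coord_power] lin1] by metis
  obtain \<chi>2 where \<chi>2: "tvs_iso (colfin_topology 0 q) ?D2 \<chi>2"
      "\<And>x. x \<in> topspace ?D2 \<Longrightarrow> \<chi>2 (power_row q x) = x"
    using tvs_iso_inverse[OF dual_power_iso is_linear_dual_power] by metis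
  have \<alpha>: "tvs_iso ?T1 ?D1 (\<lambda>x. \<chi>1 (\<Phi>1 x))" by (rule tvs_iso_compose[OF \<Phi>1(1) \<chi>1(1)])
  have \<beta>: "tvs_iso ?T2 ?D2 (\<lambda>x. \<chi>2 (\<Phi>2 x))" by (rule tvs_iso_compose[OF \<Phi>2(1) \<chi>2(1)])
  obtain \<Theta> where \<Theta>: "tvs_iso (star_tensor ?T1 ?T2) (star_tensor ?D1 ?D2) \<Theta>"
    "\<And>x y. x \<in> topspace ?T1 \<Longrightarrow> y \<in> topspace ?T2 \<Longrightarrow> \<Theta> (x \<otimes> y) = \<chi>1 (\<Phi>1 x) \<otimes> \<chi>2 (\<Phi>2 y)"
    using tensor_iso[OF \<Phi>1(2) \<Phi>2(2) lin1 is_linear_dual_power \<alpha> \<beta>] by metis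
  obtain L where L: "clinear L" "\<And>f g. L (f \<otimes> g) = kron p 0 f g" using kron_lift by blast
  obtain \<Xi> where \<Xi>: "tvs_iso (star_tensor ?T1 ?T2) (star_tensor (colfin_topology p 0) (colfin_topology 0 q)) \<Xi>"
    using tensor_iso[OF \<Phi>1(2) \<Phi>2(2) is_linear_colfin is_linear_colfin \<Phi>1(1) \<Phi>2(1)] by metis
  note lin = is_linear_star[OF \<Phi>1(2) \<Phi>2(2)]
  have \<kappa>: "tvs_iso (star_tensor ?T1 ?T2) (rowfin_topology p q) (\<lambda>t. L (\<Xi> t))"
    by (rule tvs_iso_compose[OF \<Xi> star_rowfin_iso[OF L]])
  have c: "is_completion (star_tensor ?T1 ?T2) (rowfin_topology p q) (\<lambda>t. L (\<Xi> t))"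
    by (rule is_completion_compose_iso[OF \<kappa> lin is_linear_rowfin
          is_completion_self[OF is_linear_rowfin Hausdorff_rowfin complete_rowfin]])
  obtain \<Phi> where \<Phi>: "tvs_iso (completion (star_tensor ?T1 ?T2)) (rowfin_topology p q) \<Phi>"
    "\<And>t. t \<in> topspace (star_tensor ?T1 ?T2) \<Longrightarrow>
       \<Phi> (completion_map (star_tensor ?T1 ?T2) t) = L (\<Xi> t)"
    using completion_iso_matrix[OF lin c] by metis
  obtain \<kappa>' where \<kappa>': "tvs_iso (rowfin_topology p q) (star_tensor ?T1 ?T2) \<kappa>'"
      "\<And>t. t \<in> topspace (star_tensor ?T1 ?T2) \<Longrightarrow> \<kappa>' (L (\<Xi> t)) = t"
    using tvs_iso_inverse[OF \<kappa> lin] by metis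
  have "tvs_iso (completion (star_tensor ?T1 ?T2)) (star_tensor ?D1 ?D2) (\<lambda>x. \<Theta> (\<kappa>' (\<Phi> x)))"
    by (rule tvs_iso_compose[OF tvs_iso_compose[OF \<Phi>(1) \<kappa>'(1)] \<Theta>(1)])
  moreover have "\<Theta> (\<kappa>' (\<Phi> (completion_map (star_tensor ?T1 ?T2)
      (shriek_power_pure V_top vs \<otimes> shriek_power_pure (dual_topology v) fs)))) = pure vs \<otimes> tensor_form fs"
    if vs: "length vs = p" and fs: "length fs = q" "set fs \<subseteq> topspace (dual_topology v)" for vs fs
  proof -
    let ?x = "shriek_power_pure V_top vs" and ?y = "shriek_power_pure (dual_topology v) fs"
    have x: "?x \<in> topspace ?T1" "\<Phi>1 ?x = column p tcrd (pure vs)"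
      using \<Phi>1(3)[OF vs] column_pure[OF vs] by auto
    have y: "?y \<in> topspace ?T2" "\<Phi>2 ?y = power_row q (tensor_form fs)"
      using \<Phi>2(3)[OF fs] power_row_tensor_form(2)[OF fs] by auto
    have t: "?x \<otimes> ?y \<in> topspace (star_tensor ?T1 ?T2)"
      unfolding topspace_star[OF \<Phi>1(2) \<Phi>2(2)] by (rule pure2_in_tensor_space[OF x(1) y(1)])
    have "pure vs \<in> topspace ?D1" using vs by (simp add: pure_in_tensor_power)
    then have "\<Theta> (?x \<otimes> ?y) = pure vs \<otimes> tensor_form fs"
      unfolding \<Theta>(2)[OF x(1) y(1)] x(2) y(2)
      using \<chi>1(2) \<chi>2(2) power_row_tensor_form(1)[OF fs] by simp
    then show ?thesis by (simp only: \<Phi>(2)[OF t] \<kappa>'(2)[OF t])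
  qed
  ultimately show ?thesis
    unfolding star_power_discrete[OF is_linear_V column_iso[OF coord_V]]
      star_power_cofinite[OF is_linear_dual dual_iso] completed_star_def star_pure_def mixed_eq_star
    by (intro exI[of _ "\<lambda>x. \<Theta> (\<kappa>' (\<Phi> x))"]) blast
qed

subsection \<open>The continuous dual of a mixed tensor power\<close>

abbreviation "dual_space n \<equiv> topspace (dual_power_topology v n)"

lemma subspace_dual_space: "csubspace (dual_space n)"
  by (rule subspace_topspace[OF is_linear_dual_power])

lemma is_linear_mixed: "is_linear_topology (mixed_topology v p q)"
  unfolding mixed_eq_star
  by (rule is_linear_star[OF is_linear_discrete[OF subspace_tensor_power] is_linear_dual_power])

lemma topspace_mixed: "topspace (mixed_topology v p q) = tensor_space (tensor_power UNIV p) (dual_space q)"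
  unfolding mixed_eq_star
  using topspace_star[OF is_linear_discrete[OF subspace_tensor_power] is_linear_dual_power] by simp

lemma open_subspaces_mixed:
  "E \<in> open_subspaces (mixed_topology v p q) \<longleftrightarrow>
    csubspace E \<and> E \<subseteq> tensor_space (tensor_power UNIV p) (dual_space q) \<and>
    (\<forall>x\<in>tensor_power UNIV p. \<exists>Q\<in>open_subspaces (dual_power_topology v q). \<forall>y\<in>Q. x \<otimes> y \<in> E)"
  unfolding mixed_eq_star
    open_subspaces_star[OF is_linear_discrete[OF subspace_tensor_power] is_linear_dual_power]
  by (rule star_base_discrete[OF subspace_tensor_power is_linear_dual_power])

text \<open>A functional is continuous if and only if its kernel is open, which by \<open>star_base_discrete\<close> is a
  condition on each slice \<open>x \<otimes> -\<close>.\<close>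

lemma continuous_dual_iff:
  "l \<in> continuous_dual (mixed_topology v q p) \<longleftrightarrow>
    l \<in> Hom (tensor_space (tensor_power UNIV q) (dual_space p)) UNIV \<and>
    (\<forall>x\<in>tensor_power UNIV q. \<exists>P\<in>open_subspaces (dual_power_topology v p). \<forall>g\<in>P. l (x \<otimes> g) = 0)"
    (is "?l \<longleftrightarrow> ?r")
proof
  let ?M = "mixed_topology v q p" and ?W = "tensor_space (tensor_power UNIV q) (dual_space p)"
  {
    assume l: ?l
    then have H: "l \<in> Hom ?W UNIV" by (simp add: continuous_dual_def topspace_mixed)
    let ?K = "{t \<in> ?W. l t \<in> {0}}"
    have "\<forall>U. openin ?M {t \<in> ?W. l t \<in> U}"
      using l unfolding continuous_dual_def continuous_map_def topspace_mixed by simp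
    then have "openin ?M ?K" by (rule spec)
    moreover have "csubspace ?K"
      by (rule subspace_vimage_Int[OF Hom_linear[OF H] subspace_tensor_space]) simp
    ultimately have K: "?K \<in> open_subspaces ?M" by (simp add: open_subspaces_def)
    have "\<exists>P\<in>open_subspaces (dual_power_topology v p). \<forall>g\<in>P. l (x \<otimes> g) = 0"
      if x: "x \<in> tensor_power UNIV q" for x
    proof -
      obtain Q where Q: "Q \<in> open_subspaces (dual_power_topology v p)" "\<forall>y\<in>Q. x \<otimes> y \<in> ?K"
        using K x unfolding open_subspaces_mixed by blast
      show ?thesis by (rule bexI[OF _ Q(1)]) (use Q(2) in simp)
    qed
    then show ?r using H by blast
  next
    assume r: ?r
    then have H: "l \<in> Hom ?W UNIV" by blast
    let ?K = "{t \<in> ?W. l t \<in> {0}}"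
    have s: "csubspace ?K"
      by (rule subspace_vimage_Int[OF Hom_linear[OF H] subspace_tensor_space]) simp
    have "\<exists>Q\<in>open_subspaces (dual_power_topology v p). \<forall>y\<in>Q. x \<otimes> y \<in> ?K"
      if x: "x \<in> tensor_power UNIV q" for x
    proof -
      obtain P where P: "P \<in> open_subspaces (dual_power_topology v p)" "\<forall>g\<in>P. l (x \<otimes> g) = 0"
        using r x by blast
      have "x \<otimes> y \<in> ?K" if "y \<in> P" for y
        using P(2) that pure2_in_tensor_space[OF x, of y "dual_space p"] open_subspaces_subset[OF P(1)] by blast
      then show ?thesis using P(1) by blast
    qed
    then have K: "?K \<in> open_subspaces ?M"
      unfolding open_subspaces_mixed using s by blast
    have "openin ?M {t \<in> ?W. l t \<in> U}" for U
      unfolding openin_iff_cosets[OF is_linear_mixed]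
    proof (intro conjI ballI)
      show "{t \<in> ?W. l t \<in> U} \<subseteq> topspace ?M" by (auto simp: topspace_mixed)
      fix t assume t: "t \<in> {t \<in> ?W. l t \<in> U}"
      have "t + k \<in> {t \<in> ?W. l t \<in> U}" if "k \<in> ?K" for k
        using t that linear_on_add[OF Hom_linear[OF H], of t k]
          csubspace_add[OF subspace_tensor_space, of t _ _ k] by simp
      then show "\<exists>E\<in>open_subspaces ?M. (+) t ` E \<subseteq> {t \<in> ?W. l t \<in> U}" using K by blast
    qed
    then show ?l
      using H unfolding continuous_dual_def continuous_map_def topspace_mixed by simp
  }
qed

text \<open>The functional \<open>tcrd a\<close> as an element of \<open>Hom\<close>, that is, extended by zero.\<close>

definition dcrd :: "nat \<Rightarrow> nat list \<Rightarrow> 'v tensor_alg \<Rightarrow> complex" where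
  "dcrd n a = (\<lambda>x. if x \<in> tensor_power UNIV n then tcrd a x else 0)"

lemma dcrd_in: "dcrd n a \<in> dual_space n"
  unfolding topspace_dual_power dcrd_def by (rule Hom_restrict[OF tcrd(1) _ subspace_tensor_power]) simp

lemma dcrd_basis: "length a = n \<Longrightarrow> length b = n \<Longrightarrow> dcrd n a (pure (map v b)) = (if a = b then 1 else 0)"
  using pure_basis_in[of b n] by (simp add: dcrd_def tcrd(2) product_form_crd)

text \<open>The column \<open>b\<close> is the vector of \<open>V\<^sup>\<otimes>\<^sup>p\<close> representing the continuous functional \<open>l (v\<^sub>b \<otimes> -)\<close> on \<open>(V\<^sup>\<otimes>\<^sup>p)\<^sup>*\<close>.\<close>

definition mixed_matrix ::
    "nat \<Rightarrow> nat \<Rightarrow> (('v tensor_alg, 'v tensor_alg \<Rightarrow> complex) tensor \<Rightarrow> complex) \<Rightarrow> matrix" where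
  "mixed_matrix p q l = (\<lambda>(a, b). if length a = p \<and> length b = q
     then l (pure (map v b) \<otimes> dcrd p a) else 0)"

context
  fixes p q :: nat and l
  assumes l: "l \<in> continuous_dual (mixed_topology v q p)"
begin

lemma functional_Hom: "l \<in> Hom (tensor_space (tensor_power UNIV q) (dual_space p)) UNIV"
  using l continuous_dual_iff by blast

lemma functional_right:
  assumes "x \<in> tensor_power UNIV q" shows "linear_on (dual_space p) (\<lambda>g. l (x \<otimes> g))"
  using linear_on_add[OF Hom_linear[OF functional_Hom]] linear_on_scale[OF Hom_linear[OF functional_Hom]]
    pure2_in_tensor_space[OF assms, of _ "dual_space p"]
  by (simp add: linear_on_def pure2_add_right pure2_scale_right)

lemma functional_left:
  assumes "g \<in> dual_space p" shows "linear_on (tensor_power UNIV q) (\<lambda>x. l (x \<otimes> g))"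
  using linear_on_add[OF Hom_linear[OF functional_Hom]] linear_on_scale[OF Hom_linear[OF functional_Hom]]
    pure2_in_tensor_space[OF _ assms, of _ "tensor_power UNIV q :: 'v tensor_alg set"]
  by (simp add: linear_on_def pure2_add_left pure2_scale_left)

lemma functional_kernel:
  assumes "x \<in> tensor_power UNIV q"
  obtains G where "finite G" "G \<subseteq> {a. length a = p}"
    "\<And>g. g \<in> dual_space p \<Longrightarrow> (\<And>a. a \<in> G \<Longrightarrow> g (pure (map v a)) = 0) \<Longrightarrow> l (x \<otimes> g) = 0"
proof -
  obtain P where P: "P \<in> open_subspaces (dual_power_topology v p)" "\<forall>g\<in>P. l (x \<otimes> g) = 0"
    using l assms continuous_dual_iff by blast
  obtain G where "finite G" "G \<subseteq> {b. length b = p}"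
    "\<And>g. g \<in> dual_space p \<Longrightarrow> (\<And>b. b \<in> G \<Longrightarrow> g (pure (map v b)) = 0) \<Longrightarrow> g \<in> P"
    using open_dual_powerD[OF P(1)] by metis
  then show ?thesis using that P(2) by blast
qed

lemma mixed_matrix_colfin: "mixed_matrix p q l \<in> colfin p q"
proof -
  have "finite {a. mixed_matrix p q l (a, b) \<noteq> 0}" for b
  proof (cases "length b = q")
    case True
    obtain G where G: "finite G" "G \<subseteq> {a. length a = p}"
      "\<And>g. g \<in> dual_space p \<Longrightarrow> (\<And>a. a \<in> G \<Longrightarrow> g (pure (map v a)) = 0) \<Longrightarrow> l (pure (map v b) \<otimes> g) = 0"
      using functional_kernel[OF pure_basis_in[OF True]] by metis
    have "l (pure (map v b) \<otimes> dcrd p a) = 0" if "length a = p" "a \<notin> G" for a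
      by (rule G(3)[OF dcrd_in]) (use that G(2) dcrd_basis[of a p] in auto)
    then have "{a. mixed_matrix p q l (a, b) \<noteq> 0} \<subseteq> G" by (auto simp: mixed_matrix_def)
    then show ?thesis using G(1) finite_subset by blast
  qed (simp add: mixed_matrix_def)
  then show ?thesis by (auto simp: colfin_def mixed_matrix_def)
qed

text \<open>By continuity \<open>l (v\<^sub>b \<otimes> g)\<close> depends only on the values of \<open>g\<close> at finitely many basis vectors, so \<open>g\<close> may be
  replaced by a finite combination of the functionals \<open>dcrd p a\<close>.\<close>

lemma mixed_matrix_column_eq_0:
  assumes b: "length b = q" and z: "\<And>a. mixed_matrix p q l (a, b) = 0" and g: "g \<in> dual_space p"
  shows "l (pure (map v b) \<otimes> g) = 0"
proof -
  let ?x = "pure (map v b)"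
  note x = pure_basis_in[OF b]
  obtain G where G: "finite G" "G \<subseteq> {a. length a = p}"
    "\<And>g. g \<in> dual_space p \<Longrightarrow> (\<And>a. a \<in> G \<Longrightarrow> g (pure (map v a)) = 0) \<Longrightarrow> l (?x \<otimes> g) = 0"
    using functional_kernel[OF x] by metis
  obtain h where h: "clinear h" "\<And>g. g \<in> dual_space p \<Longrightarrow> h g = l (?x \<otimes> g)"
    using linear_on_extend[OF functional_right[OF x] subspace_dual_space] by metis
  let ?s = "\<Sum>a\<in>G. g (pure (map v a)) *\<^sub>C dcrd p a"
  have s: "?s \<in> dual_space p"
    by (intro csubspace_sum[OF subspace_dual_space]
        csubspace_scale[OF subspace_dual_space] dcrd_in)
  have "h (dcrd p a) = 0" if "a \<in> G" for a
    using z[of a] that G(2) b h(2)[OF dcrd_in] by (auto simp: mixed_matrix_def)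
  then have "h ?s = 0" by (simp add: clinear_sum[OF h(1)] clinear_scale[OF h(1)])
  moreover have "l (?x \<otimes> (g - ?s)) = 0"
  proof (rule G(3)[OF csubspace_diff[OF subspace_dual_space g s]])
    fix a assume a: "a \<in> G"
    have "?s (pure (map v a)) = (\<Sum>a'\<in>G. if a' = a then g (pure (map v a)) else 0)"
      unfolding sum_fun_apply
    proof (rule sum.cong[OF refl])
      fix a' assume "a' \<in> G"
      then have "length a' = p" "length a = p" using a G(2) by auto
      then show "(g (pure (map v a')) *\<^sub>C dcrd p a') (pure (map v a)) =
          (if a' = a then g (pure (map v a)) else 0)"
        by (simp add: dcrd_basis)
    qed
    also have "\<dots> = g (pure (map v a))" using G(1) a by (simp add: sum.delta)
    finally show "(g - ?s) (pure (map v a)) = 0" by simp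
  qed
  ultimately have "h g = 0"
    using h(2)[OF csubspace_diff[OF subspace_dual_space g s]] by (simp add: clinear_diff[OF h(1)])
  then show ?thesis using h(2)[OF g] by simp
qed

lemma functional_eq_0_on_span:
  assumes B: "B \<subseteq> {b. length b = q}" and z: "\<And>a b. b \<in> B \<Longrightarrow> mixed_matrix p q l (a, b) = 0"
    and g: "g \<in> dual_space p" and x: "x \<in> cspan ((\<lambda>b. pure (map v b)) ` B)"
  shows "l (x \<otimes> g) = 0"
proof (rule linear_on_zero_on_span[OF functional_left[OF g] subspace_tensor_power _ _ x])
  show "(\<lambda>b. pure (map v b)) ` B \<subseteq> tensor_power UNIV q" using B pure_basis_in by blast
  fix y assume "y \<in> (\<lambda>b. pure (map v b)) ` B"
  then obtain b where b: "b \<in> B" "y = pure (map v b)" by blast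
  then show "l (y \<otimes> g) = 0" using mixed_matrix_column_eq_0[OF _ z g] B by blast
qed

end

lemma subspace_continuous_dual: "csubspace (continuous_dual (mixed_topology v q p))"
  unfolding csubspace_def
proof (intro conjI ballI allI)
  let ?W = "tensor_space (tensor_power UNIV q) (dual_space p)"
  have H: "csubspace (Hom ?W (UNIV :: complex set))"
    by (rule subspace_Hom[OF subspace_tensor_space csubspace_UNIV])
  show "0 \<in> continuous_dual (mixed_topology v q p)"
    unfolding continuous_dual_iff
    using csubspace_0[OF H] topspace_open_subspace[OF is_linear_dual_power] by auto
  fix l m assume l: "l \<in> continuous_dual (mixed_topology v q p)" and m: "m \<in> continuous_dual (mixed_topology v q p)"
  have "\<exists>P\<in>open_subspaces (dual_power_topology v p). \<forall>g\<in>P. (l + m) (x \<otimes> g) = 0"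
    if x: "x \<in> tensor_power UNIV q" for x
  proof -
    obtain P where P: "P \<in> open_subspaces (dual_power_topology v p)" "\<forall>g\<in>P. l (x \<otimes> g) = 0"
      using l x continuous_dual_iff by blast
    obtain Q where Q: "Q \<in> open_subspaces (dual_power_topology v p)" "\<forall>g\<in>Q. m (x \<otimes> g) = 0"
      using m x continuous_dual_iff by blast
    show ?thesis by (rule bexI[OF _ open_subspaces_Int[OF P(1) Q(1)]]) (use P(2) Q(2) in auto)
  qed
  then show "l + m \<in> continuous_dual (mixed_topology v q p)"
    unfolding continuous_dual_iff
    using csubspace_add[OF H functional_Hom[OF l] functional_Hom[OF m]] by blast
next
  fix c l assume l: "l \<in> continuous_dual (mixed_topology v q p)"
  have "\<exists>P\<in>open_subspaces (dual_power_topology v p). \<forall>g\<in>P. (c *\<^sub>C l) (x \<otimes> g) = 0"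
    if x: "x \<in> tensor_power UNIV q" for x
  proof -
    obtain P where P: "P \<in> open_subspaces (dual_power_topology v p)" "\<forall>g\<in>P. l (x \<otimes> g) = 0"
      using l x continuous_dual_iff by blast
    show ?thesis by (rule bexI[OF _ P(1)]) (use P(2) in auto)
  qed
  then show "c *\<^sub>C l \<in> continuous_dual (mixed_topology v q p)"
    unfolding continuous_dual_iff
    using csubspace_scale[OF subspace_Hom[OF subspace_tensor_space csubspace_UNIV]
        functional_Hom[OF l]] by blast
qed

lemma mixed_matrix_inj: "inj_on (mixed_matrix p q) (continuous_dual (mixed_topology v q p))"
proof (rule inj_onI)
  fix l m assume lm: "l \<in> continuous_dual (mixed_topology v q p)" "m \<in> continuous_dual (mixed_topology v q p)"
    "mixed_matrix p q l = mixed_matrix p q m"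
  have d: "l - m \<in> continuous_dual (mixed_topology v q p)"
    by (rule csubspace_diff[OF subspace_continuous_dual lm(1,2)])
  have "mixed_matrix p q (l - m) (a, b) = mixed_matrix p q l (a, b) - mixed_matrix p q m (a, b)" for a b
    by (simp add: mixed_matrix_def)
  then have z: "mixed_matrix p q (l - m) (a, b) = 0" for a b using lm(3) by simp
  have z0: "(l - m) (x \<otimes> g) = 0" if x: "x \<in> tensor_power UNIV q" and g: "g \<in> dual_space p" for x g
    by (rule functional_eq_0_on_span[OF d subset_refl z g]) (use x coord_span[OF coord_power] in simp)
  have "(l - m) t = 0" if "t \<in> tensor_space (tensor_power UNIV q) (dual_space p)" for t
  proof (rule linear_on_zero_on_span[OF Hom_linear[OF functional_Hom[OF d]] subspace_tensor_space])
    show "t \<in> cspan {x \<otimes> g |x g. x \<in> (tensor_power UNIV q :: 'v tensor_alg set) \<and> g \<in> dual_space p}"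
      using that unfolding tensor_space_def .
    show "{x \<otimes> g |x g. x \<in> (tensor_power UNIV q :: 'v tensor_alg set) \<and> g \<in> dual_space p}
        \<subseteq> tensor_space (tensor_power UNIV q) (dual_space p)"
      using pure2_in_tensor_space[of _ "tensor_power UNIV q :: 'v tensor_alg set" _ "dual_space p"] by blast
    fix t assume "t \<in> {x \<otimes> g |x g. x \<in> (tensor_power UNIV q :: 'v tensor_alg set) \<and> g \<in> dual_space p}"
    then obtain x g where "x \<in> tensor_power UNIV q" "g \<in> dual_space p" "t = x \<otimes> g" by blast
    then show "(l - m) t = 0" using z0 by blast
  qed
  then have "(l - m) t = 0" for t using Hom_off[OF functional_Hom[OF d]] by blast
  then show "l = m" by (simp add: fun_eq_iff)
qed

text \<open>A linear map \<open>h\<close> from \<open>V\<^sup>\<otimes>\<^sup>q\<close> to \<open>V\<^sup>\<otimes>\<^sup>p\<close> defines the continuous functional \<open>x \<otimes> g \<mapsto> g (h x)\<close>.\<close>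

lemma functional_of_Hom:
  assumes h: "h \<in> Hom (tensor_power UNIV q) (tensor_power UNIV p)"
  obtains l where "l \<in> continuous_dual (mixed_topology v q p)"
    "\<And>x g. x \<in> tensor_power UNIV q \<Longrightarrow> g \<in> dual_space p \<Longrightarrow> l (x \<otimes> g) = g (h x)"
    "mixed_matrix p q l = hom_matrix p q (\<lambda>b. pure (map v b)) tcrd h"
proof -
  let ?W = "tensor_space (tensor_power UNIV q) (dual_space p)"
  have dual: "g \<in> Hom (tensor_power UNIV p) UNIV" if "g \<in> dual_space p" for g
    using that topspace_dual_power by simp
  obtain L where L: "clinear L"
    "\<And>x g. x \<in> tensor_power UNIV q \<Longrightarrow> g \<in> dual_space p \<Longrightarrow> L (x \<otimes> g) = g (h x)"
  proof (rule tensor_universal_on[OF subspace_tensor_power[of UNIV q] subspace_dual_space[of p],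
        where \<beta> = "\<lambda>x g. g (h x)"])
    show "linear_on (tensor_power UNIV q) (\<lambda>x. g (h x))" if g: "g \<in> dual_space p" for g
      using linear_on_add[OF Hom_linear[OF h]] linear_on_scale[OF Hom_linear[OF h]] Hom_in[OF h]
        linear_on_add[OF Hom_linear[OF dual[OF g]]] linear_on_scale[OF Hom_linear[OF dual[OF g]]]
      by (simp add: linear_on_def)
    show "linear_on (dual_space p) (\<lambda>g. g (h x))" for x by (simp add: linear_on_def)
  qed (use that in blast)
  let ?l = "\<lambda>t. if t \<in> ?W then L t else 0"
  have val: "?l (x \<otimes> g) = g (h x)" if "x \<in> tensor_power UNIV q" "g \<in> dual_space p" for x g
    using L(2)[OF that] pure2_in_tensor_space[OF that] by simp
  have ker: "\<exists>P\<in>open_subspaces (dual_power_topology v p). \<forall>g\<in>P. ?l (x \<otimes> g) = 0"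
    if x: "x \<in> tensor_power UNIV q" for x
  proof -
    obtain A where A: "finite A" "A \<subseteq> {a. length a = p}" "h x = (\<Sum>a\<in>A. tcrd a (h x) *\<^sub>C pure (map v a))"
      using coord_expansion[OF coord_power Hom_in[OF h x]] by metis
    have "?l (x \<otimes> g) = 0" if g: "g \<in> dual_space p" "\<forall>a\<in>A. g (pure (map v a)) = 0" for g
    proof -
      have "g (h x) = 0"
      proof (rule linear_on_zero_on_span[OF Hom_linear[OF dual[OF g(1)]] subspace_tensor_power])
        show "(\<lambda>a. pure (map v a)) ` A \<subseteq> tensor_power UNIV p" using A(2) pure_basis_in by blast
        show "h x \<in> cspan ((\<lambda>a. pure (map v a)) ` A)"
          by (subst A(3), intro cspan_sum cspan_scale cspan_base) blast
      qed (use g(2) in auto)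
      then show ?thesis using val[OF x g(1)] by simp
    qed
    then show ?thesis by (intro bexI[OF _ open_dual_powerI[OF A(1,2)]]) blast
  qed
  have l: "?l \<in> continuous_dual (mixed_topology v q p)"
    unfolding continuous_dual_iff
  proof (intro conjI ballI ker)
    show "?l \<in> Hom ?W UNIV" by (rule Hom_restrict[OF L(1) _ subspace_tensor_space]) simp
  qed
  have "mixed_matrix p q ?l = hom_matrix p q (\<lambda>b. pure (map v b)) tcrd h"
  proof (rule ext, clarify)
    fix a b
    show "mixed_matrix p q ?l (a, b) = hom_matrix p q (\<lambda>b. pure (map v b)) tcrd h (a, b)"
    proof (cases "length a = p \<and> length b = q")
      case True
      then have b: "pure (map v b) \<in> tensor_power UNIV q" by (simp add: pure_basis_in)
      show ?thesis
        unfolding mixed_matrix_def hom_matrix_def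
        using True val[OF b dcrd_in] Hom_in[OF h b] by (simp add: dcrd_def)
    qed (auto simp: mixed_matrix_def hom_matrix_def)
  qed
  then show ?thesis using that[OF l val] by blast
qed

lemma zero_base_completed_mixed:
  "zero_base (continuous_dual (mixed_topology v q p))
     (range (\<lambda>i. {l \<in> continuous_dual (mixed_topology v q p).
          \<forall>x\<in>tensor_power (flag v i) q. \<forall>g\<in>dual_space p. l (x \<otimes> g) = 0}))"
  (is "zero_base ?C (range ?K)")
  unfolding zero_base_def
proof (intro conjI ballI subspace_continuous_dual)
  fix E assume "E \<in> range ?K"
  then obtain i where E: "E = ?K i" by blast
  show "csubspace E" "E \<subseteq> ?C"
    unfolding E using subspace_continuous_dual[of q p] unfolding csubspace_def by auto
next
  fix E E' assume "E \<in> range ?K" "E' \<in> range ?K"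
  then obtain i j where E: "E = ?K i" "E' = ?K j" by blast
  have "tensor_power (flag v k) q \<subseteq> tensor_power (flag v (max i j)) q" if "k \<le> max i j" for k
    unfolding power_flag_box by (rule cspan_mono[OF image_mono[OF box_mono[OF that]]])
  from this[OF max.cobounded1] this[OF max.cobounded2] have "?K (max i j) \<subseteq> E \<inter> E'"
    unfolding E by blast
  then show "\<exists>E''\<in>range ?K. E'' \<subseteq> E \<inter> E'" by blast
qed blast

text \<open>Surjectivity: a column-finite matrix is the matrix of a linear map from \<open>V\<^sup>\<otimes>\<^sup>q\<close> to \<open>V\<^sup>\<otimes>\<^sup>p\<close>, and
  \<open>functional_of_Hom\<close> turns it into a functional.\<close>

lemma completed_mixed_iso:
  "tvs_iso (completed_mixed_topology v p q) (colfin_topology p q) (mixed_matrix p q)"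
  unfolding completed_mixed_topology_def colfin_topology_def
proof (rule tvs_iso_zero_baseI[OF zero_base_completed_mixed zero_base_colfin])
  let ?C = "continuous_dual (mixed_topology v q p)"
  let ?K = "\<lambda>i. {l \<in> ?C. \<forall>x\<in>tensor_power (flag v i) q. \<forall>g\<in>dual_space p. l (x \<otimes> g) = 0}"
  have "clinear (mixed_matrix p q)"
    by (rule clinearI; rule ext; simp add: mixed_matrix_def split: prod.split)
  then show "linear_on ?C (mixed_matrix p q)" by (rule clinear_imp_linear_on)
  have "m \<in> mixed_matrix p q ` ?C" if m: "m \<in> colfin p q" for m
  proof -
    obtain h where h: "h \<in> Hom (tensor_power UNIV q) (tensor_power UNIV p)"
      "hom_matrix p q (\<lambda>b. pure (map v b)) tcrd h = m"
      using hom_matrix_surj[OF coord_power coord_power power_flag_box m] by metis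
    obtain l where "l \<in> ?C" "mixed_matrix p q l = hom_matrix p q (\<lambda>b. pure (map v b)) tcrd h"
      using functional_of_Hom[OF h(1)] by metis
    then show ?thesis using h(2) by (metis imageI)
  qed
  then show "bij_betw (mixed_matrix p q) ?C (colfin p q)"
    unfolding bij_betw_def using mixed_matrix_inj mixed_matrix_colfin by blast
  show "\<exists>E\<in>range ?K. mixed_matrix p q ` E \<subseteq> E'" if E': "E' \<in> colfin_base p q" for E'
  proof -
    obtain F where F: "E' = colfin_kernel p q F" "finite F" "F \<subseteq> {b. length b = q}"
      using E' unfolding colfin_base_def by blast
    obtain i where i: "F \<subseteq> box q i" using finite_subset_box[OF F(2,3)] by blast
    have "mixed_matrix p q l \<in> E'" if l: "l \<in> ?K i" for l
    proof -
      have "mixed_matrix p q l (a, b) = 0" if b: "b \<in> F" for a b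
      proof -
        have "pure (map v b) \<in> tensor_power (flag v i) q"
          unfolding power_flag_box by (rule cspan_base) (use b i in blast)
        then show ?thesis using l dcrd_in by (simp add: mixed_matrix_def)
      qed
      moreover have "mixed_matrix p q l \<in> colfin p q" using l by (intro mixed_matrix_colfin) simp
      ultimately show ?thesis by (simp add: F(1) colfin_kernel_def)
    qed
    then show ?thesis by (intro bexI[of _ "?K i"]) auto
  qed
  show "\<exists>E'\<in>colfin_base p q. {l \<in> ?C. mixed_matrix p q l \<in> E'} \<subseteq> E" if E: "E \<in> range ?K" for E
  proof -
    obtain i where i: "E = ?K i" using E by blast
    have "l \<in> ?K i" if l: "l \<in> ?C" "mixed_matrix p q l \<in> colfin_kernel p q (box q i)" for l
    proof -
      have z: "mixed_matrix p q l (a, b) = 0" if "b \<in> box q i" for a b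
        using l(2) that by (simp add: colfin_kernel_def)
      have "l (x \<otimes> g) = 0" if x: "x \<in> tensor_power (flag v i) q" and g: "g \<in> dual_space p" for x g
        by (rule functional_eq_0_on_span[OF l(1) box_length z g x[unfolded power_flag_box]])
      then show ?thesis using l(1) by simp
    qed
    moreover have "colfin_kernel p q (box q i) \<in> colfin_base p q"
      using finite_box box_length unfolding colfin_base_def by blast
    ultimately show ?thesis unfolding i by (intro bexI[of _ "colfin_kernel p q (box q i)"]) auto
  qed
qed

lemma is_linear_completed_mixed: "is_linear_topology (completed_mixed_topology v p q)"
  unfolding completed_mixed_topology_def by (rule is_linear_topology_zero_base[OF zero_base_completed_mixed])

lemma topspace_completed_mixed: "topspace (completed_mixed_topology v p q) = continuous_dual (mixed_topology v q p)"
  unfolding completed_mixed_topology_def by (rule topspace_zero_base[OF zero_base_completed_mixed])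

text \<open>The pure tensor of \<open>vs\<close> and \<open>fs\<close> corresponds to the linear map \<open>x \<mapsto> tensor_form fs x \<cdot> pure vs\<close> of rank at
  most one, and this map to the functional \<open>x \<otimes> g \<mapsto> tensor_form fs x \<cdot> g (pure vs)\<close>.\<close>

lemma shriek_product_iso:
  "\<exists>\<phi>. tvs_iso (completed_shriek (shriek_power V_top p) (shriek_power (dual_topology v) q))
        (completed_mixed_topology v p q) \<phi> \<and>
    (\<forall>vs fs. length vs = p \<and> length fs = q \<and> set fs \<subseteq> topspace (dual_topology v) \<longrightarrow>
      (\<forall>x\<in>tensor_power UNIV q. \<forall>g\<in>dual_space p.
         \<phi> (shriek_pure (shriek_power V_top p) (shriek_power (dual_topology v) q)
              (shriek_power_pure V_top vs) (shriek_power_pure (dual_topology v) fs)) (x \<otimes> g)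
           = tensor_form fs x * g (pure vs)))"
proof -
  let ?T = "completed_shriek (shriek_power V_top p) (shriek_power (dual_topology v) q)"
  obtain \<Phi> where \<Phi>: "tvs_iso ?T (colfin_topology p q) \<Phi>"
    "\<And>vs fs. length vs = p \<Longrightarrow> length fs = q \<Longrightarrow> set fs \<subseteq> topspace (dual_topology v) \<Longrightarrow>
      \<Phi> (shriek_pure (shriek_power V_top p) (shriek_power (dual_topology v) q)
          (shriek_power_pure V_top vs) (shriek_power_pure (dual_topology v) fs)) = pure_matrix vs fs"
    using completed_shriek_pure_matrix[of p q] by metis
  obtain \<Psi> where \<Psi>: "tvs_iso (colfin_topology p q) (completed_mixed_topology v p q) \<Psi>"
    "\<And>l. l \<in> topspace (completed_mixed_topology v p q) \<Longrightarrow> \<Psi> (mixed_matrix p q l) = l"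
    using tvs_iso_inverse[OF completed_mixed_iso is_linear_completed_mixed] by metis
  have "\<Psi> (pure_matrix vs fs) (x \<otimes> g) = tensor_form fs x * g (pure vs)"
    if vs: "length vs = p" and fs: "length fs = q" "set fs \<subseteq> topspace (dual_topology v)"
      and x: "x \<in> tensor_power UNIV q" and g: "g \<in> dual_space p" for vs fs x g
  proof -
    let ?h = "\<lambda>x. tensor_form fs x *\<^sub>C pure vs"
    have cl: "\<forall>f\<in>set fs. clinear f" using fs(2) topspace_dual by blast
    have tf: "tensor_form fs \<in> Hom (tensor_power UNIV q) UNIV"
      using tensor_form_characterization(1)[OF cl] fs(1) by simp
    have pv: "pure vs \<in> tensor_power UNIV p" using vs by (simp add: pure_in_tensor_power)
    have h: "?h \<in> Hom (tensor_power UNIV q) (tensor_power UNIV p)"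
      unfolding Hom_def mem_Collect_eq
    proof (intro conjI)
      show "linear_on (tensor_power UNIV q) ?h"
        using linear_on_add[OF Hom_linear[OF tf]] linear_on_scale[OF Hom_linear[OF tf]]
        by (simp add: linear_on_def scaleC_add_left scaleC_scaleC)
      show "?h ` tensor_power UNIV q \<subseteq> tensor_power UNIV p"
        using csubspace_scale[OF subspace_tensor_power pv] by blast
    qed (simp add: Hom_off[OF tf])
    obtain l where l: "l \<in> continuous_dual (mixed_topology v q p)"
      "\<And>x g. x \<in> tensor_power UNIV q \<Longrightarrow> g \<in> dual_space p \<Longrightarrow> l (x \<otimes> g) = g (?h x)"
      "mixed_matrix p q l = hom_matrix p q (\<lambda>b. pure (map v b)) tcrd ?h"
      using functional_of_Hom[OF h] by metis
    have "hom_matrix p q (\<lambda>b. pure (map v b)) tcrd ?h = pure_matrix vs fs"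
      unfolding hom_matrix_def pure_matrix_def
      using vs fs(1) by (auto simp: fun_eq_iff clinear_scale[OF tcrd(1)] tcrd(2)
          tensor_form_characterization(2)[OF cl])
    then have "\<Psi> (pure_matrix vs fs) = l"
      using \<Psi>(2)[of l] l(1,3) by (simp add: topspace_completed_mixed)
    moreover have "g (?h x) = tensor_form fs x * g (pure vs)"
    proof -
      have "g \<in> Hom (tensor_power UNIV p) UNIV" using g topspace_dual_power by simp
      from linear_on_scale[OF Hom_linear[OF this] pv] show ?thesis by simp
    qed
    ultimately show ?thesis using l(2)[OF x g] by simp
  qed
  then show ?thesis
    using tvs_iso_compose[OF \<Phi>(1) \<Psi>(1)] \<Phi>(2) by (intro exI[of _ "\<lambda>x. \<Psi> (\<Phi> x)"]) auto
qed

subsection \<open>Endomorphisms\<close>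

lemma gl_iso:
  "\<exists>\<phi>. tvs_iso (completed_shriek V_top (dual_topology v)) (gl_topology v) \<phi> \<and>
    (\<forall>w. \<forall>f\<in>topspace (dual_topology v). \<phi> (shriek_pure V_top (dual_topology v) w f) = (\<lambda>x. f x *\<^sub>C w))"
proof -
  let ?M = "hom_matrix 1 1 (\<lambda>b. v (hd b)) (\<lambda>b. crd (hd b))"
  have gl: "tvs_iso (gl_topology v) (colfin_topology 1 1) ?M" "is_linear_topology (gl_topology v)"
    "topspace (gl_topology v) = Hom UNIV UNIV"
    unfolding gl_topology_def
    by (rule Hom_iso[OF coord_V coord_V flag_box] is_linear_Hom[OF coord_V coord_V flag_box]
        topspace_Hom[OF coord_V coord_V flag_box])+
  obtain \<Psi> where \<Psi>: "tvs_iso (colfin_topology 1 1) (gl_topology v) \<Psi>"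
    "\<And>f. f \<in> topspace (gl_topology v) \<Longrightarrow> \<Psi> (?M f) = f"
    using tvs_iso_inverse[OF gl(1,2)] by metis
  obtain \<Phi> where \<Phi>: "tvs_iso (completed_shriek V_top (dual_topology v)) (colfin_topology (1 + 0) (0 + 1)) \<Phi>"
    "\<And>x y. x \<in> topspace V_top \<Longrightarrow> y \<in> topspace (dual_topology v) \<Longrightarrow>
       \<Phi> (shriek_pure V_top (dual_topology v) x y) = kron 1 0 (V_column x) (dual_row y)"
    using completed_shriek_colfin[OF is_linear_V is_linear_dual column_iso[OF coord_V] dual_iso] by metis
  have "\<Psi> (kron 1 0 (V_column w) (dual_row f)) = (\<lambda>x. f x *\<^sub>C w)"
    if f: "f \<in> topspace (dual_topology v)" for w f
  proof -
    have cl: "clinear f" using f topspace_dual by blast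
    have "kron 1 0 (V_column w) (dual_row f) = ?M (\<lambda>x. f x *\<^sub>C w)"
    proof (rule ext, clarify)
      fix a b
      show "kron 1 0 (V_column w) (dual_row f) (a, b) = ?M (\<lambda>x. f x *\<^sub>C w) (a, b)"
        by (cases a) (simp_all add: kron_def column_def[OF coord_V] hom_matrix_def take_drop_1
            clinear_scale[OF crd(1)] del: One_nat_def)
    qed
    moreover have "(\<lambda>x. f x *\<^sub>C w) \<in> Hom UNIV UNIV"
      by (simp add: Hom_def linear_on_def clinear_add[OF cl] clinear_scale[OF cl] scaleC_add_left scaleC_scaleC)
    ultimately show ?thesis using \<Psi>(2) gl(3) by simp
  qed
  moreover have "tvs_iso (completed_shriek V_top (dual_topology v)) (gl_topology v) (\<lambda>x. \<Psi> (\<Phi> x))"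
    by (rule tvs_iso_compose[OF \<Phi>(1)[unfolded add_0_right add_0] \<Psi>(1)])
  ultimately show ?thesis using \<Phi>(2) by (intro exI[of _ "\<lambda>x. \<Psi> (\<Phi> x)"]) simp
qed

end

theorem lemma4p2:
  fixes v :: "nat \<Rightarrow> 'v::complex_vector" and p q :: nat
  assumes "inj v"
    and "\<not> complex_vector.dependent (range v)"
    and "complex_vector.span (range v) = UNIV"
  shows
    "let V = (discrete_topology UNIV :: 'v topology); VV = dual_topology v in
      (\<exists>\<phi>. tvs_iso (completed_star (star_power V p) (star_power VV q)) (mixed_topology v p q) \<phi> \<and>
         (\<forall>vs fs. length vs = p \<and> length fs = q \<and> set fs \<subseteq> topspace VV \<longrightarrow>
            \<phi> (star_pure (star_power V p) (star_power VV q)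
                 (star_power_pure V vs) (star_power_pure VV fs))
              = pure vs \<otimes> tensor_form fs)) \<and>
      (\<exists>\<phi>. tvs_iso (completed_shriek (shriek_power V p) (shriek_power VV q))
              (completed_mixed_topology v p q) \<phi> \<and>
         (\<forall>vs fs. length vs = p \<and> length fs = q \<and> set fs \<subseteq> topspace VV \<longrightarrow>
            (\<forall>x\<in>tensor_power UNIV q. \<forall>g\<in>topspace (dual_power_topology v p).
               \<phi> (shriek_pure (shriek_power V p) (shriek_power VV q)
                    (shriek_power_pure V vs) (shriek_power_pure VV fs)) (x \<otimes> g)
                 = tensor_form fs x * g (pure vs)))) \<and>
      (\<exists>\<phi>. tvs_iso (completed_shriek V VV) (gl_topology v) \<phi> \<and>
         (\<forall>w. \<forall>f\<in>topspace VV. \<phi> (shriek_pure V VV w f) = (\<lambda>x. f x *\<^sub>C w)))"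
proof -
  interpret countable_basis v using assms by unfold_locales
  show ?thesis
    unfolding Let_def by (intro conjI star_product_iso shriek_product_iso gl_iso)
qed

end
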